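(* Let $\mathcal A$ be a finite alphabet, let $\mathcal G$ be a nonempty countable (finite or infinite) collection of nonempty finite words over $\mathcal A$, and let $X=X(\mathcal G)$ be the associated coded shift. Fix an arbitrary enumeration $g_1,g_2,\ldots$ of $\mathcal G$ (ending if $\mathcal G$ is finite), let $F_m$ consist of the first $m$ generators (or all of $\mathcal G$ if the list has already ended), and put $X_m=X(F_m)$. Suppose that $\mathcal G$ uniquely represents $X_{\mathrm{con}}(\mathcal G)$. Then, for every $\varphi\in C(X)$, \[ P_{\rm seq}(\varphi,\mathcal G)=\sup_{m\ge1}P_{X_m}(\varphi)=\lim_{m\to\infty}P_{X_m}(\varphi). \] Consequently, for every $\varphi\in C(X)$, \[ P_X(\varphi)=\lim_{m\to\infty}P_{X_m}(\varphi)\quad\Longleftrightarrow\quad P_X(\varphi)=P_{\rm seq}(\varphi,\mathcal G). \] In particular, the limit $\lim_{m\to\infty}P_{X_m}(\varphi)$ is independent of the enumeration of $\mathcal G$.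
   Context: $\mathcal A^{\mathbb Z}$ is the full two-sided shift (product topology) with left shift $\sigma$. For a nonempty countable collection $\mathcal G$ of nonempty finite words, the concatenation set $X_{\mathrm{con}}(\mathcal G)\subset\mathcal A^{\mathbb Z}$ is the set of all points obtained by bi-infinite concatenation of words in $\mathcal G$ (with any position of the origin), and the coded shift is its closure $X(\mathcal G)=\overline{X_{\mathrm{con}}(\mathcal G)}$. A pointed $\mathcal G$-representation of $x\in X_{\mathrm{con}}(\mathcal G)$ is a pair $((g_j)_{j\in\mathbb Z},k)$ with $g_j\in\mathcal G$, $0\le k<|g_0|$, and $x=\sigma^k(\cdots g_{-1}.g_0g_1\cdots)$, where the dot marks coordinate zero (i.e. $g_0$ starts at coordinate $0$). $\mathcal G$ uniquely represents $X_{\mathrm{con}}(\mathcal G)$ if every point of $X_{\mathrm{con}}(\mathcal G)$ has exactly one pointed $\mathcal G$-representation. (Under this hypothesis $X_{\mathrm{con}}(\mathcal G)$ is a shift-invariant Borel set.) $C(X)$ is the set of continuous functions $X\to\mathbb R$. For a subshift $Z$, $\mathcal M_\sigma(Z)$ is the set of $\sigma$-invariant Borel probability measures on $Z$, and $h_\mu(\sigma)$ is Kolmogorov–Sinai entropy. For a subshift $Z\subseteq X$ and $\varphi\in C(X)$, \[ P_Z(\varphi)=\sup_{\mu\in\mathcal M_\sigma(Z)}\Bigl(h_\mu(\sigma)+\int\varphi\,d\mu\Bigr), \] and the sequential pressure is \[ P_{\rm seq}(\varphi,\mathcal G)=\sup\Bigl\{h_\mu(\sigma)+\int\varphi\,d\mu:\mu\in\mathcal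 M_\sigma(X),\ \mu(X_{\mathrm{con}}(\mathcal G))=1\Bigr\}. \] *)

theory Defs
  imports "HOL-Probability.Probability"
begin

text \<open>
  The alphabet is a type of class \<open>finite\<close> carrying the discrete topology, so that the
  topology on \<open>int \<Rightarrow> 'a\<close> from \<^theory>\<open>HOL-Analysis.Function_Topology\<close> is the topology of the
  full two-sided shift and \<^const>\<open>borel\<close> is its Borel \<open>\<sigma>\<close>-algebra. Words are lists.
\<close>

definition left_shift :: "(int \<Rightarrow> 'a) \<Rightarrow> int \<Rightarrow> 'a" where
  "left_shift x = (\<lambda>n. x (n + 1))"

text \<open>The coordinate at which the word \<open>g j\<close> starts in \<open>\<cdots> g (-1) . g 0 g 1 \<cdots>\<close>.\<close>

definition word_start :: "(int \<Rightarrow> 'a list) \<Rightarrow> int \<Rightarrow> int" where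
  "word_start g j =
     (if 0 \<le> j then (\<Sum>i\<in>{0..<j}. int (length (g i))) else - (\<Sum>i\<in>{j..<0}. int (length (g i))))"

text \<open>
  Meaningful when all words are nonempty: then the half-open intervals
  \<open>[word_start g j, word_start g (j + 1))\<close> tile the integers.
\<close>

definition word_index :: "(int \<Rightarrow> 'a list) \<Rightarrow> int \<Rightarrow> int" where
  "word_index g n = (THE j. word_start g j \<le> n \<and> n < word_start g (j + 1))"

definition biconcat :: "(int \<Rightarrow> 'a list) \<Rightarrow> int \<Rightarrow> 'a" where
  "biconcat g n = g (word_index g n) ! nat (n - word_start g (word_index g n))"

definition con_set :: "'a list set \<Rightarrow> (int \<Rightarrow> 'a) set" where
  "con_set G = {(\<lambda>n. biconcat g (n + k)) |g k. range g \<subseteq> G}"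

definition coded_shift :: "'a::topological_space list set \<Rightarrow> (int \<Rightarrow> 'a) set" where
  "coded_shift G = closure (con_set G)"

definition pointed_representations ::
    "'a list set \<Rightarrow> (int \<Rightarrow> 'a) \<Rightarrow> ((int \<Rightarrow> 'a list) \<times> nat) set" where
  "pointed_representations G x =
     {(g, k). range g \<subseteq> G \<and> k < length (g 0) \<and> x = (left_shift ^^ k) (biconcat g)}"

definition uniquely_represents :: "'a list set \<Rightarrow> bool" where
  "uniquely_represents G \<longleftrightarrow> (\<forall>x\<in>con_set G. \<exists>!r. r \<in> pointed_representations G x)"

text \<open>
  Generators are listed without repetition as \<open>e 0, e 1, \<dots>\<close>; if \<open>G\<close> is finite, the list ends
  after \<open>card G\<close> entries and the remaining values of \<open>e\<close> are irrelevant.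
\<close>

definition enum_indices :: "'a set \<Rightarrow> nat set" where
  "enum_indices G = {i. finite G \<longrightarrow> i < card G}"

definition enumerates :: "(nat \<Rightarrow> 'a) \<Rightarrow> 'a set \<Rightarrow> bool" where
  "enumerates e G \<longleftrightarrow> bij_betw e (enum_indices G) G"

definition first_generators :: "'a set \<Rightarrow> (nat \<Rightarrow> 'a) \<Rightarrow> nat \<Rightarrow> 'a set" where
  "first_generators G e m = e ` {i \<in> enum_indices G. i < m}"

definition finite_partitions :: "'b measure \<Rightarrow> 'b set set set" where
  "finite_partitions M = {P. finite P \<and> P \<subseteq> sets M \<and> partition_on (space M) P}"

definition partition_entropy :: "'b measure \<Rightarrow> 'b set set \<Rightarrow> real" where
  "partition_entropy M P = - (\<Sum>A\<in>P. measure M A * ln (measure M A))"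

text \<open>The common refinement of \<open>P, T\<^bsup>-1\<^esup> P, \<dots>, T\<^bsup>-(n-1)\<^esup> P\<close>, without empty pieces.\<close>

definition iterated_join :: "'b measure \<Rightarrow> ('b \<Rightarrow> 'b) \<Rightarrow> 'b set set \<Rightarrow> nat \<Rightarrow> 'b set set" where
  "iterated_join M T P n =
     {{x \<in> space M. \<forall>i<n. (T ^^ i) x \<in> f i} |f. \<forall>i<n. f i \<in> P} - {{}}"

text \<open>
  For a measure-preserving \<open>T\<close> on a probability space the limit below exists, by subadditivity.
\<close>

definition entropy_of_partition :: "'b measure \<Rightarrow> ('b \<Rightarrow> 'b) \<Rightarrow> 'b set set \<Rightarrow> real" where
  "entropy_of_partition M T P = lim (\<lambda>n. partition_entropy M (iterated_join M T P n) / real n)"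

definition ks_entropy :: "'b measure \<Rightarrow> ('b \<Rightarrow> 'b) \<Rightarrow> ereal" where
  "ks_entropy M T = (SUP P\<in>finite_partitions M. ereal (entropy_of_partition M T P))"

text \<open>
  Measures on \<open>Z\<close> itself (\<open>space \<mu> = Z\<close>), so that integrals only see the values of a potential
  on \<open>Z\<close>, and a function that is continuous on \<open>Z\<close> is measurable whatever its values elsewhere.
\<close>

definition invariant_measures :: "(int \<Rightarrow> 'a::topological_space) set \<Rightarrow> (int \<Rightarrow> 'a) measure set" where
  "invariant_measures Z =
     {\<mu>. sets \<mu> = sets (restrict_space borel Z) \<and> prob_space \<mu> \<and>
         left_shift \<in> \<mu> \<rightarrow>\<^sub>M \<mu> \<and> distr \<mu> \<mu> left_shift = \<mu>}"

definition free_energy :: "((int \<Rightarrow> 'a) \<Rightarrow> real) \<Rightarrow> (int \<Rightarrow> 'a) measure \<Rightarrow> ereal" where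
  "free_energy \<phi> \<mu> = ks_entropy \<mu> left_shift + ereal (\<integral>x. \<phi> x \<partial>\<mu>)"

definition pressure :: "(int \<Rightarrow> 'a::topological_space) set \<Rightarrow> ((int \<Rightarrow> 'a) \<Rightarrow> real) \<Rightarrow> ereal" where
  "pressure Z \<phi> = (SUP \<mu>\<in>invariant_measures Z. free_energy \<phi> \<mu>)"

text \<open>
  If \<open>G\<close> uniquely represents \<open>con_set G\<close>, that set is Borel; in general \<^const>\<open>emeasure\<close> is 0 on
  non-measurable sets, so the condition below includes measurability.
\<close>

definition seq_pressure :: "((int \<Rightarrow> 'a::topological_space) \<Rightarrow> real) \<Rightarrow> 'a list set \<Rightarrow> ereal" where
  "seq_pressure \<phi> G =
     (SUP \<mu>\<in>{\<mu> \<in> invariant_measures (coded_shift G). emeasure \<mu> (con_set G) = 1}. free_energy \<phi> \<mu>)"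

end

theory Submission
  imports Defs
begin

text \<open>
  Every measure on \<open>X_m\<close> is carried by \<open>con_set G\<close>, so only \<open>P_seq \<le> c\<close> for \<open>c = sup_m P_{X_m}\<close> needs an
  argument. Let \<open>\<psi> w\<close> be the least Birkhoff sum of \<open>\<phi>\<close> over the cylinder of a block \<open>w\<close>, a concatenation
  of generators that is just long enough to have length at least \<open>N\<close>. If the weights
  \<open>exp (\<psi> w - c |w|)\<close> of finitely many blocks had a sum above 1, then the sum with some \<open>s > c\<close> in
  place of \<open>c\<close> would be 1, and concatenating independent blocks with this distribution
  would give an invariant measure on some \<open>X_m\<close> with the Gibbs property, hence of free energy at
  least \<open>s\<close>. So these weights are subprobabilities. The induced weights on words, with single
  letters allowed as fillers at a small price, have a sum of at most 1 over each length. For an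
  invariant measure carried by \<open>con_set G\<close> most orbit segments are, up to boundary pieces of bounded
  length, concatenations of blocks; comparing the entropy with the cross entropy relative to the
  weights bounds the free energy by \<open>c\<close> up to an error that vanishes as \<open>N\<close> grows.

  Measurability of \<open>con_set G\<close> rests on Lusin's theorem that an injective continuous image of a
  sequence space is Borel.
\<close>

section \<open>Injective images of sequence spaces\<close>

text \<open>Blocks are needed because Birkhoff sums of a continuous \<open>\<phi>\<close> over one
  cylinder differ by a small fraction of its length only when the cylinder is long, whereas
  generators may consist of a single letter. The least sum serves as weight so that the lower bound
  for the concatenation measure loses nothing; the loss of \<epsilon> per letter occurs only in the
  upper bound, where \<epsilon> is arbitrary. The obstacle is that a finite window of symbols need
  not show where the blocks begin. Under unique representation the cuts between generators are
  functions of the whole two-sided point, and Lusin's theorem makes them Borel. The lower bound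
  therefore uses a partition that records the cuts as well as the symbols. As
  \<open>ks_entropy\<close> ranges over all finite Borel partitions, this one is admissible;
  conversely the upper bound has to be proved for an arbitrary one, by approximating it with
  cylinders. Entropy and cross entropy are compared in the mean, through ln t \<le> t - 1. This
  works for every invariant measure, ergodic or not, and leaves boundary errors that vanish after
  division by n.\<close>

lemma open_coordinate_preimage:
  "open W \<Longrightarrow> open {f :: 'a \<Rightarrow> 'b::topological_space. f i \<in> W}"
  using product_topology_basis'[where I = "{i}" and U = "\<lambda>_. W" and x = "\<lambda>i. i"] by simp

text \<open>The class hierarchy leads through \<open>t0_space\<close> and \<open>t1_space\<close> to
  \<open>t2_space\<close>. The Hausdorff property of the sequence space is what
  \<open>borel_injective_image\<close> asks of its target and what makes compact sets of sequences
  closed.\<close>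

instance "fun" :: (type, t0_space) t0_space
proof
  fix x y :: "'a \<Rightarrow> 'b"
  assume "x \<noteq> y"
  then obtain i where "x i \<noteq> y i" by auto
  then obtain U where "open U" "\<not> (x i \<in> U \<longleftrightarrow> y i \<in> U)" using separation_t0[of "x i" "y i"] by blast
  then show "\<exists>U. open U \<and> \<not> (x \<in> U \<longleftrightarrow> y \<in> U)"
    using open_coordinate_preimage[of U i] by blast
qed

instance "fun" :: (type, t1_space) t1_space
proof
  fix x y :: "'a \<Rightarrow> 'b"
  assume "x \<noteq> y"
  then obtain i where "x i \<noteq> y i" by auto
  then obtain U where "open U" "x i \<in> U" "y i \<notin> U" using separation_t1[of "x i" "y i"] by blast
  then show "\<exists>U. open U \<and> x \<in> U \<and> y \<notin> U"
    using open_coordinate_preimage[of U i] by blast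
qed

instance "fun" :: (type, t2_space) t2_space
proof
  fix x y :: "'a \<Rightarrow> 'b"
  assume "x \<noteq> y"
  then obtain i where "x i \<noteq> y i" by auto
  then obtain U V where "open U" "open V" "x i \<in> U" "y i \<in> V" "U \<inter> V = {}"
    using hausdorff[of "x i" "y i"] by blast
  then show "\<exists>U V. open U \<and> open V \<and> x \<in> U \<and> y \<in> V \<and> U \<inter> V = {}"
    using open_coordinate_preimage[of U i] open_coordinate_preimage[of V i]
    by (intro exI[of _ "{f. f i \<in> U}"] exI[of _ "{f. f i \<in> V}"]) auto
qed

definition seqs_extending :: "'b set \<Rightarrow> 'b list \<Rightarrow> (nat \<Rightarrow> 'b) set" where
  "seqs_extending C s = {g. range g \<subseteq> C \<and> map g [0..<length s] = s}"

definition borel_separated :: "'x::topological_space set \<Rightarrow> 'x set \<Rightarrow> bool" where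
  "borel_separated A B \<longleftrightarrow> (\<exists>S\<in>sets borel. A \<subseteq> S \<and> S \<inter> B = {})"

text \<open>Continuity for the product of discrete topologies on \<open>C\<close>, phrased through
  prefixes so that the type of the entries needs no topology.\<close>

definition prefix_continuous :: "'b set \<Rightarrow> ((nat \<Rightarrow> 'b) \<Rightarrow> 'x::topological_space) \<Rightarrow> bool" where
  "prefix_continuous C f \<longleftrightarrow>
     (\<forall>g U. range g \<subseteq> C \<longrightarrow> open U \<longrightarrow> f g \<in> U \<longrightarrow>
        (\<exists>n. \<forall>g'. range g' \<subseteq> C \<longrightarrow> (\<forall>i<n. g' i = g i) \<longrightarrow> f g' \<in> U))"

text \<open>For fixed i the intersection of the \<open>S i j\<close> over j separates
  \<open>A i\<close> from every \<open>B j\<close>; the union of these intersections over i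
  separates the two unions.\<close>

lemma borel_separated_UN:
  assumes "countable I" "countable J" "\<And>i j. i \<in> I \<Longrightarrow> j \<in> J \<Longrightarrow> borel_separated (A i) (B j)"
  shows "borel_separated (\<Union>i\<in>I. A i) (\<Union>j\<in>J. B j)"
proof -
  from assms(3) obtain S where S: "\<And>i j. i \<in> I \<Longrightarrow> j \<in> J \<Longrightarrow> S i j \<in> sets borel \<and> A i \<subseteq> S i j \<and> S i j \<inter> B j = {}"
    unfolding borel_separated_def by metis
  show ?thesis unfolding borel_separated_def
  proof (cases "J = {}")
    case True
    then show "\<exists>S\<in>sets borel. (\<Union>i\<in>I. A i) \<subseteq> S \<and> S \<inter> (\<Union>j\<in>J. B j) = {}"
      by (intro bexI[of _ UNIV]) auto
  next
    case False
    have "(\<Union>i\<in>I. \<Inter>j\<in>J. S i j) \<in> sets borel"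
      using assms(1,2) False S by (intro sets.countable_UN' sets.countable_INT' image_subsetI) auto
    moreover have "(\<Union>i\<in>I. A i) \<subseteq> (\<Union>i\<in>I. \<Inter>j\<in>J. S i j)" using S by blast
    moreover have "(\<Union>i\<in>I. \<Inter>j\<in>J. S i j) \<inter> (\<Union>j\<in>J. B j) = {}" using S by blast
    ultimately show "\<exists>S\<in>sets borel. (\<Union>i\<in>I. A i) \<subseteq> S \<and> S \<inter> (\<Union>j\<in>J. B j) = {}" by blast
  qed
qed

lemma seqs_extending_Un:
  "seqs_extending C s = (\<Union>c\<in>C. seqs_extending C (s @ [c]))"
  unfolding seqs_extending_def by (auto simp: map_eq_conv nth_append)

lemma prefix_of_seqs_extending:
  assumes "g' \<in> seqs_extending C (map g [0..<n])" "i < n"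
  shows "g' i = g i"
proof -
  have "map g' [0..<n] = map g [0..<n]" using assms unfolding seqs_extending_def by simp
  then show ?thesis using assms(2) by (simp add: map_eq_conv)
qed

text \<open>Inseparability is inherited: if two cylinders have inseparable images, then by
  \<open>borel_separated_UN\<close> so do some one-step extensions of them. Iterating yields two
  sequences \<open>g\<close> and \<open>h\<close> with all their cylinders inseparable. Their images
  differ, have disjoint open neighbourhoods, and continuity puts the images of long cylinders into
  these neighbourhoods, which separates them.\<close>

lemma lusin_separation:
  fixes f :: "(nat \<Rightarrow> 'b) \<Rightarrow> 'x::t2_space"
  assumes C: "countable C" and cont: "prefix_continuous C f"
    and disj: "f ` seqs_extending C s \<inter> f ` seqs_extending C t = {}"
  shows "borel_separated (f ` seqs_extending C s) (f ` seqs_extending C t)"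
proof (rule ccontr)
  assume nsep: "\<not> ?thesis"
  define bad where "bad = (\<lambda>p. \<not> borel_separated (f ` seqs_extending C (fst p)) (f ` seqs_extending C (snd p)))"
  have step: "\<exists>q. bad q \<and> (\<exists>a\<in>C. \<exists>b\<in>C. q = (fst p @ [a], snd p @ [b]))" if "bad p" for p
  proof (rule ccontr)
    assume "\<not> ?thesis"
    then have "\<And>a b. a \<in> C \<Longrightarrow> b \<in> C \<Longrightarrow> borel_separated (f ` seqs_extending C (fst p @ [a])) (f ` seqs_extending C (snd p @ [b]))"
      unfolding bad_def by auto
    from borel_separated_UN[OF C C this] that show False
      unfolding bad_def by (simp add: seqs_extending_Un[of C "fst p"] seqs_extending_Un[of C "snd p"] image_UN)
  qed
  have b0: "bad (s, t)" using nsep by (simp add: bad_def)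
  obtain P where P0: "P 0 = (s, t)" and Pbad: "\<And>n. bad (P n)" and
    PS: "\<And>n. \<exists>a\<in>C. \<exists>b\<in>C. P (Suc n) = (fst (P n) @ [a], snd (P n) @ [b])"
    using dependent_nat_choice[of "\<lambda>n p. bad p \<and> (n = 0 \<longrightarrow> p = (s, t))"
        "\<lambda>n p q. \<exists>a\<in>C. \<exists>b\<in>C. q = (fst p @ [a], snd p @ [b])"] b0 step
    by (metis nat.discI)
  from PS obtain a b where ab: "\<And>n. a n \<in> C" "\<And>n. b n \<in> C"
    "\<And>n. P (Suc n) = (fst (P n) @ [a n], snd (P n) @ [b n])" by metis
  have Pn: "P n = (s @ map a [0..<n], t @ map b [0..<n])" for n
    by (induction n) (auto simp: P0 ab)
  \<comment> \<open>\<open>gl u c\<close> is the sequence that begins with the word \<open>u\<close>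
    and goes on with \<open>c\<close>.\<close>
  define gl where "gl = (\<lambda>u c i. if i < length (u :: 'b list) then u ! i else (c (i - length u) :: 'b))"
  have glmap: "map (gl u c) [0..<length u + n] = u @ map c [0..<n]" for u c n
    by (rule nth_equalityI) (auto simp: gl_def nth_append)
  \<comment> \<open>An empty image is separated from everything, so both cylinders are inhabited and
    their words consist of elements of \<open>C\<close>.\<close>
  have sC: "set s \<subseteq> C" and tC: "set t \<subseteq> C"
  proof -
    have "seqs_extending C s \<noteq> {}" "seqs_extending C t \<noteq> {}"
      using nsep unfolding borel_separated_def by force+
    then show "set s \<subseteq> C" "set t \<subseteq> C"
      unfolding seqs_extending_def
      by (smt (verit, best) emptyE equals0I image_subset_iff list.set_map mem_Collect_eq range_subsetD subsetI imageE)+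
  qed
  have glC: "range (gl u c) \<subseteq> C" if "set u \<subseteq> C" "\<And>n. c n \<in> C" for u c
    using that by (auto simp: gl_def)
  define g h where "g = gl s a" and "h = gl t b"
  have gC: "range g \<subseteq> C" and hC: "range h \<subseteq> C"
    using glC sC tC ab unfolding g_def h_def by blast+
  have gs: "g \<in> seqs_extending C s" and ht: "h \<in> seqs_extending C t"
    using gC hC glmap[of s a 0] glmap[of t b 0] unfolding g_def h_def seqs_extending_def by auto
  have Pn': "P n = (map g [0..<length s + n], map h [0..<length t + n])" for n
    using Pn glmap g_def h_def by simp
  have "f g \<noteq> f h" using disj gs ht by blast
  then obtain U V where UV: "open U" "open V" "f g \<in> U" "f h \<in> V" "U \<inter> V = {}"
    using hausdorff by metis
  obtain n where n: "\<forall>g'. range g' \<subseteq> C \<longrightarrow> (\<forall>i<n. g' i = g i) \<longrightarrow> f g' \<in> U"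
    using cont gC UV unfolding prefix_continuous_def by metis
  obtain m where m: "\<forall>g'. range g' \<subseteq> C \<longrightarrow> (\<forall>i<m. g' i = h i) \<longrightarrow> f g' \<in> V"
    using cont hC UV unfolding prefix_continuous_def by metis
  let ?k = "n + m"
  have "f ` seqs_extending C (map g [0..<length s + ?k]) \<subseteq> U"
  proof (rule image_subsetI)
    fix g' assume g': "g' \<in> seqs_extending C (map g [0..<length s + ?k])"
    then show "f g' \<in> U" using n prefix_of_seqs_extending[OF g']
      by (simp add: seqs_extending_def)
  qed
  moreover have "f ` seqs_extending C (map h [0..<length t + ?k]) \<subseteq> V"
  proof (rule image_subsetI)
    fix g' assume g': "g' \<in> seqs_extending C (map h [0..<length t + ?k])"
    then show "f g' \<in> V" using m prefix_of_seqs_extending[OF g']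
      by (simp add: seqs_extending_def)
  qed
  ultimately have "borel_separated (f ` seqs_extending C (fst (P ?k))) (f ` seqs_extending C (snd (P ?k)))"
    unfolding borel_separated_def Pn' using UV by (intro bexI[of _ U]) auto
  with Pbad show False unfolding bad_def by blast
qed

text \<open>Images of different cylinders of the same length are disjoint by injectivity, hence
  Borel separated, so each can be enclosed in a Borel set \<open>B s\<close> inside its closure such
  that the \<open>B s\<close> of one length remain disjoint. A point that meets these sets along all
  levels selects one infinite branch, and continuity together with the closures forces it to be the
  image of that branch.\<close>

theorem borel_injective_image:
  fixes f :: "(nat \<Rightarrow> 'b) \<Rightarrow> 'x::t2_space"
  assumes C: "countable C" and cont: "prefix_continuous C f"
    and inj: "inj_on f {g. range g \<subseteq> C}"
  shows "f ` {g. range g \<subseteq> C} \<in> sets borel"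
proof -
  define A where "A = (\<lambda>s. f ` seqs_extending C s)"
  define W where "W = (\<lambda>n. {s \<in> lists C. length s = n})"
  have cW: "countable (W n)" for n
    using countable_lists[OF C] unfolding W_def by (rule countable_subset[rotated]) (auto simp: lists_eq_set)
  have sub: "seqs_extending C s \<subseteq> {g. range g \<subseteq> C}" for s unfolding seqs_extending_def by auto
  have sep: "borel_separated (A s) (A t)" if "s \<noteq> t" "length s = length t" for s t
    unfolding A_def
  proof (rule lusin_separation[OF C cont])
    have "seqs_extending C s \<inter> seqs_extending C t = {}" using that unfolding seqs_extending_def by auto
    then show "f ` seqs_extending C s \<inter> f ` seqs_extending C t = {}"
      using inj sub by (metis image_empty inj_on_image_Int)
  qed
  then obtain S where S: "\<And>s t. s \<noteq> t \<Longrightarrow> length s = length t \<Longrightarrow>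
      S s t \<in> sets borel \<and> A s \<subseteq> S s t \<and> S s t \<inter> A t = {}"
    unfolding borel_separated_def by metis
  \<comment> \<open>Subtracting \<open>S t s\<close> is what makes \<open>B s\<close> and
    \<open>B t\<close> disjoint for different words of equal length.\<close>
  define B where "B = (\<lambda>s. closure (A s) \<inter> ((\<Inter>t\<in>W (length s) - {s}. S s t - S t s) \<inter> UNIV))"
  have AB: "A s \<subseteq> B s" if "s \<in> W n" for s n
  proof -
    have "A s \<subseteq> S s t - S t s" if "t \<in> W (length s) - {s}" for t
      using that S[of s t] S[of t s] unfolding W_def by auto
    then show ?thesis unfolding B_def using closure_subset[of "A s"] by blast
  qed
  have Bdisj: "s = t" if "x \<in> B s" "x \<in> B t" "s \<in> W n" "t \<in> W n" for s t n x
    using that unfolding B_def W_def by auto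
  have Bb: "B s \<in> sets borel" for s
  proof (cases "W (length s) - {s} = {}")
    case True
    show ?thesis unfolding B_def True by simp
  next
    case False
    have "(\<Inter>t\<in>W (length s) - {s}. S s t - S t s) \<in> sets borel"
      using False S cW[of "length s"]
      by (intro sets.countable_INT' sets.Diff) (auto simp: W_def)
    then show ?thesis unfolding B_def by auto
  qed
  \<comment> \<open>The sets \<open>B\<close> are not nested, so all prefixes of the chosen word are
    required to contain the point; this makes the words of the different levels coherent.\<close>
  have eq: "f ` {g. range g \<subseteq> C} = (\<Inter>n. \<Union>s\<in>W n. \<Inter>k\<in>{..n}. B (take k s))"
  proof (intro equalityI subsetI)
    fix x assume "x \<in> f ` {g. range g \<subseteq> C}"
    then obtain g where g: "range g \<subseteq> C" "x = f g" by auto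
    have "x \<in> B (map g [0..<k])" for k
    proof -
      have "g \<in> seqs_extending C (map g [0..<k])" using g unfolding seqs_extending_def by simp
      moreover have "map g [0..<k] \<in> W k" using g(1) range_subsetD[OF g(1)] unfolding W_def by auto
      ultimately show ?thesis using AB g(2) unfolding A_def by blast
    qed
    then have "x \<in> (\<Inter>k\<in>{..n}. B (take k (map g [0..<n])))" for n
      by (auto simp: take_map)
    moreover have "map g [0..<n] \<in> W n" for n using range_subsetD[OF g(1)] unfolding W_def by auto
    ultimately show "x \<in> (\<Inter>n. \<Union>s\<in>W n. \<Inter>k\<in>{..n}. B (take k s))" by blast
  next
    fix x assume x: "x \<in> (\<Inter>n. \<Union>s\<in>W n. \<Inter>k\<in>{..n}. B (take k s))"
    have "\<exists>s\<in>W n. \<forall>k\<le>n. x \<in> B (take k s)" for n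
    proof -
      have "x \<in> (\<Union>s\<in>W n. \<Inter>k\<in>{..n}. B (take k s))" using x by blast
      then show ?thesis by blast
    qed
    then obtain s where s: "\<And>n. s n \<in> W n" "\<And>n k. k \<le> n \<Longrightarrow> x \<in> B (take k (s n))" by metis
    have ls: "length (s n) = n" "set (s n) \<subseteq> C" for n using s(1)[of n] unfolding W_def by auto
    have take_s: "take k (s n) = s k" if "k \<le> n" for k n
    proof (rule Bdisj[of x _ _ k])
      show "x \<in> B (take k (s n))" using s that by simp
      show "x \<in> B (s k)" using s(2)[of k k] ls by simp
      show "take k (s n) \<in> W k" using ls[of n] that unfolding W_def by (auto dest: in_set_takeD)
    qed (use s in auto)
    define g where "g = (\<lambda>i. s (Suc i) ! i)"
    have gC: "range g \<subseteq> C" 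
  proof (rule image_subsetI)
    fix i
    have "s (Suc i) ! i \<in> set (s (Suc i))" using ls(1)[of "Suc i"] by simp
    then show "g i \<in> C" unfolding g_def using ls(2) by blast
  qed
    have mg: "map g [0..<n] = s n" for n
    proof (rule nth_equalityI)
      fix i assume "i < length (map g [0..<n])"
      then have i: "i < n" by simp
      then show "map g [0..<n] ! i = s n ! i" using take_s[of "Suc i" n] by (simp add: g_def) (metis lessI nth_take)
    qed (use ls in auto)
    have xc: "x \<in> closure (A (map g [0..<n]))" for n
      using s(2)[of n n] ls[of n] unfolding mg B_def by simp
    have "x = f g"
    proof (rule ccontr)
      assume "x \<noteq> f g"
      then obtain U V where UV: "open U" "open V" "f g \<in> U" "x \<in> V" "U \<inter> V = {}"
        using hausdorff by metis
      obtain n where n: "\<forall>g'. range g' \<subseteq> C \<longrightarrow> (\<forall>i<n. g' i = g i) \<longrightarrow> f g' \<in> U"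
        using cont gC UV unfolding prefix_continuous_def by metis
      have "A (map g [0..<n]) \<subseteq> U"
        unfolding A_def
      proof (rule image_subsetI)
        fix g' assume g': "g' \<in> seqs_extending C (map g [0..<n])"
        then show "f g' \<in> U" using n prefix_of_seqs_extending[OF g'] by (simp add: seqs_extending_def)
      qed
      then have "A (map g [0..<n]) \<subseteq> - V" using UV by auto
      then have "closure (A (map g [0..<n])) \<subseteq> - V" using UV by (intro closure_minimal) auto
      then show False using xc UV by auto
    qed
    then show "x \<in> f ` {g. range g \<subseteq> C}" using gC by auto
  qed
  show ?thesis unfolding eq
    using Bb cW by (intro sets.countable_INT sets.countable_UN' sets.finite_INT) auto
qed

section \<open>Concatenations of words\<close>

lemma word_start_0 [simp]: "word_start g 0 = 0"
  by (simp add: word_start_def)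

lemma word_start_Suc: "word_start g (j + 1) = word_start g j + int (length (g j))"
proof (cases "0 \<le> j")
  case True
  then have "{0..<j+1} = insert j {0..<j}" by auto
  with True show ?thesis by (simp add: word_start_def)
next
  case False
  then have "{j..<0} = insert j {j+1..<0}" by auto
  with False show ?thesis by (cases "j = -1") (auto simp: word_start_def)
qed

lemma word_start_cong:
  assumes "\<And>i. 0 \<le> i \<and> i < j \<or> j \<le> i \<and> i < 0 \<Longrightarrow> g i = g' i"
  shows "word_start g j = word_start g' j"
  using assms unfolding word_start_def by (auto intro!: sum.cong)

lemma word_start_shift:
  "word_start (\<lambda>i. g (i + m)) j = word_start g (j + m) - word_start g m"
proof -
  have "word_start (\<lambda>i. g (i + m)) j + word_start g m = word_start g (j + m)"
  proof (induction j rule: int_induct[where k = 0])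
    case (step1 i)
    then show ?case using word_start_Suc[of "\<lambda>i. g (i + m)" i] word_start_Suc[of g "i + m"]
      by (simp add: algebra_simps)
  next
    case (step2 i)
    then show ?case using word_start_Suc[of "\<lambda>i. g (i + m)" "i - 1"] word_start_Suc[of g "i - 1 + m"]
      by (simp add: algebra_simps)
  qed simp
  then show ?thesis by simp
qed

lemma word_start_diff:
  assumes "[] \<notin> range g" "i \<le> j"
  shows "j - i \<le> word_start g j - word_start g i"
  using assms(2)
proof (induction j rule: int_ge_induct)
  case (step k)
  have "length (g k) > 0" using assms(1) by (metis length_greater_0_conv rangeI)
  with step show ?case using word_start_Suc[of g k] by linarith
qed simp

lemma word_start_strict_mono:
  assumes "[] \<notin> range g"
  shows "strict_mono (word_start g)"
proof (rule strict_monoI)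
  fix i j :: int assume "i < j"
  then show "word_start g i < word_start g j" using word_start_diff[OF assms, of i j] by simp
qed

lemma word_start_ex:
  assumes "[] \<notin> range g"
  shows "\<exists>j. word_start g j \<le> n \<and> n < word_start g (j + 1)"
proof -
  have lo: "word_start g (- \<bar>n\<bar>) \<le> n" using word_start_diff[OF assms, of "- \<bar>n\<bar>" 0] by simp
  have hi: "word_start g (\<bar>n\<bar> + 1) > n" using word_start_diff[OF assms, of 0 "\<bar>n\<bar> + 1"] by simp
  have "finite {j \<in> {- \<bar>n\<bar>..\<bar>n\<bar>}. word_start g j \<le> n}"
    by (rule finite_subset[of _ "{- \<bar>n\<bar>..\<bar>n\<bar>}"]) auto
  note fin = this
  moreover have ne: "- \<bar>n\<bar> \<in> {j \<in> {- \<bar>n\<bar>..\<bar>n\<bar>}. word_start g j \<le> n}" using lo by simp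
  ultimately have M: "Max {j \<in> {- \<bar>n\<bar>..\<bar>n\<bar>}. word_start g j \<le> n} \<in> {j \<in> {- \<bar>n\<bar>..\<bar>n\<bar>}. word_start g j \<le> n}" (is "?M \<in> _")
    using Max_in by blast
  have "n < word_start g (?M + 1)"
  proof (rule ccontr)
    assume a: "\<not> n < word_start g (?M + 1)"
    then have "?M + 1 \<noteq> \<bar>n\<bar> + 1" using hi by auto
    then have "?M + 1 \<in> {j \<in> {- \<bar>n\<bar>..\<bar>n\<bar>}. word_start g j \<le> n}" using M a by auto
    then have "?M + 1 \<le> ?M" using fin by (intro Max_ge)
    then show False by simp
  qed
  with M show ?thesis by blast
qed

lemma word_index_eq:
  assumes "[] \<notin> range g" "word_start g j \<le> n" "n < word_start g (j + 1)"
  shows "word_index g n = j"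
  unfolding word_index_def
proof (rule the_equality)
  fix i assume i: "word_start g i \<le> n \<and> n < word_start g (i + 1)"
  have sm: "strict_mono (word_start g)" by (rule word_start_strict_mono[OF assms(1)])
  from i assms have "word_start g i < word_start g (j + 1)" "word_start g j < word_start g (i + 1)" by linarith+
  then show "i = j" using sm by (simp add: strict_mono_less)
qed (use assms in auto)

lemma biconcat_nth:
  assumes "[] \<notin> range g" "i < length (g j)"
  shows "biconcat g (word_start g j + int i) = g j ! i"
proof -
  have "word_index g (word_start g j + int i) = j"
    by (rule word_index_eq[OF assms(1)]) (use assms(2) in \<open>auto simp: word_start_Suc\<close>)
  then show ?thesis by (simp add: biconcat_def)
qed

lemma biconcat_eqI:
  assumes "[] \<notin> range g" "\<And>j i. i < length (g j) \<Longrightarrow> x (word_start g j + int i) = g j ! i"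
  shows "biconcat g = x"
proof
  fix n
  obtain j where j: "word_start g j \<le> n" "n < word_start g (j + 1)" using word_start_ex[OF assms(1)] by blast
  define i where "i = nat (n - word_start g j)"
  have i: "i < length (g j)" "n = word_start g j + int i"
    using j unfolding i_def by (auto simp: word_start_Suc)
  show "biconcat g n = x n" using biconcat_nth[of g, OF assms(1) i(1)] assms(2)[OF i(1)] i(2) by simp
qed

text \<open>Every word has at least one letter, so the word that covers coordinate n has an index of
  absolute value at most \<bar>n\<bar> + 1. Hence each symbol depends on finitely many words: the
  source of all continuity and measurability statements about \<open>biconcat\<close>.\<close>

lemma biconcat_cong:
  assumes ne: "[] \<notin> range g" "[] \<notin> range g'" and eq: "\<And>i. \<bar>i\<bar> \<le> \<bar>n\<bar> + 1 \<Longrightarrow> g i = g' i"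
  shows "biconcat g n = biconcat g' n"
proof -
  obtain j where j: "word_start g j \<le> n" "n < word_start g (j + 1)" using word_start_ex[OF ne(1)] by blast
  have b: "\<bar>j\<bar> \<le> \<bar>n\<bar> + 1"
  proof (cases "0 \<le> j")
    case True then show ?thesis using word_start_diff[OF ne(1), of 0 j] j by simp
  next
    case False then show ?thesis using word_start_diff[OF ne(1), of "j+1" 0] j by simp
  qed
  have w: "word_start g j = word_start g' j" using eq b by (intro word_start_cong) auto
  have gj: "g j = g' j" using eq b by blast
  have "word_index g n = j" by (rule word_index_eq[OF ne(1)]) (use j in auto)
  moreover have "word_index g' n = j"
    by (rule word_index_eq[OF ne(2)]) (use j w gj in \<open>auto simp: word_start_Suc\<close>)
  ultimately show ?thesis using w gj by (simp add: biconcat_def)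
qed

section \<open>Shifts by integers, regrouping, and cuts\<close>

definition shift_by :: "int \<Rightarrow> (int \<Rightarrow> 'a) \<Rightarrow> int \<Rightarrow> 'a" where
  "shift_by k x = (\<lambda>n. x (n + k))"

lemma shift_by_shift_by [simp]: "shift_by k (shift_by l x) = shift_by (k + l) x"
  by (simp add: shift_by_def fun_eq_iff algebra_simps)

lemma shift_by_0 [simp]: "shift_by 0 x = x" by (simp add: shift_by_def)

lemma left_shift_eq_shift: "left_shift = shift_by 1"
  by (simp add: left_shift_def shift_by_def fun_eq_iff)

lemma funpow_left_shift: "left_shift ^^ k = shift_by (int k)"
  by (induction k) (auto simp: left_shift_eq_shift fun_eq_iff shift_by_def algebra_simps)

lemma biconcat_shift:
  assumes "[] \<notin> range g"
  shows "biconcat (\<lambda>i. g (i + m)) = shift_by (word_start g m) (biconcat g)"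
proof (rule biconcat_eqI)
  fix j i assume "i < length (g (j + m))"
  then show "shift_by (word_start g m) (biconcat g) (word_start (\<lambda>i. g (i + m)) j + int i) = g (j + m) ! i"
    using biconcat_nth[OF assms, of i "j + m"] by (simp add: shift_by_def word_start_shift algebra_simps)
qed (use assms in auto)

lemma biconcat_in_words:
  assumes "[] \<notin> range h"
  shows "biconcat h m \<in> (\<Union>j. set (h j))"
proof -
  obtain j where j: "word_start h j \<le> m" "m < word_start h (j + 1)" using word_start_ex[OF assms] by blast
  then have l: "nat (m - word_start h j) < length (h j)" by (auto simp: word_start_Suc)
  from biconcat_nth[of h, OF assms l] j nth_mem[OF l] show ?thesis by auto
qed

text \<open>Two levels of concatenation are in play: \<open>h\<close> is a bi-infinite sequence of
  lists of words, so \<open>word_start h\<close> counts words while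
  \<open>word_start (biconcat h)\<close> counts letters.\<close>

lemma word_start_biconcat:
  assumes "[] \<notin> range h" "i \<le> length (h j)"
  shows "word_start (biconcat h) (word_start h j + int i)
       = word_start (biconcat h) (word_start h j) + int (length (concat (take i (h j))))"
  using assms(2)
proof (induction i)
  case (Suc i)
  then have i: "i < length (h j)" by simp
  have "word_start (biconcat h) (word_start h j + int i + 1)
      = word_start (biconcat h) (word_start h j + int i) + int (length (h j ! i))"
    unfolding word_start_Suc biconcat_nth[OF assms(1) i] ..
  with Suc i show ?case by (simp add: take_Suc_conv_app_nth algebra_simps)
qed simp

lemma word_start_concat:
  assumes "[] \<notin> range h"
  shows "word_start (\<lambda>j. concat (h j)) j = word_start (biconcat h) (word_start h j)"
proof -
  have step: "word_start (biconcat h) (word_start h (j + 1))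
      = word_start (biconcat h) (word_start h j) + int (length (concat (h j)))" for j
    using word_start_biconcat[of h "length (h j)" j, OF assms] by (simp add: word_start_Suc)
  show ?thesis
  proof (induction j rule: int_induct[where k = 0])
    case (step1 i)
    then show ?case using step[of i] word_start_Suc[of "\<lambda>j. concat (h j)" i] by simp
  next
    case (step2 i)
    then show ?case using step[of "i - 1"] word_start_Suc[of "\<lambda>j. concat (h j)" "i - 1"] by simp
  qed simp
qed

lemma nth_concat_ex:
  "r < length (concat xs) \<Longrightarrow> \<exists>i r'. i < length xs \<and> r' < length (xs ! i) \<and>
     r = length (concat (take i xs)) + r' \<and> concat xs ! r = xs ! i ! r'"
proof (induction xs arbitrary: r)
  case (Cons a xs)
  show ?case
  proof (cases "r < length a")
    case True
    then show ?thesis by (intro exI[of _ 0] exI[of _ r]) (auto simp: nth_append)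
  next
    case False
    then have "r - length a < length (concat xs)" using Cons.prems by auto
    from Cons.IH[OF this] obtain i r' where ir: "i < length xs" "r' < length (xs ! i)"
      "r - length a = length (concat (take i xs)) + r'" "concat xs ! (r - length a) = xs ! i ! r'" by blast
    then show ?thesis using False
      by (intro exI[of _ "Suc i"] exI[of _ r']) (auto simp: nth_append)
  qed
qed simp

text \<open>Associativity of bi-infinite concatenation, including the position of the
  origin.\<close>

lemma biconcat_biconcat:
  assumes "[] \<notin> range h" "\<And>j w. w \<in> set (h j) \<Longrightarrow> w \<noteq> []"
  shows "biconcat (\<lambda>j. concat (h j)) = biconcat (biconcat h)"
proof (rule biconcat_eqI)
  show "[] \<notin> range (\<lambda>j. concat (h j))"
  proof
    assume "[] \<in> range (\<lambda>j. concat (h j))"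
    then obtain j where "concat (h j) = []" by auto
    moreover have "h j \<noteq> []" using assms(1) by (metis rangeI)
    ultimately show False using assms(2)[of "hd (h j)" j] by auto
  qed
  have ne: "[] \<notin> range (biconcat h)"
  proof
    assume "[] \<in> range (biconcat h)"
    then obtain m where "biconcat h m = []" by (metis imageE)
    with biconcat_in_words[OF assms(1), of m] obtain j where "[] \<in> set (h j)" by auto
    then show False using assms(2) by blast
  qed
  fix j r assume "r < length (concat (h j))"
  then obtain i r' where i: "i < length (h j)" "r' < length (h j ! i)"
     "r = length (concat (take i (h j))) + r'" "concat (h j) ! r = h j ! i ! r'" using nth_concat_ex by blast
  have e: "word_start (\<lambda>j. concat (h j)) j + int r = word_start (biconcat h) (word_start h j + int i) + int r'"
    using i word_start_biconcat[of h i j, OF assms(1)] word_start_concat[of h j, OF assms(1)] by simp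
  have b: "biconcat h (word_start h j + int i) = h j ! i" using biconcat_nth[OF assms(1) i(1)] .
  show "biconcat (biconcat h) (word_start (\<lambda>j. concat (h j)) j + int r) = concat (h j) ! r"
    unfolding e using biconcat_nth[OF ne, of r' "word_start h j + int i"] b i by simp
qed

text \<open>The points with a generator boundary at coordinate zero. Throughout,
  \<open>shift_by k x \<in> cut_set G\<close> expresses that \<open>x\<close> has a cut at
  coordinate k.\<close>

definition cut_set :: "'a list set \<Rightarrow> (int \<Rightarrow> 'a) set" where
  "cut_set G = biconcat ` {g. range g \<subseteq> G}"

lemma con_set_eq: "con_set G = (\<Union>k. shift_by k ` cut_set G)"
  unfolding con_set_def cut_set_def shift_by_def by auto

lemma con_set_eq': "con_set G = {x. \<exists>k. shift_by k x \<in> cut_set G}"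
proof (intro equalityI subsetI)
  fix x assume "x \<in> con_set G"
  then obtain k y where "y \<in> cut_set G" "x = shift_by k y" unfolding con_set_eq by auto
  then have "shift_by (- k) x \<in> cut_set G" by simp
  then show "x \<in> {x. \<exists>k. shift_by k x \<in> cut_set G}" by blast
next
  fix x assume "x \<in> {x. \<exists>k. shift_by k x \<in> cut_set G}"
  then obtain k where "shift_by k x \<in> cut_set G" by blast
  moreover have "x = shift_by (- k) (shift_by k x)" by simp
  ultimately show "x \<in> con_set G" unfolding con_set_eq by blast
qed

lemma con_set_shift: "shift_by k x \<in> con_set G \<longleftrightarrow> x \<in> con_set G"
proof -
  have *: "shift_by l y \<in> con_set G" if y: "y \<in> con_set G" for l y
  proof -
    obtain m where "shift_by m y \<in> cut_set G" using y unfolding con_set_eq' by blast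
    then have "shift_by (m - l) (shift_by l y) \<in> cut_set G" by simp
    then show ?thesis unfolding con_set_eq' by blast
  qed
  show ?thesis using *[of x k] *[of "shift_by k x" "- k"] by auto
qed

lemma cut_set_mono: "F \<subseteq> G \<Longrightarrow> cut_set F \<subseteq> cut_set G"
  unfolding cut_set_def by blast

lemma con_set_mono: "F \<subseteq> G \<Longrightarrow> con_set F \<subseteq> con_set G"
  unfolding con_set_eq using cut_set_mono[of F G] by blast

lemma cut_set_subset_con_set: "cut_set G \<subseteq> con_set G"
  unfolding con_set_eq' by (auto intro: exI[of _ 0])

text \<open>Renumbering the words so that the one covering coordinate k gets index 0 brings a
  shifted concatenation into the form of a pointed representation. The last clause keeps the
  renumbering, from which \<open>unique_cuts\<close> recovers the position of the cut.\<close>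

lemma shift_biconcat_rep:
  assumes "[] \<notin> G" "range g \<subseteq> G"
  obtains g' r where "range g' \<subseteq> G" "r < length (g' 0)" "shift_by k (biconcat g) = shift_by (int r) (biconcat g')"
    "\<exists>j. g' = (\<lambda>i. g (i + j)) \<and> k = word_start g j + int r"
proof -
  have ne: "[] \<notin> range g" using assms by blast
  obtain j where j: "word_start g j \<le> k" "k < word_start g (j + 1)" using word_start_ex[OF ne] by blast
  define r where "r = nat (k - word_start g j)"
  have r: "r < length (g j)" "k = word_start g j + int r" using j by (auto simp: r_def word_start_Suc)
  show ?thesis
    by (rule that[of "\<lambda>i. g (i + j)" r]) (use assms r biconcat_shift[OF ne, of j] in \<open>auto simp: add.commute[of "int r"]\<close>)
qed

lemma unique_rep:
  assumes u: "uniquely_represents G" and g: "range g \<subseteq> G" "r < length (g 0)"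
    and g': "range g' \<subseteq> G" "r' < length (g' 0)"
    and eq: "shift_by (int r) (biconcat g) = shift_by (int r') (biconcat g')"
  shows "g = g' \<and> r = r'"
proof -
  let ?x = "shift_by (int r) (biconcat g)"
  have "?x \<in> con_set G" using g unfolding con_set_eq cut_set_def by blast
  then have ex: "\<exists>!p. p \<in> pointed_representations G ?x" using u unfolding uniquely_represents_def by blast
  have "(g, r) \<in> pointed_representations G ?x" "(g', r') \<in> pointed_representations G ?x"
    using g g' eq unfolding pointed_representations_def by (auto simp: funpow_left_shift)
  then show ?thesis using ex by auto
qed

lemma unique_biconcat:
  assumes "uniquely_represents G" "[] \<notin> G"
  shows "inj_on biconcat {g. range g \<subseteq> G}"
proof (rule inj_onI)
  fix g g' assume a: "g \<in> {g. range g \<subseteq> G}" "g' \<in> {g. range g \<subseteq> G}" "biconcat g = biconcat g'"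
  have "g 0 \<in> G" "g' 0 \<in> G" using a by auto
  then have "0 < length (g 0)" "0 < length (g' 0)" using assms(2) by auto
  then show "g = g'" using unique_rep[OF assms(1), of g 0 g' 0] a by auto
qed

text \<open>A cut inside a word of \<open>g\<close> would give the shifted point one pointed
  representation with positive offset and another with offset 0. Hence the cuts of a point are
  intrinsic: they are the word boundaries of any of its factorizations.\<close>

lemma unique_cuts:
  assumes u: "uniquely_represents G" "[] \<notin> G" and g: "range g \<subseteq> G" and k: "shift_by k (biconcat g) \<in> cut_set G"
  shows "k \<in> range (word_start g)"
proof -
  obtain g' r where g': "range g' \<subseteq> G" "r < length (g' 0)" "shift_by k (biconcat g) = shift_by (int r) (biconcat g')"
    "\<exists>j. g' = (\<lambda>i. g (i + j)) \<and> k = word_start g j + int r"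
    using shift_biconcat_rep[OF u(2) g] by metis
  obtain g2 where g2: "range g2 \<subseteq> G" "shift_by k (biconcat g) = biconcat g2" using k unfolding cut_set_def by blast
  have "g2 0 \<in> G" using g2 by auto
  then have "g2 0 \<noteq> []" using u(2) by auto
  then have "g' = g2 \<and> r = 0" using unique_rep[OF u(1) g'(1,2) g2(1), of 0] g' g2 by auto
  then show ?thesis using g' by auto
qed

section \<open>Finite windows and blocks\<close>

definition slice :: "(int \<Rightarrow> 'a) \<Rightarrow> int \<Rightarrow> nat \<Rightarrow> 'a list" where
  "slice x a l = map (\<lambda>i. x (a + int i)) [0..<l]"

lemma length_slice [simp]: "length (slice x a l) = l" by (simp add: slice_def)

lemma nth_slice [simp]: "i < l \<Longrightarrow> slice x a l ! i = x (a + int i)" by (simp add: slice_def)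

lemma slice_shift: "slice (shift_by k x) a l = slice x (a + k) l"
  by (simp add: slice_def shift_by_def algebra_simps)

lemma slice_append: "slice x a l @ slice x (a + int l) m = slice x a (l + m)"
  by (rule nth_equalityI) (auto simp: nth_append algebra_simps)

lemma slice_cong: "(\<And>i. i < l \<Longrightarrow> x (a + int i) = y (b + int i)) \<Longrightarrow> slice x a l = slice y b l"
  by (simp add: slice_def)

lemma slice_biconcat:
  assumes "[] \<notin> range g"
  shows "slice (biconcat g) (word_start g j) (length (g j)) = g j"
  by (rule nth_equalityI) (use biconcat_nth[OF assms] in auto)

lemma slice_biconcat_concat:
  assumes "[] \<notin> range g"
  shows "slice (biconcat g) 0 (nat (word_start g (int m))) = concat (map (\<lambda>i. g (int i)) [0..<m])"
proof (induction m)
  case (Suc m)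
  have "word_start g (int m) \<ge> 0" using word_start_diff[OF assms, of 0 "int m"] by simp
  then have "nat (word_start g (int (Suc m))) = nat (word_start g (int m)) + length (g (int m))"
    using word_start_Suc[of g "int m"] by (simp add: add.commute nat_add_distrib)
  moreover have "slice (biconcat g) (0 + int (nat (word_start g (int m)))) (length (g (int m))) = g (int m)"
    using slice_biconcat[OF assms, of "int m"] \<open>word_start g (int m) \<ge> 0\<close> by simp
  ultimately show ?case using Suc slice_append[of "biconcat g" 0 "nat (word_start g (int m))" "length (g (int m))"]
    by simp
qed (simp add: slice_def)

text \<open>Each of the two cuts comes with a factorization of its own; \<open>unique_cuts\<close>
  turns the second cut into a word boundary of the first factorization.\<close>

lemma slice_between_cuts:
  assumes u: "uniquely_represents G" "[] \<notin> G" and ab: "shift_by a x \<in> cut_set G" "shift_by b x \<in> cut_set G" "a \<le> b"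
  shows "\<exists>ws\<in>lists G. slice x a (nat (b - a)) = concat ws"
proof -
  obtain g where g: "range g \<subseteq> G" "shift_by a x = biconcat g" using ab(1) unfolding cut_set_def by blast
  have ne: "[] \<notin> range g" using g u(2) by blast
  have "shift_by (b - a) (biconcat g) \<in> cut_set G" using ab(2) unfolding g(2)[symmetric] by simp
  then obtain m where m: "b - a = word_start g m" using unique_cuts[OF u g(1)] by blast
  have "m \<ge> 0"
    using ab(3) m strict_mono_less[OF word_start_strict_mono[OF ne], of m 0] by (simp add: not_less[symmetric])
  then have "slice (biconcat g) 0 (nat (b - a)) = concat (map (\<lambda>i. g (int i)) [0..<nat m])"
    using slice_biconcat_concat[OF ne, of "nat m"] m by simp
  moreover have "slice (biconcat g) 0 (nat (b - a)) = slice x a (nat (b - a))"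
    unfolding g(2)[symmetric] slice_shift by simp
  moreover have "map (\<lambda>i. g (int i)) [0..<nat m] \<in> lists G" using range_subsetD[OF g(1)] by auto
  ultimately show ?thesis by metis
qed

text \<open>Without its last generator a block is shorter than \<open>N\<close>. Thus a block ends
  at the first cut at distance at least \<open>N\<close> from its beginning, and the block
  boundaries can be read off the cuts.\<close>

definition block_words :: "'a list set \<Rightarrow> nat \<Rightarrow> 'a list set" where
  "block_words F N =
     {concat ws |ws. ws \<in> lists F \<and> ws \<noteq> [] \<and> N \<le> length (concat ws) \<and> length (concat (butlast ws)) < N}"

lemma length_block_words: "w \<in> block_words F N \<Longrightarrow> N \<le> length w"
  unfolding block_words_def by auto

lemma Nil_notin_block_words: "0 < N \<Longrightarrow> [] \<notin> block_words F N"
  using length_block_words by fastforce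

text \<open>Greedy grouping. The remainder is shorter than \<open>N\<close> even if generators are
  arbitrarily long, which grouping by a fixed number of generators would not achieve.\<close>

lemma exists_blocks:
  assumes "ws \<in> lists G" "0 < N"
  shows "\<exists>bs\<in>lists (block_words G N). \<exists>rs\<in>lists G. concat ws = concat bs @ concat rs \<and> length (concat rs) < N"
  using assms(1)
proof (induction ws rule: rev_induct)
  case Nil
  show ?case by (intro bexI[of _ "[]"]) (use assms(2) in auto)
next
  case (snoc w ws)
  then obtain bs rs where b: "bs \<in> lists (block_words G N)" "rs \<in> lists G" "concat ws = concat bs @ concat rs"
    "length (concat rs) < N" by auto
  have w: "w \<in> G" using snoc.prems by simp
  show ?case
  proof (cases "length (concat (rs @ [w])) < N")
    case True
    then show ?thesis by (intro bexI[of _ bs] bexI[of _ "rs @ [w]"]) (use b w in auto)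
  next
    case False
    then have "concat (rs @ [w]) \<in> block_words G N"
      unfolding block_words_def mem_Collect_eq by (intro exI[of _ "rs @ [w]"]) (use b w in auto)
    then show ?thesis
      by (intro bexI[of _ "bs @ [concat (rs @ [w])]"] bexI[of _ "[]"]) (use b assms(2) in auto)
  qed
qed

text \<open>All generators of a block but the last have total length below \<open>N\<close>, so a
  block consists of at most \<open>N\<close> generators.\<close>

lemma finite_block_words:
  assumes "finite F" "[] \<notin> F"
  shows "finite (block_words F N)"
proof -
  have "block_words F N \<subseteq> concat ` {ws. set ws \<subseteq> F \<and> length ws \<le> N}"
  proof
    fix w assume "w \<in> block_words F N"
    then obtain ws where ws: "w = concat ws" "ws \<in> lists F" "ws \<noteq> []" "length (concat (butlast ws)) < N"
      unfolding block_words_def by auto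
    have "length us \<le> length (concat us)" if "us \<in> lists F" for us
      using that
    proof (induction us)
      case (Cons a us)
      then have "a \<noteq> []" using assms(2) by auto
      then have "length a \<ge> 1" by (simp add: Suc_le_eq)
      then show ?case using Cons by auto
    qed simp
    from this[of "butlast ws"] ws have "length (butlast ws) < N"
      by (meson in_lists_conv_set in_set_butlastD le_less_trans)
    then have "length ws \<le> N" by simp
    then show "w \<in> concat ` {ws. set ws \<subseteq> F \<and> length ws \<le> N}" using ws by auto
  qed
  moreover have "finite {ws. set ws \<subseteq> F \<and> length ws \<le> N}" using finite_lists_length_le[OF assms(1)] .
  ultimately show ?thesis using finite_subset by blast
qed

text \<open>Resolves a sequence of blocks into its generators, keeping track of how the two families
  of boundaries correspond.\<close>

lemma block_parse:
  assumes F: "[] \<notin> F" and g: "range g \<subseteq> block_words F N"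
  obtains h where "[] \<notin> range h" "\<And>j. set (h j) \<subseteq> F" "\<And>j. g j = concat (h j)"
    "\<And>j. length (concat (butlast (h j))) < N" "biconcat g = biconcat (biconcat h)"
    "range (biconcat h) \<subseteq> F" "\<And>j. word_start g j = word_start (biconcat h) (word_start h j)"
proof -
  have "\<exists>ws. ws \<noteq> [] \<and> set ws \<subseteq> F \<and> g j = concat ws \<and> length (concat (butlast ws)) < N" for j
  proof -
    have "g j \<in> block_words F N" using g by auto
    then show ?thesis unfolding block_words_def by auto
  qed
  then obtain h where h': "\<And>j. h j \<noteq> []" and h: "\<And>j. set (h j) \<subseteq> F" "\<And>j. g j = concat (h j)"
    "\<And>j. length (concat (butlast (h j))) < N" by metis
  have hne: "[] \<notin> range h" by (auto, metis h')
  have gh: "g = (\<lambda>j. concat (h j))" using h by auto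
  show ?thesis
  proof (rule that[of h])
    show "biconcat g = biconcat (biconcat h)" unfolding gh
      by (rule biconcat_biconcat[OF hne]) (use h F in auto)
    show "range (biconcat h) \<subseteq> F" using biconcat_in_words[OF hne] h by blast
    show "word_start g j = word_start (biconcat h) (word_start h j)" for j
      unfolding gh by (rule word_start_concat[OF hne])
  qed (use h hne in auto)
qed

lemma cut_set_block_words:
  assumes "[] \<notin> F"
  shows "cut_set (block_words F N) \<subseteq> cut_set F"
proof
  fix x assume "x \<in> cut_set (block_words F N)"
  then obtain g where "range g \<subseteq> block_words F N" "x = biconcat g" unfolding cut_set_def by auto
  then show "x \<in> cut_set F" using block_parse[OF assms, of g N] unfolding cut_set_def
    by (metis (mono_tags, lifting) image_eqI mem_Collect_eq)
qed

lemma block_start_cut: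
  assumes F: "[] \<notin> F" "F \<subseteq> G" and N: "0 < N" and g: "range g \<subseteq> block_words F N"
  shows "shift_by (word_start g j) (biconcat g) \<in> cut_set G"
proof -
  have ne: "[] \<notin> range g" using g Nil_notin_block_words[OF N, of F] by blast
  have "shift_by (word_start g j) (biconcat g) = biconcat (\<lambda>i. g (i + j))" by (rule biconcat_shift[OF ne, symmetric])
  then have "shift_by (word_start g j) (biconcat g) \<in> cut_set (block_words F N)"
    using g unfolding cut_set_def by (intro image_eqI[of _ _ "\<lambda>i. g (i + j)"]) auto
  then show ?thesis using cut_set_block_words[OF F(1)] cut_set_mono[OF F(2)] by blast
qed

text \<open>Reads the blocks off the set of cuts: the next block boundary after a boundary \<open>a\<close> is the
  first cut at or after \<open>a + N\<close>.\<close>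

lemma next_block_start:
  assumes u: "uniquely_represents G" "[] \<notin> G" and F: "F \<subseteq> G" and N: "0 < N" and g: "range g \<subseteq> block_words F N"
    and t: "shift_by t (biconcat g) \<in> cut_set G" "word_start g j + int N \<le> t"
  shows "word_start g (j + 1) \<le> t"
proof (rule ccontr)
  assume lt: "\<not> ?thesis"
  have F': "[] \<notin> F" using u F by auto
  obtain h where h: "[] \<notin> range h" "\<And>j. set (h j) \<subseteq> F" "\<And>j. g j = concat (h j)"
    "\<And>j. length (concat (butlast (h j))) < N" "biconcat g = biconcat (biconcat h)"
    "range (biconcat h) \<subseteq> F" "\<And>j. word_start g j = word_start (biconcat h) (word_start h j)"
    using block_parse[OF F' g] by metis
  have bne: "[] \<notin> range (biconcat h)" using h(6) F' by blast
  have sm: "strict_mono (word_start (biconcat h))" by (rule word_start_strict_mono[OF bne])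
  have "range (biconcat h) \<subseteq> G" using h(6) F by blast
  from unique_cuts[OF u this] t(1) h(5) obtain m where m: "t = word_start (biconcat h) m" by auto
  have "m < word_start h (j + 1)" using lt h(7)[of "j+1"] m sm by (simp add: not_le strict_mono_less)
  moreover have "word_start h j \<le> m"
  proof -
    have "word_start (biconcat h) (word_start h j) \<le> word_start (biconcat h) m" using t(2) h(7)[of j] m by linarith
    then show ?thesis using sm by (simp add: strict_mono_less_eq)
  qed
  ultimately have "m = word_start h j + int (nat (m - word_start h j))" "nat (m - word_start h j) < length (h j)"
    using word_start_Suc[of h j] by auto
  then obtain i where i: "m = word_start h j + int i" "i < length (h j)" by blast
  \<comment> \<open>A cut strictly inside the block ends a proper prefix of its list of generators;
    such a prefix lies in \<open>butlast\<close> and is shorter than \<open>N\<close>.\<close>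
  have "t = word_start g j + int (length (concat (take i (h j))))"
    using word_start_biconcat[of h i j, OF h(1)] i m h(7)[of j] by simp
  moreover have "take i (h j) = take i (butlast (h j))" using i by (simp add: take_butlast)
  moreover have "length (concat (take i (butlast (h j)))) \<le> length (concat (butlast (h j)))"
    by (metis append_take_drop_id concat_append le_add1 length_append)
  ultimately show False using h(4)[of j] t(2) by simp
qed

text \<open>Window [a, b), with a in the initial block or at its end. Once the initial blocks
  coincide, each further boundary is found from the cuts in the window by
  \<open>next_block_start\<close>, and the symbols between two boundaries give the block. This is
  the decoding that bounds the measure of an atom in the lower bound.\<close>

lemma blocks_determined:
  assumes u: "uniquely_represents G" "[] \<notin> G" and F: "F \<subseteq> G" and N: "0 < N"
    and g: "range g \<subseteq> block_words F N" "range g' \<subseteq> block_words F N" and g0: "g 0 = g' 0"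
    and a: "a \<le> int (length (g 0))"
    and cuts: "\<And>t. a \<le> t \<Longrightarrow> t < b \<Longrightarrow> shift_by t (biconcat g) \<in> cut_set G \<longleftrightarrow> shift_by t (biconcat g') \<in> cut_set G"
    and syms: "\<And>t. a \<le> t \<Longrightarrow> t < b \<Longrightarrow> biconcat g t = biconcat g' t"
  shows "word_start g (int i + 1) < b \<Longrightarrow> \<forall>j. 0 \<le> j \<and> j \<le> int i \<longrightarrow> g j = g' j"
proof (induction i)
  case 0
  then show ?case using g0 by (metis antisym of_nat_0)
next
  case (Suc i)
  have ne: "[] \<notin> range g" using g(1) Nil_notin_block_words[OF N, of F] by blast
  have ne': "[] \<notin> range g'" using g(2) Nil_notin_block_words[OF N, of F] by blast
  have F': "[] \<notin> F" using u F by auto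
  let ?s = "word_start g (int i + 1)" and ?t = "word_start g (int i + 1 + 1)" and ?t' = "word_start g' (int i + 1 + 1)"
  have tb: "?t < b" using Suc.prems by (simp add: add.commute)
  have len: "N \<le> length (g j)" "N \<le> length (g' j)" for j
    using g length_block_words by (metis range_subsetD)+
  have st: "?s + int N \<le> ?t" using word_start_Suc[of g "int i + 1"] len(1)[of "int i + 1"] by simp
  then have "?s < b" using tb by simp
  from Suc.IH[OF this] have IH: "\<And>j. 0 \<le> j \<Longrightarrow> j \<le> int i \<Longrightarrow> g j = g' j" by blast
  have s': "word_start g' (int i + 1) = ?s" by (rule word_start_cong) (use IH in auto)
  have st': "?s + int N \<le> ?t'" using word_start_Suc[of g' "int i + 1"] len(2)[of "int i + 1"] s' by simp
  have as: "a \<le> ?s"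
  proof -
    have "word_start g 1 = int (length (g 0))" using word_start_Suc[of g 0] by simp
    moreover have "word_start g 1 \<le> ?s"
      using word_start_diff[OF ne, of 1 "int i + 1"] by simp
    ultimately show ?thesis using a by simp
  qed
  \<comment> \<open>The end of the next block of \<open>g\<close> is also a cut of the other point,
    so the block of \<open>g'\<close> ends no later; its end then lies in the window too, and the
    roles can be exchanged.\<close>
  have "shift_by ?t (biconcat g) \<in> cut_set G" by (rule block_start_cut[OF F' F N g(1)])
  then have "shift_by ?t (biconcat g') \<in> cut_set G" using cuts[of ?t] tb st as by simp
  from next_block_start[OF u F N g(2) this, of "int i + 1"] st s' have le1: "?t' \<le> ?t" by simp
  have "shift_by ?t' (biconcat g') \<in> cut_set G" by (rule block_start_cut[OF F' F N g(2)])
  then have "shift_by ?t' (biconcat g) \<in> cut_set G" using cuts[of ?t'] tb st' as le1 by simp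
  from next_block_start[OF u F N g(1) this, of "int i + 1"] st' have le2: "?t \<le> ?t'" by simp
  have l: "length (g (int i + 1)) = length (g' (int i + 1))"
    using le1 le2 s' word_start_Suc[of g "int i + 1"] word_start_Suc[of g' "int i + 1"] by simp
  have "g (int i + 1) = slice (biconcat g) ?s (length (g (int i + 1)))" using slice_biconcat[OF ne] by simp
  also have "\<dots> = slice (biconcat g') ?s (length (g (int i + 1)))"
    using as tb word_start_Suc[of g "int i + 1"] by (intro slice_cong syms) auto
  also have "\<dots> = g' (int i + 1)" using slice_biconcat[OF ne', of "int i + 1"] s' l by simp
  finally have "g (int i + 1) = g' (int i + 1)" .
  moreover have "j = int i + 1 \<or> j \<le> int i" if "j \<le> int (Suc i)" for j using that by linarith
  ultimately show ?case using IH by blast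
qed

section \<open>Topology of coded shifts\<close>

definition agree :: "nat \<Rightarrow> (int \<Rightarrow> 'a) \<Rightarrow> (int \<Rightarrow> 'a) \<Rightarrow> bool" where
  "agree r x y \<longleftrightarrow> (\<forall>i. \<bar>i\<bar> \<le> int r \<longrightarrow> x i = y i)"

lemma agree_mono: "agree r x y \<Longrightarrow> s \<le> r \<Longrightarrow> agree s x y"
  unfolding agree_def by auto

lemma agree_sym: "agree r x y \<Longrightarrow> agree r y x"
  unfolding agree_def by auto

lemma agree_trans: "agree r x y \<Longrightarrow> agree r y z \<Longrightarrow> agree r x z"
  unfolding agree_def by auto

lemma open_finite_coordinates:
  fixes A :: "(int \<Rightarrow> 'a::discrete_topology) set"
  assumes "\<And>x y. x \<in> A \<Longrightarrow> agree r x y \<Longrightarrow> y \<in> A"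
  shows "open A"
proof -
  have "open {y. agree r x y}" for x :: "int \<Rightarrow> 'a"
  proof -
    have "finite {- int r..int r}" by simp
    then have "open {y. \<forall>i\<in>{- int r..int r}. y i \<in> {x i}}"
      by (rule product_topology_basis'[where x = "\<lambda>i. i" and U = "\<lambda>i. {x i}"]) (rule discrete_topology_class.open_discrete)
    moreover have "{y. \<forall>i\<in>{- int r..int r}. y i \<in> {x i}} = {y. agree r x y}"
      unfolding agree_def by (auto simp: abs_le_iff)
    ultimately show ?thesis by simp
  qed
  then have "open (\<Union>x\<in>A. {y. agree r x y})" by blast
  moreover have "(\<Union>x\<in>A. {y. agree r x y}) = A" using assms by (auto simp: agree_def)
  ultimately show ?thesis by simp
qed

lemma open_imp_agree:
  fixes U :: "(int \<Rightarrow> 'a::topological_space) set"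
  assumes "open U" "x \<in> U"
  obtains r where "\<And>y. agree r x y \<Longrightarrow> y \<in> U"
proof -
  have "openin (product_topology (\<lambda>i. euclidean) UNIV) U" using assms(1) by (simp add: open_fun_def)
  then obtain X where X: "x \<in> (\<Pi>\<^sub>E i\<in>UNIV. X i)" "finite {i. X i \<noteq> topspace euclidean}" "(\<Pi>\<^sub>E i\<in>UNIV. X i) \<subseteq> U"
    using product_topology_open_contains_basis[OF _ assms(2)] by blast
  define r where "r = nat (Max (insert 0 (abs ` {i. X i \<noteq> UNIV})))"
  have fin: "finite (insert 0 (abs ` {i. X i \<noteq> UNIV}))" using X(2) by simp
  have "y \<in> U" if "agree r x y" for y
  proof -
    have "y i \<in> X i" for i
    proof (cases "X i = UNIV")
      case False
      then have "\<bar>i\<bar> \<le> Max (insert 0 (abs ` {i. X i \<noteq> UNIV}))" using fin by (intro Max_ge) auto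
      moreover have "0 \<le> Max (insert 0 (abs ` {i. X i \<noteq> UNIV}))" using fin by (intro Max_ge) auto
      ultimately have "\<bar>i\<bar> \<le> int r" unfolding r_def by simp
      then have "x i = y i" using that unfolding agree_def by blast
      moreover have "x i \<in> X i" using X(1) by auto
      ultimately show ?thesis by simp
    qed simp
    then show ?thesis using X(3) by auto
  qed
  then show ?thesis using that by blast
qed

lemma closure_agree:
  fixes x :: "int \<Rightarrow> 'a::discrete_topology"
  shows "x \<in> closure A \<longleftrightarrow> (\<forall>r. \<exists>y\<in>A. agree r x y)"
proof
  assume x: "x \<in> closure A"
  show "\<forall>r. \<exists>y\<in>A. agree r x y"
  proof
    fix r
    have "open {y. agree r x y}" by (rule open_finite_coordinates) (auto intro: agree_trans)
    moreover have "x \<in> {y. agree r x y}" by (simp add: agree_def)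
    ultimately have "{y. agree r x y} \<inter> A \<noteq> {}" using x open_Int_closure_eq_empty by blast
    then show "\<exists>y\<in>A. agree r x y" by auto
  qed
next
  assume a: "\<forall>r. \<exists>y\<in>A. agree r x y"
  show "x \<in> closure A"
  proof (rule ccontr)
    assume "x \<notin> closure A"
    then obtain r where r: "\<And>y. agree r x y \<Longrightarrow> y \<in> - closure A"
      using open_imp_agree[of "- closure A" x] by auto
    obtain y where "y \<in> A" "agree r x y" using a by blast
    then show False using r closure_subset by blast
  qed
qed

lemma agree_shift: "agree (r + nat \<bar>k\<bar>) x y \<Longrightarrow> agree r (shift_by k x) (shift_by k y)"
  unfolding agree_def shift_by_def by auto

lemma continuous_shift [continuous_intros]:
  "continuous_on S (shift_by k :: (int \<Rightarrow> 'a::topological_space) \<Rightarrow> _)"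
proof -
  have "continuous_on UNIV (\<lambda>x :: int \<Rightarrow> 'a. x (n + k))" for n by simp
  then have "continuous_on UNIV (shift_by k :: (int \<Rightarrow> 'a) \<Rightarrow> _)"
    unfolding shift_by_def by (intro continuous_on_coordinatewise_then_product)
  then show ?thesis using continuous_on_subset by blast
qed

lemma shift_measurable [measurable]: "shift_by k \<in> borel_measurable (borel :: (int \<Rightarrow> 'a::topological_space) measure)"
  by (intro borel_measurable_continuous_onI continuous_shift)

lemma borel_shift_image:
  fixes A :: "(int \<Rightarrow> 'a::topological_space) set"
  assumes "A \<in> sets borel"
  shows "shift_by k ` A \<in> sets borel"
proof -
  have "shift_by k ` A = shift_by (- k) -` A \<inter> space borel"
  proof (intro equalityI subsetI)
    fix x assume "x \<in> shift_by (- k) -` A \<inter> space borel"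
    then show "x \<in> shift_by k ` A" by (intro image_eqI[of _ _ "shift_by (- k) x"]) auto
  qed auto
  then show ?thesis using measurable_sets[OF shift_measurable assms] by metis
qed

lemma compact_full_shift: "compact (UNIV :: (int \<Rightarrow> 'a::{finite,topological_space}) set)"
proof -
  have "compact_space (product_topology (\<lambda>i::int. euclidean :: 'a topology) UNIV)"
    unfolding compact_space_product_topology
    by (simp add: compact_space_def finite_imp_compact)
  then have "compactin euclidean (UNIV :: (int \<Rightarrow> 'a) set)"
    unfolding euclidean_product_topology compact_space_def by simp
  then show ?thesis by simp
qed

lemma compact_coded_shift: "compact (coded_shift G :: (int \<Rightarrow> 'a::{finite,topological_space}) set)"
  unfolding coded_shift_def using compact_full_shift compact_Int_closed[of UNIV "closure (con_set G)"] by auto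

lemma coded_shift_shift:
  fixes x :: "int \<Rightarrow> 'a::discrete_topology"
  assumes "x \<in> coded_shift G"
  shows "shift_by k x \<in> coded_shift G"
  unfolding coded_shift_def closure_agree
proof
  fix r
  obtain y where "y \<in> con_set G" "agree (r + nat \<bar>k\<bar>) x y"
    using assms unfolding coded_shift_def closure_agree by blast
  then show "\<exists>y\<in>con_set G. agree r (shift_by k x) y"
    using agree_shift con_set_shift by blast
qed

lemma coded_shift_mono: "F \<subseteq> G \<Longrightarrow> coded_shift F \<subseteq> coded_shift G"
  unfolding coded_shift_def by (intro closure_mono con_set_mono)

lemma con_set_subset_coded_shift: "con_set G \<subseteq> coded_shift G"
  unfolding coded_shift_def by (rule closure_subset)

text \<open>Uniform continuity by a finite subcover: \<open>R\<close> exceeds the radii of all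
  chosen centres, so two points that agree up to \<open>R\<close> lie in the neighbourhood of a
  common centre.\<close>

lemma continuous_uniform_agree:
  fixes \<phi> :: "(int \<Rightarrow> 'a::discrete_topology) \<Rightarrow> real"
  assumes X: "compact X" and cont: "continuous_on X \<phi>" and e: "0 < e"
  obtains r where "\<And>x y. x \<in> X \<Longrightarrow> y \<in> X \<Longrightarrow> agree r x y \<Longrightarrow> \<bar>\<phi> x - \<phi> y\<bar> \<le> e"
proof -
  have "\<exists>r. \<forall>y\<in>X. agree r x y \<longrightarrow> \<bar>\<phi> x - \<phi> y\<bar> < e / 2" if x: "x \<in> X" for x
  proof -
    from cont[unfolded continuous_on_open_invariant, rule_format, OF open_ball[of "\<phi> x" "e / 2"]]
    obtain A where A: "open A" "A \<inter> X = \<phi> -` ball (\<phi> x) (e / 2) \<inter> X" by blast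
    have "x \<in> \<phi> -` ball (\<phi> x) (e / 2) \<inter> X" using x e by simp
    then have "x \<in> A" unfolding A(2)[symmetric] by simp
    obtain r where r: "\<And>y. agree r x y \<Longrightarrow> y \<in> A" using open_imp_agree[OF A(1) \<open>x \<in> A\<close>] by blast
    have "\<bar>\<phi> x - \<phi> y\<bar> < e / 2" if "y \<in> X" "agree r x y" for y
    proof -
      have "y \<in> A \<inter> X" using r that by simp
      then have "\<phi> y \<in> ball (\<phi> x) (e / 2)" unfolding A(2) by simp
      then show ?thesis by (simp only: mem_ball dist_real_def)
    qed
    then show ?thesis by blast
  qed
  then obtain r where r: "\<And>x y. x \<in> X \<Longrightarrow> y \<in> X \<Longrightarrow> agree (r x) x y \<Longrightarrow> \<bar>\<phi> x - \<phi> y\<bar> < e / 2" by metis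
  have op: "open {y. agree (r x) x y}" for x by (rule open_finite_coordinates) (auto intro: agree_trans)
  have "X \<subseteq> (\<Union>x\<in>X. {y. agree (r x) x y})" by (auto simp: agree_def)
  from compactE_image[OF X op this]
  obtain D where D: "D \<subseteq> X" "finite D" "X \<subseteq> (\<Union>x\<in>D. {y. agree (r x) x y})" by blast
  define R where "R = Max (insert 0 (r ` D))"
  have "\<bar>\<phi> x - \<phi> y\<bar> \<le> e" if xy: "x \<in> X" "y \<in> X" "agree R x y" for x y
  proof -
    obtain d where d: "d \<in> D" "agree (r d) d x" using D xy by auto
    have "r d \<le> R" unfolding R_def using D(2) d(1) by (intro Max_ge) auto
    then have "agree (r d) d y" using d agree_mono[OF xy(3)] agree_trans by blast
    then have "\<bar>\<phi> d - \<phi> x\<bar> < e / 2" "\<bar>\<phi> d - \<phi> y\<bar> < e / 2" using r d D(1) xy by blast+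
    then show ?thesis by linarith
  qed
  then show ?thesis using that by blast
qed

text \<open>For finite \<open>F\<close> the sequences of words form a compact space under the
  explicitly chosen product of discrete topologies, and \<open>biconcat\<close> is continuous on it
  by \<open>biconcat_cong\<close>.\<close>

lemma compact_cut_set:
  fixes F :: "'a::discrete_topology list set"
  assumes F: "finite F" "[] \<notin> F"
  shows "compact (cut_set F)"
proof -
  let ?T = "product_topology (\<lambda>_::int. discrete_topology F) UNIV"
  have ts: "topspace ?T = {g. range g \<subseteq> F}" by auto
  have "compact_space ?T" unfolding compact_space_product_topology using F by (simp add: compact_space_discrete_topology)
  then have c: "compactin ?T {g. range g \<subseteq> F}" unfolding compact_space_def ts .
  have "continuous_map ?T euclidean biconcat"
    unfolding continuous_map_def
  proof (intro conjI allI impI)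
    show "biconcat \<in> topspace ?T \<rightarrow> topspace euclidean" by simp
    fix U :: "(int \<Rightarrow> 'a) set" assume "openin euclidean U"
    then have U: "open U" by simp
    show "openin ?T {g \<in> topspace ?T. biconcat g \<in> U}"
      unfolding openin_product_topology_alt
    proof (intro conjI ballI)
      fix g assume "g \<in> {g \<in> topspace ?T. biconcat g \<in> U}"
      then have g: "range g \<subseteq> F" "biconcat g \<in> U" unfolding ts by auto
      obtain r where r: "\<And>y. agree r (biconcat g) y \<Longrightarrow> y \<in> U" using open_imp_agree[OF U g(2)] by blast
      define W where "W = (\<lambda>i::int. if \<bar>i\<bar> \<le> int r + 1 then {g i} else F)"
      have "finite {i. W i \<noteq> topspace (discrete_topology F)}"
        by (rule finite_subset[of _ "{- (int r + 1)..int r + 1}"]) (auto simp: W_def split: if_splits)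
      moreover have "\<forall>i\<in>UNIV. openin (discrete_topology F) (W i)" using g by (auto simp: W_def)
      moreover have "g \<in> Pi\<^sub>E UNIV W" using g by (auto simp: W_def)
      moreover have "Pi\<^sub>E UNIV W \<subseteq> {g \<in> topspace ?T. biconcat g \<in> U}"
      proof
        fix g' assume "g' \<in> Pi\<^sub>E UNIV W"
        then have g'W: "g' i \<in> W i" for i by auto
        have g': "range g' \<subseteq> F"
        proof (rule image_subsetI)
          fix i show "g' i \<in> F" using g'W[of i] g(1) by (auto simp: W_def split: if_splits)
        qed
        have gg: "g i = g' i" if "\<bar>i\<bar> \<le> int r + 1" for i using g'W[of i] that by (simp add: W_def)
        have "agree r (biconcat g) (biconcat g')"
          unfolding agree_def
        proof (intro allI impI)
          fix n assume "\<bar>n\<bar> \<le> int r"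
          then show "biconcat g n = biconcat g' n" by (intro biconcat_cong gg) (use F g g' in auto)
        qed
        then show "g' \<in> {g \<in> topspace ?T. biconcat g \<in> U}" using r g' unfolding ts by auto
      qed
      ultimately show "\<exists>W. finite {i \<in> UNIV. W i \<noteq> topspace (discrete_topology F)} \<and>
          (\<forall>i\<in>UNIV. openin (discrete_topology F) (W i)) \<and> g \<in> Pi\<^sub>E UNIV W \<and>
          Pi\<^sub>E UNIV W \<subseteq> {g \<in> topspace ?T. biconcat g \<in> U}" by (intro exI[of _ W]) simp
    qed
  qed
  from image_compactin[OF c this] show ?thesis unfolding cut_set_def by simp
qed

lemma con_set_bounded_shift:
  assumes "finite F" "[] \<notin> F"
  shows "con_set F = (\<Union>k\<in>{..Max (insert 0 (length ` F))}. shift_by (int k) ` cut_set F)"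
proof (intro equalityI subsetI)
  fix x assume "x \<in> con_set F"
  then obtain k g where g: "range g \<subseteq> F" "x = shift_by k (biconcat g)" unfolding con_set_eq cut_set_def by auto
  obtain g' r where g': "range g' \<subseteq> F" "r < length (g' 0)" "x = shift_by (int r) (biconcat g')"
    using shift_biconcat_rep[OF assms(2) g(1), of k] g(2) by metis
  have "length (g' 0) \<le> Max (insert 0 (length ` F))" using g' assms(1) by (intro Max_ge) auto
  then have "r \<in> {..Max (insert 0 (length ` F))}" using g' by simp
  then show "x \<in> (\<Union>k\<in>{..Max (insert 0 (length ` F))}. shift_by (int k) ` cut_set F)"
    using g' unfolding cut_set_def by blast
qed (auto simp: con_set_eq)

text \<open>Offsets are bounded by the longest generator, so \<open>con_set F\<close> is a finite
  union of compact sets and already closed. Hence measures on the coded shift of finitely many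
  generators live on concatenations.\<close>

lemma coded_shift_finite:
  fixes F :: "'a::discrete_topology list set"
  assumes "finite F" "[] \<notin> F"
  shows "coded_shift F = con_set F"
proof -
  have "compact (con_set F)"
    unfolding con_set_bounded_shift[OF assms]
    by (intro compact_UN compact_continuous_image continuous_shift compact_cut_set assms) auto
  then have "closed (con_set F)" by (rule compact_imp_closed)
  then show ?thesis unfolding coded_shift_def by simp
qed


text \<open>Unique representation makes \<open>biconcat\<close> injective on sequences over
  \<open>G\<close>. A bijection between naturals and integers turns two-sided sequences into
  one-sided ones, to which Lusin's theorem applies.\<close>

lemma borel_cut_set:
  fixes G :: "'a::{discrete_topology,countable} list set"
  assumes u: "uniquely_represents G" "[] \<notin> G"
  shows "cut_set G \<in> sets borel"
proof -
  have "infinite (UNIV :: int set)" by (rule infinite_UNIV_int)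
  then obtain \<iota> :: "nat \<Rightarrow> int" where \<iota>: "bij \<iota>"
    using bij_betw_from_nat_into[of "UNIV :: int set"] by auto
  define \<kappa> where "\<kappa> = inv \<iota>"
  have \<kappa>: "\<iota> (\<kappa> i) = i" "\<kappa> (\<iota> n) = n" for i n
    using \<iota> unfolding \<kappa>_def by (simp_all add: bij_is_inj bij_is_surj surj_f_inv_f)
  define f where "f = (\<lambda>s :: nat \<Rightarrow> 'a list. biconcat (s \<circ> \<kappa>))"
  have r: "range (s \<circ> \<kappa>) = range s" for s :: "nat \<Rightarrow> 'a list"
  proof -
    have "surj \<kappa>" using \<kappa>(2) by (rule surjI)
    then show ?thesis by (metis image_comp)
  qed
  have "cut_set G = f ` {s. range s \<subseteq> G}"
  proof (intro equalityI subsetI)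
    fix x assume "x \<in> cut_set G"
    then obtain g where g: "range g \<subseteq> G" "x = biconcat g" unfolding cut_set_def by auto
    have "x = f (g \<circ> \<iota>)" using g \<kappa> by (simp add: f_def comp_def)
    moreover have "range (g \<circ> \<iota>) \<subseteq> G" using g by auto
    ultimately show "x \<in> f ` {s. range s \<subseteq> G}" by blast
  next
    fix x assume "x \<in> f ` {s. range s \<subseteq> G}"
    then show "x \<in> cut_set G" unfolding cut_set_def f_def using r by blast
  qed
  moreover have "f ` {s. range s \<subseteq> G} \<in> sets borel"
  proof (rule borel_injective_image)
    show "countable G" by (rule countableI_type)
    show "inj_on f {s. range s \<subseteq> G}"
    proof (rule inj_onI)
      fix s t assume st: "s \<in> {s. range s \<subseteq> G}" "t \<in> {s. range s \<subseteq> G}" "f s = f t"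
      then have "s \<circ> \<kappa> = t \<circ> \<kappa>" using inj_onD[OF unique_biconcat[OF u]] r by (simp add: f_def)
      then show "s = t" using \<kappa> by (metis comp_apply ext)
    qed
    show "prefix_continuous G f"
      unfolding prefix_continuous_def
    proof (intro allI impI)
      fix s and U :: "(int \<Rightarrow> 'a) set" assume s: "range s \<subseteq> G" "open U" "f s \<in> U"
      obtain R where R: "\<And>y. agree R (f s) y \<Longrightarrow> y \<in> U" using open_imp_agree[OF s(2,3)] by blast
      \<comment> \<open>The prefix is long enough to contain every word that can be visible at the
        coordinates from -R to R.\<close>
      define n where "n = Suc (Max (\<kappa> ` {- (int R + 1)..int R + 1}))"
      have n: "\<kappa> i < n" if "\<bar>i\<bar> \<le> int R + 1" for i
        unfolding n_def less_Suc_eq_le using that by (intro Max_ge imageI) auto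
      have "f s' \<in> U" if s': "range s' \<subseteq> G" "\<forall>i<n. s' i = s i" for s'
      proof (rule R)
        show "agree R (f s) (f s')"
          unfolding agree_def f_def
        proof (intro allI impI)
          fix m assume m: "\<bar>m\<bar> \<le> int R"
          show "biconcat (s \<circ> \<kappa>) m = biconcat (s' \<circ> \<kappa>) m"
          proof (rule biconcat_cong)
            fix i assume "\<bar>i\<bar> \<le> \<bar>m\<bar> + 1"
            then have "\<kappa> i < n" using m n by auto
            then show "(s \<circ> \<kappa>) i = (s' \<circ> \<kappa>) i" using s'(2) by simp
          qed (use r s s' u in auto)
        qed
      qed
      then show "\<exists>n. \<forall>g'. range g' \<subseteq> G \<longrightarrow> (\<forall>i<n. g' i = s i) \<longrightarrow> f g' \<in> U" by blast
    qed
  qed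
  ultimately show ?thesis by simp
qed

lemma borel_con_set:
  fixes G :: "'a::{discrete_topology,countable} list set"
  assumes "uniquely_represents G" "[] \<notin> G"
  shows "con_set G \<in> sets borel"
proof -
  have "shift_by k ` cut_set G \<in> sets borel" for k by (intro borel_shift_image borel_cut_set assms)
  then show ?thesis unfolding con_set_eq by (intro sets.countable_UN' image_subsetI) auto
qed

section \<open>Entropy of partitions\<close>

text \<open>Shannon entropy of the distribution of \<open>f\<close>. Indexing by values in place of
  pieces admits values that are never taken; they contribute 0.\<close>

definition dist_entropy :: "'b measure \<Rightarrow> ('b \<Rightarrow> 's) \<Rightarrow> 's set \<Rightarrow> real" where
  "dist_entropy M f S = - (\<Sum>s\<in>S. measure M (f -` {s} \<inter> space M) * ln (measure M (f -` {s} \<inter> space M)))"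

context prob_space
begin

lemma integral_finite_valued:
  fixes g :: "'s \<Rightarrow> real"
  assumes S: "finite S" and f: "f \<in> M \<rightarrow>\<^sub>M count_space S"
  shows "integrable M (\<lambda>x. g (f x))"
    and "(\<integral>x. g (f x) \<partial>M) = (\<Sum>s\<in>S. g s * prob (f -` {s} \<inter> space M))"
proof -
  have A: "f -` {s} \<inter> space M \<in> sets M" if "s \<in> S" for s
    using measurable_sets[OF f, of "{s}"] that by simp
  have eq: "g (f x) = (\<Sum>s\<in>S. g s * indicator (f -` {s} \<inter> space M) x)" if "x \<in> space M" for x
  proof -
    have "f x \<in> S" using measurable_space[OF f that] by simp
    then have "(\<Sum>s\<in>S. g s * indicator (f -` {s} \<inter> space M) x) = (\<Sum>s\<in>S. if s = f x then g s else 0)"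
      using that by (intro sum.cong) (auto simp: indicator_def)
    then show ?thesis using S \<open>f x \<in> S\<close> by simp
  qed
  have i: "integrable M (\<lambda>x. \<Sum>s\<in>S. g s * indicator (f -` {s} \<inter> space M) x)"
    using A by (intro Bochner_Integration.integrable_sum integrable_mult_right) (auto simp: emeasure_eq_measure)
  show "integrable M (\<lambda>x. g (f x))" using i by (subst Bochner_Integration.integrable_cong[OF refl eq]) auto
  have "(\<integral>x. g (f x) \<partial>M) = (\<integral>x. (\<Sum>s\<in>S. g s * indicator (f -` {s} \<inter> space M) x) \<partial>M)"
    by (intro Bochner_Integration.integral_cong eq refl)
  also have "\<dots> = (\<Sum>s\<in>S. g s * prob (f -` {s} \<inter> space M))"
    using A by (subst Bochner_Integration.integral_sum) (auto simp: emeasure_eq_measure intro!: sum.cong)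
  finally show "(\<integral>x. g (f x) \<partial>M) = (\<Sum>s\<in>S. g s * prob (f -` {s} \<inter> space M))" .
qed

lemma dist_entropy_integral:
  assumes "finite S" "f \<in> M \<rightarrow>\<^sub>M count_space S"
  shows "dist_entropy M f S = (\<integral>x. - ln (prob (f -` {f x} \<inter> space M)) \<partial>M)"
  using integral_finite_valued(2)[OF assms, of "\<lambda>s. - ln (prob (f -` {s} \<inter> space M))"]
  by (simp add: dist_entropy_def sum_negf mult.commute)

lemma AE_prob_fibre_pos:
  assumes "finite S" "f \<in> M \<rightarrow>\<^sub>M count_space S"
  shows "AE x in M. 0 < prob (f -` {f x} \<inter> space M)"
proof -
  have "AE x in M. x \<notin> f -` {s} \<inter> space M" if "s \<in> S" "prob (f -` {s} \<inter> space M) = 0" for s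
    using measurable_sets[OF assms(2), of "{s}"] that
    by (intro AE_not_in null_setsI) (auto simp: emeasure_eq_measure)
  then have "AE x in M. \<forall>s\<in>S. prob (f -` {s} \<inter> space M) = 0 \<longrightarrow> x \<notin> f -` {s} \<inter> space M"
    using assms(1) by (intro AE_finite_allI) auto
  then show ?thesis using AE_space
  proof eventually_elim
    case (elim x)
    then have "f x \<in> S" using measurable_space[OF assms(2)] by auto
    with elim have "prob (f -` {f x} \<inter> space M) \<noteq> 0" by auto
    then show ?case using measure_nonneg less_eq_real_def by metis
  qed
qed

text \<open>Gibbs' inequality: apply ln t \<le> t - 1 to the quotient of \<open>Q\<close> and the
  true distribution. \<open>D\<close> plays the part of a code length bounding - ln Q from above; it
  may depend on the point itself and not only on \<open>f x\<close>, which allows Birkhoff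
  sums.\<close>

lemma dist_entropy_le_cross_entropy:
  assumes S: "finite S" and f: "f \<in> M \<rightarrow>\<^sub>M count_space S"
    and Q: "\<And>s. s \<in> S \<Longrightarrow> 0 \<le> Q s" "sum Q S \<le> 1"
    and D: "integrable M D" "AE x in M. exp (- D x) \<le> Q (f x)"
  shows "dist_entropy M f S \<le> (\<integral>x. D x \<partial>M)"
proof -
  define p where "p = (\<lambda>s. prob (f -` {s} \<inter> space M))"
  let ?g = "\<lambda>s. Q s / p s"
  have int: "integrable M (\<lambda>x. - ln (p (f x)) - (?g (f x) - 1))"
    by (rule integral_finite_valued(1)[OF S f])
  have "(\<integral>x. - ln (p (f x)) - (?g (f x) - 1) \<partial>M) \<le> (\<integral>x. D x \<partial>M)"
  proof (rule integral_mono_AE[OF int D(1)])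
    show "AE x in M. - ln (p (f x)) - (?g (f x) - 1) \<le> D x"
      using AE_prob_fibre_pos[OF S f] D(2)
    proof eventually_elim
      case (elim x)
      then have pos: "0 < p (f x)" "0 < Q (f x)" by (auto simp: p_def intro: less_le_trans[OF exp_gt_zero])
      have "- D x \<le> ln (Q (f x))" using elim pos by (simp add: ln_ge_iff)
      moreover have "ln (Q (f x) / p (f x)) \<le> Q (f x) / p (f x) - 1" using pos by (intro ln_le_minus_one) simp
      ultimately show ?case using pos by (simp add: ln_div)
    qed
  qed
  also have "(\<integral>x. - ln (p (f x)) - (?g (f x) - 1) \<partial>M) = (\<integral>x. - ln (p (f x)) \<partial>M) - (\<integral>x. ?g (f x) - 1 \<partial>M)"
    by (intro Bochner_Integration.integral_diff integral_finite_valued(1)[OF S f, of "\<lambda>s. - ln (p s)"]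
        integral_finite_valued(1)[OF S f, of "\<lambda>s. ?g s - 1"])
  also have "(\<integral>x. - ln (p (f x)) \<partial>M) = dist_entropy M f S"
    using dist_entropy_integral[OF S f] by (simp add: p_def)
  also have "(\<integral>x. ?g (f x) - 1 \<partial>M) = (\<integral>x. ?g (f x) \<partial>M) - 1"
    using integral_finite_valued(1)[OF S f, of ?g] by (subst Bochner_Integration.integral_diff) (auto simp: prob_space)
  finally have le: "dist_entropy M f S - ((\<integral>x. ?g (f x) \<partial>M) - 1) \<le> (\<integral>x. D x \<partial>M)" .
  have "(\<integral>x. ?g (f x) \<partial>M) = (\<Sum>s\<in>S. ?g s * p s)"
    using integral_finite_valued(2)[OF S f, of ?g] by (simp add: p_def)
  also have "\<dots> \<le> sum Q S" using Q(1) by (intro sum_mono) auto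
  finally show ?thesis using le Q(2) by simp
qed

text \<open>The converse direction: small atoms force large entropy, since entropy is the mean of -
  ln of the measure of the atom.\<close>

lemma dist_entropy_ge:
  assumes S: "finite S" and f: "f \<in> M \<rightarrow>\<^sub>M count_space S"
    and D: "integrable M D" "AE x in M. prob (f -` {f x} \<inter> space M) \<le> exp (- D x)"
  shows "(\<integral>x. D x \<partial>M) \<le> dist_entropy M f S"
  unfolding dist_entropy_integral[OF S f]
proof (rule integral_mono_AE[OF D(1) integral_finite_valued(1)[OF S f]])
  show "AE x in M. D x \<le> - ln (prob (f -` {f x} \<inter> space M))"
    using AE_prob_fibre_pos[OF S f] D(2)
  proof eventually_elim
    case (elim x)
    then have "ln (prob (f -` {f x} \<inter> space M)) \<le> ln (exp (- D x))" by (subst ln_le_cancel_iff) auto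
    then show ?case by simp
  qed
qed

lemma dist_entropy_nonneg: "0 \<le> dist_entropy M f S"
  unfolding dist_entropy_def
  by (auto simp: sum_negf[symmetric] intro!: sum_nonneg mult_nonneg_nonpos)
     (metis ln_le_zero_iff ln_0 measure_nonneg order.order_iff_strict prob_le_1)

end

text \<open>Fekete's lemma; nonnegativity keeps the infimum of the quotients finite.\<close>

lemma fekete_nonneg:
  fixes a :: "nat \<Rightarrow> real"
  assumes sub: "\<And>m n. a (m + n) \<le> a m + a n" and nn: "\<And>n. 0 \<le> a n"
  shows "convergent (\<lambda>n. a n / real n)"
proof -
  define L where "L = (INF n\<in>{1..}. a n / real n)"
  have bdd: "bdd_below ((\<lambda>n. a n / real n) ` {1..})" using nn by (intro bdd_belowI2[of _ 0]) simp
  have lower: "L \<le> a n / real n" if "n \<ge> 1" for n unfolding L_def using that bdd by (intro cINF_lower) auto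
  have mult: "a (q * k + r) \<le> real q * a k + a r" for q k r
  proof (induction q)
    case (Suc q)
    have "a (Suc q * k + r) \<le> a k + a (q * k + r)" using sub[of k "q * k + r"] by (simp add: add.assoc)
    then show ?case using Suc by (simp add: algebra_simps)
  qed simp
  have "(\<lambda>n. a n / real n) \<longlonglongrightarrow> L"
  proof (rule LIMSEQ_I)
    fix e :: real assume e: "0 < e"
    have "L < L + e / 2" using e by simp
    then obtain k where k: "k \<ge> 1" "a k / real k < L + e / 2"
      unfolding L_def using cINF_less_iff[OF _ bdd, of "L + e / 2"] L_def by auto
    \<comment> \<open>One bound for all remainders \<open>a r\<close> that division by k can
      leave.\<close>
    define C where "C = (\<Sum>r<k. a r)"
    have C: "a r \<le> C" if "r < k" for r unfolding C_def using that nn by (intro member_le_sum) auto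
    have C0: "0 \<le> C" unfolding C_def using nn by (intro sum_nonneg)
    obtain N where N: "real N > 2 * C / e" using reals_Archimedean2 by blast
    show "\<exists>n0. \<forall>n\<ge>n0. norm (a n / real n - L) < e"
    proof (intro exI[of _ "max 1 N"] allI impI)
      fix n assume n: "n \<ge> max 1 N"
      have "a n \<le> real (n div k) * a k + a (n mod k)" using mult[of "n div k" k "n mod k"] by simp
      also have "\<dots> \<le> real n / real k * a k + C"
      proof (intro add_mono mult_right_mono)
        have "real (n div k) * real k \<le> real n"
          by (metis div_times_less_eq_dividend of_nat_le_iff of_nat_mult)
        then show "real (n div k) \<le> real n / real k" using k by (simp add: field_simps)
      qed (use k nn C in auto)
      finally have "a n / real n \<le> (real n / real k * a k + C) / real n" by (rule divide_right_mono) simp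
      also have "\<dots> = a k / real k + C / real n" using n by (simp add: field_simps)
      also have "C / real n < e / 2"
      proof -
        have "2 * C / e < real n" using N n by simp
        then show ?thesis using e n by (simp add: field_simps)
      qed
      finally have "a n / real n < L + e" using k by simp
      moreover have "L \<le> a n / real n" using lower n by simp
      ultimately show "norm (a n / real n - L) < e" using e by simp
    qed
  qed
  then show ?thesis by (auto simp: convergent_def)
qed

section \<open>Itineraries under a measure-preserving map\<close>

locale measure_preserving = prob_space M for M :: "'b measure" +
  fixes T :: "'b \<Rightarrow> 'b"
  assumes T_meas [measurable]: "T \<in> M \<rightarrow>\<^sub>M M" and T_inv: "distr M M T = M"
begin

lemma funpow_meas [measurable]: "T ^^ n \<in> M \<rightarrow>\<^sub>M M"
proof (induction n)
  case (Suc n)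
  then show ?case using measurable_comp[OF Suc T_meas] by simp
qed (simp add: measurable_ident id_def)

lemma funpow_inv: "distr M M (T ^^ n) = M"
proof (induction n)
  case (Suc n)
  have "distr M M (T ^^ Suc n) = distr (distr M M (T ^^ n)) M T" by (subst distr_distr) auto
  then show ?case unfolding Suc T_inv .
qed (simp add: id_def distr_id)

lemma integral_funpow:
  fixes g :: "'b \<Rightarrow> real"
  assumes [measurable]: "g \<in> borel_measurable M"
  shows "(\<integral>x. g ((T ^^ n) x) \<partial>M) = (\<integral>x. g x \<partial>M)"
  using integral_distr[OF funpow_meas[of n] assms] unfolding funpow_inv by simp

lemma integrable_funpow:
  fixes g :: "'b \<Rightarrow> real"
  assumes "integrable M g"
  shows "integrable M (\<lambda>x. g ((T ^^ n) x))"
  using integrable_distr[OF funpow_meas[of n], of g] assms unfolding funpow_inv by simp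

lemma prob_funpow:
  assumes "A \<in> sets M"
  shows "prob ((T ^^ n) -` A \<inter> space M) = prob A"
  using measure_distr[OF funpow_meas[of n] assms] unfolding funpow_inv by simp

lemma AE_funpow:
  assumes "AE x in M. P x"
  shows "AE x in M. P ((T ^^ n) x)"
proof -
  have "AE x in distr M M (T ^^ n). P x" using assms unfolding funpow_inv .
  then show ?thesis by (rule AE_distrD[OF funpow_meas])
qed

definition itinerary :: "('b \<Rightarrow> 's) \<Rightarrow> nat \<Rightarrow> 'b \<Rightarrow> 's list" where
  "itinerary l n x = map (\<lambda>i. l ((T ^^ i) x)) [0..<n]"

lemma length_itinerary [simp]: "length (itinerary l n x) = n" by (simp add: itinerary_def)

lemma itinerary_add: "itinerary l (m + n) x = itinerary l m x @ itinerary l n ((T ^^ m) x)"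
proof (rule nth_equalityI)
  fix i assume "i < length (itinerary l (m + n) x)"
  then show "itinerary l (m + n) x ! i = (itinerary l m x @ itinerary l n ((T ^^ m) x)) ! i"
    by (auto simp: itinerary_def nth_append funpow_add[symmetric, unfolded comp_def fun_eq_iff, rule_format])
qed simp

lemma itinerary_eq_iff: "itinerary l n x = s \<longleftrightarrow> length s = n \<and> (\<forall>i<n. l ((T ^^ i) x) = s ! i)"
  unfolding list_eq_iff_nth_eq by (auto simp: itinerary_def)

lemma itinerary_meas:
  assumes S: "finite S" and l: "l \<in> M \<rightarrow>\<^sub>M count_space S"
  shows "itinerary l n \<in> M \<rightarrow>\<^sub>M count_space {s. set s \<subseteq> S \<and> length s = n}"
proof (rule measurable_count_space_eq2[THEN iffD2])
  show "finite {s. set s \<subseteq> S \<and> length s = n}" using finite_lists_length_eq[OF S] .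
  have in_S: "l ((T ^^ i) x) \<in> S" if "x \<in> space M" for x i
    using measurable_space[OF measurable_comp[OF funpow_meas[of i] l] that] by simp
  show "itinerary l n \<in> space M \<rightarrow> {s. set s \<subseteq> S \<and> length s = n} \<and>
     (\<forall>s\<in>{s. set s \<subseteq> S \<and> length s = n}. itinerary l n -` {s} \<inter> space M \<in> sets M)"
  proof (intro conjI ballI)
    show "itinerary l n \<in> space M \<rightarrow> {s. set s \<subseteq> S \<and> length s = n}" using in_S by (auto simp: itinerary_def)
    fix s assume s: "s \<in> {s. set s \<subseteq> S \<and> length s = n}"
    have "itinerary l n -` {s} \<inter> space M = {x \<in> space M. \<forall>i\<in>{..<n}. l ((T ^^ i) x) = s ! i}"
      using s by (auto simp: itinerary_eq_iff)
    also have "\<dots> \<in> sets M"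
    proof (rule sets.sets_Collect_finite_All)
      fix i assume i: "i \<in> {..<n}"
      then have "s ! i \<in> S" using s by (auto dest!: nth_mem)
      then have "(\<lambda>x. l ((T ^^ i) x)) -` {s ! i} \<inter> space M \<in> sets M"
        using measurable_sets[OF measurable_comp[OF funpow_meas[of i] l], of "{s ! i}"] by (simp add: comp_def)
      moreover have "(\<lambda>x. l ((T ^^ i) x)) -` {s ! i} \<inter> space M = {x \<in> space M. l ((T ^^ i) x) = s ! i}" by auto
      ultimately show "{x \<in> space M. l ((T ^^ i) x) = s ! i} \<in> sets M" by simp
    qed simp
    finally show "itinerary l n -` {s} \<inter> space M \<in> sets M" .
  qed
qed

abbreviation "itin_entropy l S n \<equiv> dist_entropy M (itinerary l n) {s. set s \<subseteq> S \<and> length s = n}"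

text \<open>The product of the distributions of the first m and of the last n labels is a
  probability on itineraries of length m + n. By invariance, the cross entropy relative to it is the
  sum on the right.\<close>

lemma itin_entropy_subadditive:
  assumes S: "finite S" and l: "l \<in> M \<rightarrow>\<^sub>M count_space S"
  shows "itin_entropy l S (m + n) \<le> itin_entropy l S m + itin_entropy l S n"
proof -
  define p where "p = (\<lambda>k s. prob (itinerary l k -` {s} \<inter> space M))"
  let ?W = "\<lambda>k. {s. set s \<subseteq> S \<and> length s = k}"
  have W: "finite (?W k)" for k using finite_lists_length_eq[OF S] .
  note im = itinerary_meas[OF S l]
  define D where "D = (\<lambda>x. - ln (p m (itinerary l m x)) + - ln (p n (itinerary l n ((T ^^ m) x))))"
  have i1: "integrable M (\<lambda>x. - ln (p k (itinerary l k x)))" for k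
    by (rule integral_finite_valued(1)[OF W im])
  have i2: "integrable M (\<lambda>x. - ln (p n (itinerary l n ((T ^^ m) x))))"
    by (rule integrable_funpow[OF i1])
  have sum1: "sum (p k) (?W k) = 1" for k
    using integral_finite_valued(2)[OF W im, of "\<lambda>_. 1" k] by (simp add: p_def prob_space)
  have "itin_entropy l S (m + n) \<le> (\<integral>x. D x \<partial>M)"
  proof (rule dist_entropy_le_cross_entropy[OF W im, where Q = "\<lambda>s. p m (take m s) * p n (drop m s)"])
    show "0 \<le> p m (take m s) * p n (drop m s)" for s by (simp add: p_def)
    have "(\<Sum>s\<in>?W (m + n). p m (take m s) * p n (drop m s)) = (\<Sum>z\<in>?W m \<times> ?W n. p m (fst z) * p n (snd z))"
      by (rule sum.reindex_bij_witness[of _ "\<lambda>z. fst z @ snd z" "\<lambda>s. (take m s, drop m s)"])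
         (auto dest: in_set_takeD in_set_dropD)
    also have "\<dots> = (\<Sum>a\<in>?W m. \<Sum>b\<in>?W n. p m a * p n b)"
      by (simp add: sum.cartesian_product case_prod_beta)
    also have "\<dots> = 1" using sum1 by (simp add: sum_distrib_left[symmetric])
    finally show "(\<Sum>s\<in>?W (m + n). p m (take m s) * p n (drop m s)) \<le> 1" by simp
    show "integrable M D" unfolding D_def using i1 i2 by (intro Bochner_Integration.integrable_add)
    show "AE x in M. exp (- D x) \<le> p m (take m (itinerary l (m + n) x)) * p n (drop m (itinerary l (m + n) x))"
      using AE_prob_fibre_pos[OF W im, of m] AE_funpow[OF AE_prob_fibre_pos[OF W im, of n], of m]
      by eventually_elim (simp add: D_def itinerary_add exp_add p_def)
  qed
  also have "(\<integral>x. D x \<partial>M) = itin_entropy l S m + itin_entropy l S n"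
    unfolding D_def using integral_funpow[OF borel_measurable_integrable[OF i1], of n m] i1[of m] i2
    by (simp add: dist_entropy_integral[OF W im] p_def)
  finally show ?thesis .
qed

lemma itin_entropy_convergent:
  assumes "finite S" "l \<in> M \<rightarrow>\<^sub>M count_space S"
  shows "convergent (\<lambda>n. itin_entropy l S n / real n)"
  using itin_entropy_subadditive[OF assms] dist_entropy_nonneg by (intro fekete_nonneg)

definition label :: "'b set set \<Rightarrow> 'b \<Rightarrow> 'b set" where
  "label P x = (THE A. A \<in> P \<and> x \<in> A)"

lemma label_eq_iff:
  assumes "P \<in> finite_partitions M" "x \<in> space M"
  shows "label P x = A \<and> A \<in> P \<longleftrightarrow> A \<in> P \<and> x \<in> A" "label P x \<in> P" "x \<in> label P x"
proof -
  have "\<exists>A. A \<in> P \<and> x \<in> A"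
    using assms unfolding finite_partitions_def partition_on_def by auto
  moreover have "A = B" if "A \<in> P \<and> x \<in> A" "B \<in> P \<and> x \<in> B" for A B
    using assms that unfolding finite_partitions_def partition_on_def disjoint_def by blast
  ultimately have ex1: "\<exists>!A. A \<in> P \<and> x \<in> A" by blast
  from theI'[OF ex1] show "label P x \<in> P" "x \<in> label P x" unfolding label_def by auto
  with ex1 show "label P x = A \<and> A \<in> P \<longleftrightarrow> A \<in> P \<and> x \<in> A" by auto
qed

lemma label_meas:
  assumes P: "P \<in> finite_partitions M"
  shows "label P \<in> M \<rightarrow>\<^sub>M count_space P"
proof (rule measurable_count_space_eq2[THEN iffD2])
  show "finite P" using P by (simp add: finite_partitions_def)
  show "label P \<in> space M \<rightarrow> P \<and> (\<forall>A\<in>P. label P -` {A} \<inter> space M \<in> sets M)"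
  proof (intro conjI ballI)
    show "label P \<in> space M \<rightarrow> P" using label_eq_iff(2)[OF P] by auto
    fix A assume A: "A \<in> P"
    then have "A \<in> sets M" using P by (auto simp: finite_partitions_def)
    moreover have "label P -` {A} \<inter> space M = A"
      using label_eq_iff(1)[OF P] A sets.sets_into_space[OF \<open>A \<in> sets M\<close>] by blast
    ultimately show "label P -` {A} \<inter> space M \<in> sets M" by simp
  qed
qed

text \<open>Pieces of the iterated join correspond bijectively to the itineraries that occur; an
  itinerary that does not occur has an empty fibre and contributes 0.\<close>

lemma partition_entropy_iterated_join:
  assumes P: "P \<in> finite_partitions M"
  shows "partition_entropy M (iterated_join M T P n) = itin_entropy (label P) P n"
proof -
  let ?W = "{s. set s \<subseteq> P \<and> length s = n}"
  define c where "c = (\<lambda>s. itinerary (label P) n -` {s} \<inter> space M)"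
  have fP: "finite P" using P by (simp add: finite_partitions_def)
  have W: "finite ?W" using finite_lists_length_eq[OF fP] .
  have csp: "(T ^^ i) x \<in> space M" if "x \<in> space M" for x i using measurable_space[OF funpow_meas that] .
  have c: "c s = {x \<in> space M. \<forall>i<n. (T ^^ i) x \<in> s ! i}" if "s \<in> ?W" for s
  proof -
    have "label P ((T ^^ i) x) = s ! i \<longleftrightarrow> (T ^^ i) x \<in> s ! i" if "i < n" "x \<in> space M" for i x
    proof -
      have "s ! i \<in> P" using \<open>s \<in> ?W\<close> \<open>i < n\<close> by (auto dest!: nth_mem)
      then show ?thesis using label_eq_iff(1)[OF P csp[OF that(2)], of i "s ! i"] by blast
    qed
    then show ?thesis using that unfolding c_def by (auto simp: itinerary_eq_iff)
  qed
  have join: "iterated_join M T P n = c ` {s \<in> ?W. c s \<noteq> {}}"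
  proof (intro equalityI subsetI)
    fix A assume "A \<in> iterated_join M T P n"
    then obtain f where f: "A = {x \<in> space M. \<forall>i<n. (T ^^ i) x \<in> f i}" "\<forall>i<n. f i \<in> P" "A \<noteq> {}"
      unfolding iterated_join_def by auto
    have "map f [0..<n] \<in> ?W" using f by auto
    moreover have "c (map f [0..<n]) = A" unfolding c[OF calculation] f(1) by auto
    ultimately show "A \<in> c ` {s \<in> ?W. c s \<noteq> {}}" using f(3) by blast
  next
    fix A assume "A \<in> c ` {s \<in> ?W. c s \<noteq> {}}"
    then obtain s where s: "s \<in> ?W" "A = c s" "A \<noteq> {}" by auto
    then have "\<forall>i<n. s ! i \<in> P" by (auto dest!: nth_mem)
    then show "A \<in> iterated_join M T P n"
      unfolding iterated_join_def using s(2,3) c[OF s(1)] by blast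
  qed
  have inj: "inj_on c {s \<in> ?W. c s \<noteq> {}}" unfolding c_def by (rule inj_onI) auto
  have "(\<Sum>A\<in>iterated_join M T P n. prob A * ln (prob A)) = (\<Sum>s\<in>{s \<in> ?W. c s \<noteq> {}}. prob (c s) * ln (prob (c s)))"
    unfolding join by (rule sum.reindex[OF inj, unfolded comp_def])
  also have "\<dots> = (\<Sum>s\<in>?W. prob (c s) * ln (prob (c s)))"
    using W by (intro sum.mono_neutral_left) auto
  finally show ?thesis unfolding partition_entropy_def dist_entropy_def c_def by simp
qed

text \<open>Subadditivity guarantees convergence, so the value of \<open>lim\<close> in the
  definition of the entropy is a genuine limit.\<close>

lemma entropy_of_partition_limit:
  assumes P: "P \<in> finite_partitions M"
  shows "(\<lambda>n. itin_entropy (label P) P n / real n) \<longlonglongrightarrow> entropy_of_partition M T P"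
proof -
  have "finite P" using P by (simp add: finite_partitions_def)
  then show ?thesis
    using itin_entropy_convergent[OF _ label_meas[OF P]]
    unfolding entropy_of_partition_def partition_entropy_iterated_join[OF P] by (simp add: convergent_LIMSEQ_iff)
qed

end

lemma invariant_measure_preserving:
  assumes "\<mu> \<in> invariant_measures Z"
  shows "measure_preserving \<mu> left_shift"
  using assms unfolding invariant_measures_def measure_preserving_def measure_preserving_axioms_def by auto

section \<open>Entropy bounds from weights on words\<close>

definition cylindrical :: "nat \<Rightarrow> (int \<Rightarrow> 'a) set \<Rightarrow> bool" where
  "cylindrical r C \<longleftrightarrow> (\<forall>x y. agree r x y \<longrightarrow> (x \<in> C \<longleftrightarrow> y \<in> C))"

lemma cylindrical_mono: "cylindrical r C \<Longrightarrow> r \<le> s \<Longrightarrow> cylindrical s C"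
  unfolding cylindrical_def using agree_mono by blast

lemma cylindrical_Compl: "cylindrical r C \<Longrightarrow> cylindrical r (- C)"
  unfolding cylindrical_def by blast

lemma cylindrical_borel:
  fixes C :: "(int \<Rightarrow> 'a::discrete_topology) set"
  assumes "cylindrical r C"
  shows "C \<in> sets borel"
  using assms unfolding cylindrical_def by (intro borel_open open_finite_coordinates[of C r]) blast

text \<open>The approximable sets form a \<sigma>-algebra. It contains the open sets because an open
  set is the increasing union of the cylindrical sets of points whose agreement neighbourhood of
  radius r it contains.\<close>

lemma borel_cylindrical_approx:
  fixes N :: "(int \<Rightarrow> 'a::discrete_topology) measure"
  assumes N: "finite_measure N" "sets N = sets borel" and B: "B \<in> sets borel" and d: "0 < \<delta>"
  shows "\<exists>r C. cylindrical r C \<and> measure N (sym_diff B C) < \<delta>"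
proof -
  interpret finite_measure N by fact
  have cylN: "C \<in> sets N" if "cylindrical r C" for r C using cylindrical_borel[OF that] N(2) by simp
  have "B \<in> sigma_sets UNIV {S. open S}" using B by (simp add: borel_def)
  then show ?thesis using d
  proof (induction arbitrary: \<delta> rule: sigma_sets.induct)
    case (Basic U)
    then have U: "open U" by simp
    define C where "C = (\<lambda>r. {x. \<forall>y. agree r x y \<longrightarrow> y \<in> U})"
    have cyl: "cylindrical r (C r)" for r
      unfolding cylindrical_def C_def using agree_sym agree_trans by blast
    have CU: "C r \<subseteq> U" for r unfolding C_def agree_def by blast
    have UC: "(\<Union>r. C r) = U"
    proof (intro equalityI subsetI)
      fix x assume "x \<in> U"
      then obtain r where "\<And>y. agree r x y \<Longrightarrow> y \<in> U" using open_imp_agree[OF U] by blast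
      then show "x \<in> (\<Union>r. C r)" unfolding C_def by blast
    qed (use CU in blast)
    have "incseq C" unfolding C_def incseq_def using agree_mono by blast
    then have "(\<lambda>r. measure N (C r)) \<longlonglongrightarrow> measure N U"
      using finite_Lim_measure_incseq[of C] cylN[OF cyl] UC by (auto simp: image_subset_iff)
    from LIMSEQ_D[OF this \<open>0 < \<delta>\<close>] obtain r where "norm (measure N (C r) - measure N U) < \<delta>" by blast
    moreover have "measure N (sym_diff U (C r)) = measure N U - measure N (C r)"
      using CU[of r] finite_measure_Diff[of U "C r"] cylN[OF cyl] U N(2) by (simp add: Diff_eq_empty_iff[THEN iffD2])
    moreover have "measure N (C r) \<le> measure N U" using CU[of r] U N(2) by (intro finite_measure_mono) auto
    ultimately show ?case using cyl by (intro exI[of _ r] exI[of _ "C r"]) auto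
  next
    case Empty
    then show ?case by (intro exI[of _ 0] exI[of _ "{}"]) (auto simp: cylindrical_def)
  next
    case (Compl B)
    then obtain r C where "cylindrical r C" "measure N (sym_diff B C) < \<delta>" by blast
    moreover have "sym_diff (UNIV - B) (- C) = sym_diff B C" by auto
    ultimately show ?case using cylindrical_Compl by metis
  next
    case (Union B)
    have Bm: "B i \<in> sets N" for i using Union.hyps[of i] N(2) by (simp add: borel_def)
    have "(\<lambda>n. measure N (\<Union>i<n. B i)) \<longlonglongrightarrow> measure N (\<Union>n. \<Union>i<n. B i)"
      using Bm by (intro finite_Lim_measure_incseq incseq_SucI UN_mono image_subsetI sets.finite_UN) auto
    moreover have "(\<Union>n. \<Union>i<n. B i) = (\<Union>i. B i)" by auto
    ultimately have lim: "(\<lambda>n. measure N (\<Union>i<n. B i)) \<longlonglongrightarrow> measure N (\<Union>i. B i)" by simp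
    have "0 < \<delta> / 2" using Union.prems by simp
    from LIMSEQ_D[OF lim this] obtain n where n: "norm (measure N (\<Union>i<n. B i) - measure N (\<Union>i. B i)) < \<delta> / 2" by blast
    \<comment> \<open>One half of the error is spent on truncating the union, the other on the n
      approximations; the summand 1 covers n = 0.\<close>
    have "0 < \<delta> / (2 * (real n + 1))" using Union.prems by simp
    then have "\<exists>r C. cylindrical r C \<and> measure N (sym_diff (B i) C) < \<delta> / (2 * (real n + 1))" for i
      using Union.IH by blast
    then obtain r C where rC: "\<And>i. cylindrical (r i) (C i)" "\<And>i. measure N (sym_diff (B i) (C i)) < \<delta> / (2 * (real n + 1))"
      by metis
    define R where "R = Max (insert 0 (r ` {..<n}))"
    have R: "r i \<le> R" if "i < n" for i unfolding R_def using that by (intro Max_ge) auto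
    have CR: "cylindrical R (C i)" if "i < n" for i using cylindrical_mono[OF rC(1) R[OF that]] .
    have cyl: "cylindrical R (\<Union>i<n. C i)" using CR unfolding cylindrical_def by blast
    have sd: "sym_diff (B i) (C i) \<in> sets N" for i using Bm cylN[OF rC(1)] by auto
    have "measure N (sym_diff (\<Union>i. B i) (\<Union>i<n. C i))
       \<le> measure N (((\<Union>i. B i) - (\<Union>i<n. B i)) \<union> (\<Union>i<n. sym_diff (B i) (C i)))"
      using Bm sd by (intro finite_measure_mono) auto
    also have "\<dots> \<le> measure N ((\<Union>i. B i) - (\<Union>i<n. B i)) + measure N (\<Union>i<n. sym_diff (B i) (C i))"
      using Bm sd by (intro measure_Un_le) auto
    also have "measure N ((\<Union>i. B i) - (\<Union>i<n. B i)) = measure N (\<Union>i. B i) - measure N (\<Union>i<n. B i)"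
      using Bm by (intro finite_measure_Diff) auto
    also have "\<dots> < \<delta> / 2" using n unfolding real_norm_def by linarith
    also have "measure N (\<Union>i<n. sym_diff (B i) (C i)) \<le> (\<Sum>i<n. measure N (sym_diff (B i) (C i)))"
      using sd by (intro finite_measure_subadditive_finite) auto
    also have "\<dots> \<le> (\<Sum>i<n. \<delta> / (2 * (real n + 1)))" using rC(2) by (intro sum_mono less_imp_le)
    also have "\<dots> \<le> \<delta> / 2" using Union.prems by (simp add: field_simps)
    finally show ?case using cyl by (intro exI[of _ R] exI[of _ "\<Union>i<n. C i"]) simp
  qed
qed

text \<open>Independent letters with a subprobability depending on the position: the sum over words
  factorizes by splitting off the first letter.\<close>

lemma sum_lists_prod_le_1:
  fixes g :: "nat \<Rightarrow> 's \<Rightarrow> real"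
  assumes S: "finite S" and nn: "\<And>i s. s \<in> S \<Longrightarrow> 0 \<le> g i s" and le: "\<And>i. (\<Sum>s\<in>S. g i s) \<le> 1"
  shows "(\<Sum>l\<in>{l. set l \<subseteq> S \<and> length l = n}. \<Prod>i<n. g i (l ! i)) \<le> 1"
  using nn le
proof (induction n arbitrary: g)
  case (Suc n)
  let ?W = "{l. set l \<subseteq> S \<and> length l = n}"
  have W: "finite ?W" using finite_lists_length_eq[OF S] .
  have "(\<Sum>l\<in>{l. set l \<subseteq> S \<and> length l = Suc n}. \<Prod>i<Suc n. g i (l ! i))
      = (\<Sum>z\<in>S \<times> ?W. g 0 (fst z) * (\<Prod>i<n. g (Suc i) (snd z ! i)))"
    by (rule sum.reindex_bij_witness[of _ "\<lambda>z. fst z # snd z" "\<lambda>l. (hd l, tl l)"])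
       (auto simp: length_Suc_conv prod.lessThan_Suc_shift simp del: prod.lessThan_Suc)
  also have "\<dots> = (\<Sum>a\<in>S. \<Sum>b\<in>?W. g 0 a * (\<Prod>i<n. g (Suc i) (b ! i)))"
    by (simp add: sum.cartesian_product case_prod_beta)
  also have "\<dots> = (\<Sum>a\<in>S. g 0 a) * (\<Sum>b\<in>?W. \<Prod>i<n. g (Suc i) (b ! i))"
    by (simp add: sum_product)
  also have "\<dots> \<le> 1 * 1"
  proof (rule mult_mono)
    show "(\<Sum>b\<in>?W. \<Prod>i<n. g (Suc i) (b ! i)) \<le> 1" using Suc.IH[of "\<lambda>i. g (Suc i)"] Suc.prems by blast
    show "0 \<le> (\<Sum>b\<in>?W. \<Prod>i<n. g (Suc i) (b ! i))"
    proof (intro sum_nonneg prod_nonneg)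
      fix b i assume "b \<in> ?W" "i \<in> {..<n}"
      then have "b ! i \<in> S" by (auto dest!: nth_mem)
      then show "0 \<le> g (Suc i) (b ! i)" using Suc.prems(1) by blast
    qed
  qed (use Suc.prems in auto)
  finally show ?case by simp
next
  case 0
  have "{l. set l \<subseteq> S \<and> length l = 0} = {[]}" by auto
  then show ?case by simp
qed

lemma words_of_length_finite: "finite {u :: 'a::finite list. length u = n}"
  using finite_lists_length_eq[of "UNIV :: 'a set" n] by simp

lemma take_drop_slice:
  assumes "i + w \<le> n"
  shows "take w (drop i (slice x a n)) = slice x (a + int i) w"
  by (rule nth_equalityI) (use assms in \<open>auto simp: algebra_simps\<close>)

text \<open>\<open>Q\<close> is a subprobability on words of each length and \<open>D n\<close>
  bounds its code length from above. An arbitrary partition is handled by a cylindrical labelling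
  that errs with probability at most \<delta>: draw a word by \<open>Q\<close>, read off the
  approximate labels, and corrupt each independently. The code length of the true itinerary grows by
  - ln (1 - \<delta>) per step and by a further ln (c / \<delta>) at each error, where c is the
  number of pieces; both corrections vanish in the mean as \<delta> tends to 0.\<close>

lemma ks_entropy_le:
  fixes Q :: "'a::{finite,discrete_topology} list \<Rightarrow> real"
  assumes mu: "\<mu> \<in> invariant_measures X"
    and Q: "\<And>u. 0 \<le> Q u" "\<And>n. (\<Sum>u\<in>{u. length u = n}. Q u) \<le> 1"
    and D: "\<And>n. integrable \<mu> (D n)" "\<And>n. AE x in \<mu>. exp (- D n x) \<le> Q (slice x 0 n)"
      "\<And>n. (\<integral>x. D n x \<partial>\<mu>) \<le> real n * \<beta> + K"
  shows "ks_entropy \<mu> left_shift \<le> ereal \<beta>"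
  unfolding ks_entropy_def
proof (rule SUP_least)
  interpret measure_preserving \<mu> left_shift using invariant_measure_preserving[OF mu] .
  have sets_mu: "sets \<mu> = sets (restrict_space borel X)" using mu by (simp add: invariant_measures_def)
  have space_mu: "space \<mu> = X" using sets_eq_imp_space_eq[OF sets_mu] by (simp add: space_restrict_space)
  fix P assume P: "P \<in> finite_partitions \<mu>"
  have fP: "finite P" and Ps: "P \<subseteq> sets \<mu>" using P by (auto simp: finite_partitions_def)
  have ne: "P \<noteq> {}" using label_eq_iff(2)[OF P] not_empty by blast
  note lm = label_meas[OF P]
  let ?c = "real (card P)"
  have c: "0 < ?c" using fP ne by (simp add: card_gt_0_iff)
  let ?H = "itin_entropy (label P) P"
  have key: "entropy_of_partition \<mu> left_shift P \<le> \<beta> - ln (1 - \<delta>) + \<delta> * ln (?c / \<delta>)"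
    if \<delta>: "0 < \<delta>" "\<delta> < 1" for \<delta> :: real
  proof -
    \<comment> \<open>\<open>N\<close> is \<open>\<mu>\<close> regarded on the full shift, where
      Borel sets can be approximated by cylindrical ones.\<close>
    define N where "N = distr \<mu> borel (\<lambda>x. x)"
    have idm: "(\<lambda>x. x) \<in> \<mu> \<rightarrow>\<^sub>M borel"
      unfolding measurable_cong_sets[OF sets_mu refl] by (intro measurable_restrict_space1) simp
    interpret N: prob_space N unfolding N_def by (rule prob_space_distr[OF idm])
    have sN: "sets N = sets borel" by (simp add: N_def)
    have mN: "measure N S = prob (S \<inter> X)" if "S \<in> sets borel" for S
      unfolding N_def using measure_distr[OF idm that] space_mu by (simp add: vimage_def Int_def)
    have "\<exists>r C. cylindrical r C \<and> prob (sym_diff A C \<inter> X) < \<delta> / ?c" if "A \<in> P" for A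
    proof -
      have "A \<in> sets (restrict_space borel X)" using that Ps sets_mu by auto
      then obtain B where B: "B \<in> sets borel" "A = X \<inter> B" by (auto simp: sets_restrict_space)
      obtain r C where C: "cylindrical r C" "measure N (sym_diff B C) < \<delta> / ?c"
        using borel_cylindrical_approx[OF N.finite_measure_axioms sN B(1), of "\<delta> / ?c"] \<delta> c by auto
      have "sym_diff B C \<in> sets borel" using B(1) cylindrical_borel[OF C(1)] by auto
      from mN[OF this] have "prob (sym_diff B C \<inter> X) < \<delta> / ?c" using C(2) by simp
      moreover have "sym_diff B C \<inter> X = sym_diff A C \<inter> X" using B(2) by auto
      ultimately show ?thesis using C(1) by auto
    qed
    then obtain r0 C where C: "\<And>A. A \<in> P \<Longrightarrow> cylindrical (r0 A) (C A)"
      "\<And>A. A \<in> P \<Longrightarrow> prob (sym_diff A (C A) \<inter> X) < \<delta> / ?c" by metis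
    define r where "r = Max (insert 0 (r0 ` P))"
    have cyl: "cylindrical r (C A)" if "A \<in> P" for A
      using cylindrical_mono[OF C(1)[OF that], of r] fP that unfolding r_def by (auto intro: Max_ge)
    define bad where "bad = (\<Union>A\<in>P. sym_diff A (C A) \<inter> X)"
    have CX: "C A \<inter> X \<in> sets \<mu>" if "A \<in> P" for A
      using cylindrical_borel[OF cyl[OF that]] unfolding sets_mu by (auto simp: sets_restrict_space)
    have sdm: "sym_diff A (C A) \<inter> X \<in> sets \<mu>" if "A \<in> P" for A
    proof -
      have "A \<in> sets \<mu>" using that Ps by auto
      moreover have "sym_diff A (C A) \<inter> X = sym_diff A (C A \<inter> X)"
        using sets.sets_into_space[OF \<open>A \<in> sets \<mu>\<close>] space_mu by auto
      ultimately show ?thesis using CX[OF that] by auto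
    qed
    have badm: "bad \<in> sets \<mu>" unfolding bad_def using fP sdm by (intro sets.finite_UN) auto
    have pbad: "prob bad \<le> \<delta>"
    proof -
      have "prob bad \<le> (\<Sum>A\<in>P. prob (sym_diff A (C A) \<inter> X))"
        unfolding bad_def using fP sdm by (intro finite_measure_subadditive_finite) auto
      also have "\<dots> \<le> (\<Sum>A\<in>P. \<delta> / ?c)" using C(2) by (intro sum_mono less_imp_le)
      also have "\<dots> = \<delta>" using c by simp
      finally show ?thesis .
    qed
    \<comment> \<open>Off \<open>bad\<close> exactly one piece qualifies and the choice is the true
      label. On \<open>bad\<close> the value is arbitrary, but it still depends only on the
      coordinates up to radius \<open>r\<close>.\<close>
    define \<kappa>0 where "\<kappa>0 = (\<lambda>x. SOME A. A \<in> P \<and> x \<in> C A)"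
    have \<kappa>0_agree: "\<kappa>0 x = \<kappa>0 y" if "agree r x y" for x y
    proof -
      have "(A \<in> P \<and> x \<in> C A) = (A \<in> P \<and> y \<in> C A)" for A using cyl[of A] that unfolding cylindrical_def by blast
      then show ?thesis unfolding \<kappa>0_def by simp
    qed
    have \<kappa>0_lab: "label P x = \<kappa>0 x" if x: "x \<in> X" "x \<notin> bad" for x
    proof -
      have lx: "label P x \<in> P" "x \<in> label P x" using label_eq_iff[OF P] x space_mu by auto
      have iff: "x \<in> A \<longleftrightarrow> x \<in> C A" if "A \<in> P" for A using x that unfolding bad_def by auto
      have uniq: "A = label P x" if A: "A \<in> P \<and> x \<in> C A" for A
      proof -
        have "x \<in> A" using iff A by blast
        then show ?thesis using label_eq_iff(1)[OF P, of x A] x(1) A unfolding space_mu by blast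
      qed
      have "label P x \<in> P \<and> x \<in> C (label P x)" using lx iff by blast
      from some_equality[of "\<lambda>A. A \<in> P \<and> x \<in> C A", OF this uniq] show ?thesis unfolding \<kappa>0_def by simp
    qed
    \<comment> \<open>The number of coordinates seen by a label of radius \<open>r\<close>.
      Itineraries are started at time \<open>r\<close>, so that these windows begin at coordinate 0;
      invariance leaves the entropy unchanged.\<close>
    define w where "w = 2 * r + 1"
    define \<kappa> where "\<kappa> = (\<lambda>u :: 'a list. \<kappa>0 (\<lambda>i. u ! nat (i + int r)))"
    have \<kappa>: "\<kappa> (slice x (int i) w) = \<kappa>0 ((left_shift ^^ (i + r)) x)" for x i
      unfolding \<kappa>_def
    proof (rule \<kappa>0_agree)
      show "agree r (\<lambda>j. slice x (int i) w ! nat (j + int r)) ((left_shift ^^ (i + r)) x)"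
        unfolding agree_def funpow_left_shift shift_by_def w_def by (auto simp: abs_le_iff algebra_simps)
    qed
    \<comment> \<open>A noisy channel: the label \<open>B\<close> is kept with weight 1 - \<delta>,
      and each other label gets the weight \<delta> / c.\<close>
    define q where "q = (\<lambda>A B :: (int \<Rightarrow> 'a) set. if A = B then 1 - \<delta> else \<delta> / ?c)"
    have q0: "0 \<le> q A B" for A B using \<delta> c by (simp add: q_def)
    have q1: "(\<Sum>A\<in>P. q A B) \<le> 1" for B
    proof -
      have "(\<Sum>A\<in>P. q A B) \<le> (\<Sum>A\<in>P. (if A = B then 1 - \<delta> else 0) + \<delta> / ?c)"
        using \<delta> c by (intro sum_mono) (auto simp: q_def)
      also have "\<dots> = (if B \<in> P then 1 - \<delta> else 0) + \<delta>" using fP c ne by (simp add: sum.distrib)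
      also have "\<dots> \<le> 1" using \<delta> by simp
      finally show ?thesis .
    qed
    have bound: "?H n \<le> real n * (\<beta> - ln (1 - \<delta>) + \<delta> * ln (?c / \<delta>)) + (real w * \<beta> + K)" for n
    proof -
      let ?W = "{s. set s \<subseteq> P \<and> length s = n}"
      have W: "finite ?W" using finite_lists_length_eq[OF fP] .
      note im = itinerary_meas[OF fP lm, of n]
      let ?f = "\<lambda>x. itinerary (label P) n ((left_shift ^^ r) x)"
      have fm: "?f \<in> \<mu> \<rightarrow>\<^sub>M count_space ?W"
        using measurable_comp[OF funpow_meas[of r] im] by (simp add: comp_def)
      have He: "?H n = dist_entropy \<mu> ?f ?W"
      proof -
        have "prob (?f -` {s} \<inter> space \<mu>) = prob (itinerary (label P) n -` {s} \<inter> space \<mu>)" if "s \<in> ?W" for s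
        proof -
          have S: "itinerary (label P) n -` {s} \<inter> space \<mu> \<in> sets \<mu>" using measurable_sets[OF im, of "{s}"] that by simp
          have "(left_shift ^^ r) -` (itinerary (label P) n -` {s} \<inter> space \<mu>) \<inter> space \<mu> = ?f -` {s} \<inter> space \<mu>"
            using measurable_space[OF funpow_meas[of r]] by auto
          then show ?thesis using prob_funpow[OF S, of r] by simp
        qed
        then show ?thesis unfolding dist_entropy_def by simp
      qed
      define U where "U = {u :: 'a list. length u = n + w}"
      have fU: "finite U" unfolding U_def by (rule words_of_length_finite)
      \<comment> \<open>The output weight of the channel when the input word is drawn by
        \<open>Q\<close>.\<close>
      define Q' where "Q' = (\<lambda>l. \<Sum>u\<in>U. Q u * (\<Prod>i<n. q (l ! i) (\<kappa> (take w (drop i u)))))"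
      define b where "b = (\<lambda>i x. indicat_real bad ((left_shift ^^ (i + r)) x))"
      define D' where "D' = (\<lambda>x. D (n + w) x + (\<Sum>i<n. - ln (1 - \<delta>) + ln (?c / \<delta>) * b i x))"
      have bi: "integrable \<mu> (b i)" "(\<integral>x. b i x \<partial>\<mu>) \<le> \<delta>" for i
      proof -
        have "integrable \<mu> (indicat_real bad)" using badm by (simp add: emeasure_eq_measure)
        from integrable_funpow[OF this] show "integrable \<mu> (b i)" unfolding b_def .
        have "(\<integral>x. b i x \<partial>\<mu>) = (\<integral>x. indicat_real bad x \<partial>\<mu>)" unfolding b_def using badm by (intro integral_funpow) auto
        then show "(\<integral>x. b i x \<partial>\<mu>) \<le> \<delta>" using badm pbad by simp
      qed
      have lnc: "0 \<le> ln (?c / \<delta>)"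
      proof -
        have "1 \<le> card P" using fP ne by (simp add: Suc_le_eq card_gt_0_iff)
        then have "1 \<le> ?c" by simp
        then have "1 \<le> ?c / \<delta>" using \<delta> by (simp add: field_simps)
        then show ?thesis by simp
      qed
      have "dist_entropy \<mu> ?f ?W \<le> (\<integral>x. D' x \<partial>\<mu>)"
      proof (rule dist_entropy_le_cross_entropy[OF W fm, where Q = Q'])
        show "0 \<le> Q' l" for l unfolding Q'_def using Q(1) q0 by (intro sum_nonneg mult_nonneg_nonneg prod_nonneg) auto
        have "sum Q' ?W = (\<Sum>u\<in>U. Q u * (\<Sum>l\<in>?W. \<Prod>i<n. q (l ! i) (\<kappa> (take w (drop i u)))))"
          unfolding Q'_def by (subst sum.swap) (simp add: sum_distrib_left)
        also have "\<dots> \<le> (\<Sum>u\<in>U. Q u * 1)"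
          using Q(1) q0 q1 fP sum_lists_prod_le_1[of P "\<lambda>i A. q A (\<kappa> (take w (drop i _)))"]
          by (intro sum_mono mult_left_mono) auto
        also have "\<dots> \<le> 1" using Q(2) by (simp add: U_def)
        finally show "sum Q' ?W \<le> 1" .
        show "integrable \<mu> D'"
          unfolding D'_def using D(1) bi(1)
          by (intro Bochner_Integration.integrable_add Bochner_Integration.integrable_sum integrable_mult_right) auto
        show "AE x in \<mu>. exp (- D' x) \<le> Q' (?f x)"
          using D(2)[of "n + w"] AE_space
        proof eventually_elim
          case (elim x)
          let ?u = "slice x 0 (n + w)"
          have factor: "exp (- (- ln (1 - \<delta>) + ln (?c / \<delta>) * b i x)) \<le> q (?f x ! i) (\<kappa> (take w (drop i ?u)))"
            if i: "i < n" for i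
          proof -
            have fi: "?f x ! i = label P ((left_shift ^^ (i + r)) x)"
              using i by (simp add: itinerary_def funpow_add)
            have ki: "\<kappa> (take w (drop i ?u)) = \<kappa>0 ((left_shift ^^ (i + r)) x)"
              using i \<kappa>[of x i] by (simp add: take_drop_slice)
            have inX: "(left_shift ^^ (i + r)) x \<in> X" using measurable_space[OF funpow_meas[of "i + r"]] elim(2) space_mu by auto
            show ?thesis
            proof (cases "(left_shift ^^ (i + r)) x \<in> bad")
              case True
              \<comment> \<open>On \<open>bad\<close> the approximate label may or may not be right
                by accident, so the weight has to lie below both values of \<open>q\<close>; the
                product of the two is small enough.\<close>
              have "exp (- (- ln (1 - \<delta>) + ln (?c / \<delta>) * b i x)) = (1 - \<delta>) * (\<delta> / ?c)"
                using True \<delta> c by (simp add: b_def exp_diff exp_minus ln_div)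
              also have "\<dots> \<le> \<delta> / ?c" using \<delta> c by (intro mult_left_le_one_le) auto
              finally have 1: "exp (- (- ln (1 - \<delta>) + ln (?c / \<delta>) * b i x)) \<le> \<delta> / ?c" .
              have "(1 - \<delta>) * (\<delta> / ?c) \<le> (1 - \<delta>) * 1"
                using \<delta> c lnc by (intro mult_left_mono) (auto simp: field_simps)
              then have 2: "exp (- (- ln (1 - \<delta>) + ln (?c / \<delta>) * b i x)) \<le> 1 - \<delta>"
                using \<open>_ = (1 - \<delta>) * (\<delta> / ?c)\<close> by simp
              show ?thesis using 1 2 by (simp add: q_def)
            next
              case False
              then have "?f x ! i = \<kappa> (take w (drop i ?u))" using fi ki \<kappa>0_lab[OF inX] by simp
              then show ?thesis using False \<delta> by (simp add: q_def b_def)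
            qed
          qed
          have "exp (- D' x) = exp (- D (n + w) x) * (\<Prod>i<n. exp (- (- ln (1 - \<delta>) + ln (?c / \<delta>) * b i x)))"
            unfolding D'_def by (simp add: exp_add[symmetric] exp_sum[symmetric] sum_negf[symmetric] del: minus_add_distrib)
          also have "\<dots> \<le> Q ?u * (\<Prod>i<n. q (?f x ! i) (\<kappa> (take w (drop i ?u))))"
            using elim(1) factor Q(1) by (intro mult_mono prod_mono) (auto intro: prod_nonneg)
          also have "\<dots> \<le> Q' (?f x)"
            unfolding Q'_def using fU Q(1) q0
            by (intro member_le_sum[of ?u]) (auto simp: U_def intro!: mult_nonneg_nonneg prod_nonneg)
          finally show ?case .
        qed
      qed
      also have "(\<integral>x. D' x \<partial>\<mu>) = (\<integral>x. D (n + w) x \<partial>\<mu>) + (\<Sum>i<n. - ln (1 - \<delta>) + ln (?c / \<delta>) * (\<integral>x. b i x \<partial>\<mu>))"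
        unfolding D'_def using D(1) bi(1) by (simp add: Bochner_Integration.integral_sum prob_space)
      also have "\<dots> \<le> (real (n + w) * \<beta> + K) + (\<Sum>i<n. - ln (1 - \<delta>) + ln (?c / \<delta>) * \<delta>)"
        using D(3) bi(2) lnc by (intro add_mono sum_mono mult_left_mono order_refl)
      also have "\<dots> = real n * (\<beta> - ln (1 - \<delta>) + \<delta> * ln (?c / \<delta>)) + (real w * \<beta> + K)"
        by (simp add: algebra_simps)
      finally show ?thesis using He by simp
    qed
    show ?thesis
    proof (rule LIMSEQ_le[OF entropy_of_partition_limit[OF P]])
      let ?b = "\<beta> - ln (1 - \<delta>) + \<delta> * ln (?c / \<delta>)"
      show "(\<lambda>n. ?b + (real w * \<beta> + K) / real n) \<longlonglongrightarrow> ?b"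
        using tendsto_add[OF tendsto_const lim_const_over_n, of ?b "real w * \<beta> + K"] by simp
      show "\<exists>N. \<forall>n\<ge>N. ?H n / real n \<le> ?b + (real w * \<beta> + K) / real n"
      proof (intro exI[of _ 1] allI impI)
        fix n :: nat assume "1 \<le> n"
        then show "?H n / real n \<le> ?b + (real w * \<beta> + K) / real n"
          using divide_right_mono[OF bound[of n], of "real n"] by (simp add: add_divide_distrib)
      qed
    qed
  qed
  have "entropy_of_partition \<mu> left_shift P \<le> \<beta>"
  proof (rule LIMSEQ_le_const)
    \<comment> \<open>The choice \<delta> = 1 / m.\<close>
    have "(\<lambda>m. \<beta> - ln (1 - 1 / real m) + (ln ?c / real m + ln (real m) / real m)) \<longlonglongrightarrow> \<beta> - ln (1 - 0) + (0 + 0)"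
      by (intro tendsto_intros lim_const_over_n lim_ln_over_n) simp_all
    then show "(\<lambda>m. \<beta> - ln (1 - 1 / real m) + (ln ?c / real m + ln (real m) / real m)) \<longlonglongrightarrow> \<beta>" by simp
    show "\<exists>N. \<forall>m\<ge>N. entropy_of_partition \<mu> left_shift P
        \<le> \<beta> - ln (1 - 1 / real m) + (ln ?c / real m + ln (real m) / real m)"
    proof (intro exI[of _ 2] allI impI)
      fix m :: nat assume m: "2 \<le> m"
      have "1 / real m * ln (?c / (1 / real m)) = ln ?c / real m + ln (real m) / real m"
        using m c by (simp add: ln_mult add_divide_distrib)
      then show "entropy_of_partition \<mu> left_shift P
        \<le> \<beta> - ln (1 - 1 / real m) + (ln ?c / real m + ln (real m) / real m)"
        using key[of "1 / real m"] m by simp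
    qed
  qed
  then show "ereal (entropy_of_partition \<mu> left_shift P) \<le> ereal \<beta>" by simp
qed

section \<open>The upper bound\<close>

definition birkhoff :: "((int \<Rightarrow> 'a) \<Rightarrow> real) \<Rightarrow> nat \<Rightarrow> (int \<Rightarrow> 'a) \<Rightarrow> real" where
  "birkhoff \<phi> n x = (\<Sum>i<n. \<phi> (shift_by (int i) x))"

lemma birkhoff_add: "birkhoff \<phi> (m + n) x = birkhoff \<phi> m x + birkhoff \<phi> n (shift_by (int m) x)"
proof -
  have "{..<m + n} = {..<m} \<union> (\<lambda>i. m + i) ` {..<n}"
  proof (intro equalityI subsetI)
    fix i assume "i \<in> {..<m + n}"
    then show "i \<in> {..<m} \<union> (\<lambda>i. m + i) ` {..<n}" by (cases "i < m") (auto intro!: image_eqI[of _ _ "i - m"])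
  qed auto
  then have "birkhoff \<phi> (m + n) x = (\<Sum>i<m. \<phi> (shift_by (int i) x)) + (\<Sum>i\<in>(\<lambda>i. m + i) ` {..<n}. \<phi> (shift_by (int i) x))"
    unfolding birkhoff_def by (simp only:) (subst sum.union_disjoint, auto)
  then show ?thesis by (simp add: birkhoff_def sum.reindex add.commute)
qed

lemma abs_birkhoff_le:
  assumes "\<And>i. i < n \<Longrightarrow> \<bar>\<phi> (shift_by (int i) x)\<bar> \<le> B"
  shows "\<bar>birkhoff \<phi> n x\<bar> \<le> real n * B"
proof -
  have "\<bar>birkhoff \<phi> n x\<bar> \<le> (\<Sum>i<n. \<bar>\<phi> (shift_by (int i) x)\<bar>)" unfolding birkhoff_def by (rule sum_abs)
  also have "\<dots> \<le> (\<Sum>i<n. B)" using assms by (intro sum_mono) auto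
  finally show ?thesis by simp
qed

lemma birkhoff_shift_invariant_bound:
  fixes x :: "int \<Rightarrow> 'a::discrete_topology"
  assumes "\<And>x. x \<in> coded_shift G \<Longrightarrow> \<bar>\<phi> x\<bar> \<le> B" "x \<in> coded_shift G"
  shows "\<bar>birkhoff \<phi> n x\<bar> \<le> real n * B"
  using assms coded_shift_shift by (intro abs_birkhoff_le) blast

lemma continuous_coded_shift_bounded:
  fixes \<phi> :: "(int \<Rightarrow> 'a::{finite,topological_space}) \<Rightarrow> real"
  assumes "continuous_on (coded_shift G) \<phi>"
  obtains B where "0 \<le> B" "\<And>x. x \<in> coded_shift G \<Longrightarrow> \<bar>\<phi> x\<bar> \<le> B"
proof -
  have "bounded (\<phi> ` coded_shift G)"
    by (intro compact_imp_bounded compact_continuous_image assms compact_coded_shift)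
  then obtain B where "\<forall>x\<in>coded_shift G. \<bar>\<phi> x\<bar> \<le> B" unfolding bounded_iff by auto
  then show ?thesis using that[of "max 0 B"] by (simp add: le_max_iff_disj)
qed

text \<open>The \<psi> of the overview. Estimates of it are stated in the presence of a point of
  \<open>X\<close> in the cylinder, which makes the infimum range over a nonempty set.\<close>

definition word_weight :: "((int \<Rightarrow> 'a) \<Rightarrow> real) \<Rightarrow> (int \<Rightarrow> 'a) set \<Rightarrow> 'a list \<Rightarrow> real" where
  "word_weight \<phi> X w = (INF x\<in>{x \<in> X. slice x 0 (length w) = w}. birkhoff \<phi> (length w) x)"

lemma word_weight_le:
  fixes \<phi> :: "(int \<Rightarrow> 'a::discrete_topology) \<Rightarrow> real"
  assumes "\<And>x. x \<in> coded_shift G \<Longrightarrow> \<bar>\<phi> x\<bar> \<le> B"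
    and x: "x \<in> coded_shift G" "slice x 0 (length w) = w"
  shows "word_weight \<phi> (coded_shift G) w \<le> birkhoff \<phi> (length w) x"
  unfolding word_weight_def
proof (rule cINF_lower)
  show "bdd_below (birkhoff \<phi> (length w) ` {x \<in> coded_shift G. slice x 0 (length w) = w})"
  proof (rule bdd_belowI2[of _ "- (real (length w) * B)"])
    fix y assume "y \<in> {x \<in> coded_shift G. slice x 0 (length w) = w}"
    then show "- (real (length w) * B) \<le> birkhoff \<phi> (length w) y"
      using birkhoff_shift_invariant_bound[where \<phi> = \<phi> and B = B and G = G and x = y and n = "length w"] assms(1)
      by (auto simp: abs_le_iff)
  qed
qed (use x in auto)

text \<open>Two points in the cylinder of \<open>w\<close> have shifts that agree up to radius r at
  all but at most 2 r boundary positions. The inner positions cost \<epsilon> / 2 each, the boundary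
  positions 2 B each, and the latter are negligible for long words.\<close>

lemma birkhoff_le_word_weight:
  fixes \<phi> :: "(int \<Rightarrow> 'a::{finite,discrete_topology}) \<Rightarrow> real"
  assumes cont: "continuous_on (coded_shift G) \<phi>" and e: "0 < \<epsilon>"
  obtains N where "0 < N" "\<And>w x. N \<le> length w \<Longrightarrow> x \<in> coded_shift G \<Longrightarrow> slice x 0 (length w) = w \<Longrightarrow>
     birkhoff \<phi> (length w) x \<le> word_weight \<phi> (coded_shift G) w + \<epsilon> * real (length w)"
proof -
  obtain B where B: "0 \<le> B" "\<And>x. x \<in> coded_shift G \<Longrightarrow> \<bar>\<phi> x\<bar> \<le> B"
    using continuous_coded_shift_bounded[OF cont] by blast
  have "0 < \<epsilon> / 2" using e by simp
  from continuous_uniform_agree[OF compact_coded_shift cont this]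
  obtain r where r: "\<And>x y. x \<in> coded_shift G \<Longrightarrow> y \<in> coded_shift G \<Longrightarrow> agree r x y \<Longrightarrow> \<bar>\<phi> x - \<phi> y\<bar> \<le> \<epsilon> / 2" by blast
  \<comment> \<open>Solves 4 r B \<le> (\<epsilon> / 2) l for l: 2 r boundary positions at a cost of
    2 B.\<close>
  obtain N0 where N0: "real N0 \<ge> 8 * real r * B / \<epsilon>" using real_arch_simple by blast
  define N where "N = Suc N0"
  have N: "4 * real r * B \<le> \<epsilon> / 2 * real l" if "N \<le> l" for l
  proof -
    have "8 * real r * B / \<epsilon> \<le> real l" using N0 that unfolding N_def by linarith
    then show ?thesis using e by (simp add: field_simps)
  qed
  have main: "birkhoff \<phi> l x \<le> birkhoff \<phi> l y + \<epsilon> * real l"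
    if l: "N \<le> l" and xy: "x \<in> coded_shift G" "y \<in> coded_shift G" "slice x 0 l = slice y 0 l" for x y l
  proof -
    have eq: "x (int i) = y (int i)" if "i < l" for i
      using arg_cong[OF xy(3), of "\<lambda>s. s ! i"] that by simp
    let ?A = "{i \<in> {..<l}. i < r \<or> l \<le> i + r}"
    have "\<phi> (shift_by (int i) x) - \<phi> (shift_by (int i) y) \<le> \<epsilon> / 2 + (if i \<in> ?A then 2 * B else 0)" if i: "i < l" for i
    proof (cases "i \<in> ?A")
      case True
      have "\<bar>\<phi> (shift_by (int i) x)\<bar> \<le> B" "\<bar>\<phi> (shift_by (int i) y)\<bar> \<le> B"
        using B(2) coded_shift_shift xy by blast+
      then have "\<phi> (shift_by (int i) x) - \<phi> (shift_by (int i) y) \<le> 2 * B" by linarith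
      then show ?thesis using True e by simp
    next
      case False
      then have "agree r (shift_by (int i) x) (shift_by (int i) y)"
        unfolding agree_def shift_by_def
      proof (intro allI impI)
        fix j assume "\<bar>j\<bar> \<le> int r"
        then have "0 \<le> j + int i" "j + int i < int l" using False i by auto
        then show "x (j + int i) = y (j + int i)" using eq[of "nat (j + int i)"] by simp
      qed
      then have "\<bar>\<phi> (shift_by (int i) x) - \<phi> (shift_by (int i) y)\<bar> \<le> \<epsilon> / 2"
        using r coded_shift_shift xy by blast
      then have "\<phi> (shift_by (int i) x) - \<phi> (shift_by (int i) y) \<le> \<epsilon> / 2" by linarith
      then show ?thesis using False by auto
    qed
    then have "birkhoff \<phi> l x - birkhoff \<phi> l y \<le> (\<Sum>i<l. \<epsilon> / 2 + (if i \<in> ?A then 2 * B else 0))"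
      unfolding birkhoff_def sum_subtractf[symmetric] by (intro sum_mono) auto
    also have "\<dots> = \<epsilon> / 2 * real l + real (card ?A) * (2 * B)"
    proof -
      have "(\<Sum>i<l. if i \<in> ?A then 2 * B else 0) = (\<Sum>i\<in>?A. 2 * B)"
        by (rule sum.mono_neutral_cong_right) auto
      then show ?thesis by (simp add: sum.distrib)
    qed
    also have "\<dots> \<le> \<epsilon> / 2 * real l + (2 * real r) * (2 * B)"
    proof -
      have "?A \<subseteq> {..<r} \<union> {l - r..<l}" by auto
      then have "card ?A \<le> card ({..<r} \<union> {l - r..<l})" by (intro card_mono) auto
      also have "\<dots> \<le> card {..<r} + card {l - r..<l}" by (rule card_Un_le)
      also have "\<dots> \<le> 2 * r" by simp
      finally have "real (card ?A) \<le> 2 * real r" by linarith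
      then show ?thesis using B by (intro add_left_mono mult_right_mono) auto
    qed
    also have "\<dots> \<le> \<epsilon> * real l" using N[OF l] by (simp add: algebra_simps)
    finally show ?thesis by simp
  qed
  show ?thesis
  proof (rule that[of N])
    show "0 < N" by (simp add: N_def)
    fix w x assume w: "N \<le> length w" "x \<in> coded_shift G" "slice x 0 (length w) = w"
    have "birkhoff \<phi> (length w) x - \<epsilon> * real (length w) \<le> word_weight \<phi> (coded_shift G) w"
      unfolding word_weight_def
    proof (rule cINF_greatest)
      show "{x \<in> coded_shift G. slice x 0 (length w) = w} \<noteq> {}" using w by blast
      fix y assume "y \<in> {x \<in> coded_shift G. slice x 0 (length w) = w}"
      then show "birkhoff \<phi> (length w) x - \<epsilon> * real (length w) \<le> birkhoff \<phi> (length w) y"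
        using main[OF w(1,2), of y] w(3) by simp
    qed
    then show "birkhoff \<phi> (length w) x \<le> word_weight \<phi> (coded_shift G) w + \<epsilon> * real (length w)" by simp
  qed
qed

text \<open>The sum over all factorizations of \<open>u\<close> into nonempty words of the product
  of the weights \<open>q\<close>. For a probability \<open>q\<close> this is a renewal weight: the
  chance that an independent concatenation starts with \<open>u\<close> and has a word boundary
  right after it.\<close>

function parse_weight :: "('a list \<Rightarrow> real) \<Rightarrow> 'a list \<Rightarrow> real" where
  "parse_weight q u = (if u = [] then 1
     else (\<Sum>j\<in>{1..length u}. q (take j u) * parse_weight q (drop j u)))"
  by pat_completeness auto
termination by (relation "Wellfounded.measure (length \<circ> snd)") auto

declare parse_weight.simps [simp del]

lemma parse_weight_Nil [simp]: "parse_weight q [] = 1"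
  by (simp add: parse_weight.simps)

lemma parse_weight_nonneg:
  assumes "\<And>w. 0 \<le> q w"
  shows "0 \<le> parse_weight q u"
proof (induction "length u" arbitrary: u rule: less_induct)
  case less
  then show ?case using assms by (subst parse_weight.simps) (auto intro!: sum_nonneg mult_nonneg_nonneg)
qed

lemma parse_weight_append:
  assumes "\<And>w. 0 \<le> q w" "w \<noteq> []"
  shows "q w * parse_weight q v \<le> parse_weight q (w @ v)"
proof -
  have "q (take (length w) (w @ v)) * parse_weight q (drop (length w) (w @ v))
     \<le> (\<Sum>j\<in>{1..length (w @ v)}. q (take j (w @ v)) * parse_weight q (drop j (w @ v)))"
    using assms parse_weight_nonneg[of q] by (intro member_le_sum) (auto simp: Suc_le_eq)
  then show ?thesis using assms(2) by (subst parse_weight.simps) simp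
qed

text \<open>The given factorization is one of the nonnegative terms of the sum.\<close>

lemma parse_weight_concat:
  assumes "\<And>w. 0 \<le> q w" "[] \<notin> set ws"
  shows "prod_list (map q ws) \<le> parse_weight q (concat ws)"
  using assms(2)
proof (induction ws)
  case (Cons w ws)
  then have "q w * prod_list (map q ws) \<le> q w * parse_weight q (concat ws)"
    using assms(1) by (intro mult_left_mono) auto
  also have "\<dots> \<le> parse_weight q (w @ concat ws)" using Cons.prems assms(1) by (intro parse_weight_append) auto
  finally show ?case by simp
qed simp

text \<open>The chance that a renewal takes place at time n. Conditioning on the first word of
  length j, the rest contributes at most 1 by induction, which leaves the total mass of
  \<open>q\<close> on lengths up to n.\<close>

lemma sum_parse_weight_le_1:
  fixes q :: "'a::finite list \<Rightarrow> real"
  assumes q: "\<And>w. 0 \<le> q w" and le: "\<And>n. (\<Sum>w\<in>{w. w \<noteq> [] \<and> length w \<le> n}. q w) \<le> 1"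
  shows "(\<Sum>u\<in>{u. length u = n}. parse_weight q u) \<le> 1"
proof (induction n rule: less_induct)
  case (less n)
  let ?W = "\<lambda>n. {u :: 'a list. length u = n}"
  note fin = words_of_length_finite
  show ?case
  proof (cases "n = 0")
    case True
    then show ?thesis by simp
  next
    case False
    have "(\<Sum>u\<in>?W n. parse_weight q u) = (\<Sum>u\<in>?W n. \<Sum>j\<in>{1..n}. q (take j u) * parse_weight q (drop j u))"
      using False by (intro sum.cong refl, subst parse_weight.simps) auto
    also have "\<dots> = (\<Sum>j\<in>{1..n}. \<Sum>u\<in>?W n. q (take j u) * parse_weight q (drop j u))" by (rule sum.swap)
    also have "\<dots> \<le> (\<Sum>j\<in>{1..n}. \<Sum>w\<in>?W j. q w)"
    proof (rule sum_mono)
      fix j assume j: "j \<in> {1..n}"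
      have "(\<Sum>u\<in>?W n. q (take j u) * parse_weight q (drop j u))
          = (\<Sum>z\<in>?W j \<times> ?W (n - j). q (fst z) * parse_weight q (snd z))"
        by (rule sum.reindex_bij_witness[of _ "\<lambda>z. fst z @ snd z" "\<lambda>u. (take j u, drop j u)"]) (use j in auto)
      also have "\<dots> = (\<Sum>w\<in>?W j. \<Sum>v\<in>?W (n - j). q w * parse_weight q v)"
        by (simp add: sum.cartesian_product case_prod_beta)
      also have "\<dots> = (\<Sum>w\<in>?W j. q w * (\<Sum>v\<in>?W (n - j). parse_weight q v))" by (simp add: sum_distrib_left)
      also have "\<dots> \<le> (\<Sum>w\<in>?W j. q w * 1)" using less[of "n - j"] j q by (intro sum_mono mult_left_mono) auto
      finally show "(\<Sum>u\<in>?W n. q (take j u) * parse_weight q (drop j u)) \<le> (\<Sum>w\<in>?W j. q w)" by simp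
    qed
    also have "\<dots> = (\<Sum>w\<in>(\<Union>j\<in>{1..n}. ?W j). q w)"
      using fin by (intro sum.UNION_disjoint[symmetric]) auto
    also have "(\<Union>j\<in>{1..n}. ?W j) = {w. w \<noteq> [] \<and> length w \<le> n}" by (auto simp: Suc_le_eq)
    finally show ?thesis using le[of n] by simp
  qed
qed

lemma word_start_cut:
  assumes "[] \<notin> G" "range g \<subseteq> G"
  shows "shift_by (word_start g j) (biconcat g) \<in> cut_set G"
proof -
  have "[] \<notin> range g" using assms by blast
  then have "shift_by (word_start g j) (biconcat g) = biconcat (\<lambda>i. g (i + j))" by (rule biconcat_shift[symmetric])
  then show ?thesis unfolding cut_set_def using assms(2) by (intro image_eqI[of _ _ "\<lambda>i. g (i + j)"]) auto
qed

lemma con_set_cuts_unbounded: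
  assumes "[] \<notin> G" "x \<in> con_set G"
  shows "\<exists>a :: nat. shift_by (int a) x \<in> cut_set G" "\<exists>a :: nat. shift_by (- int a) x \<in> cut_set G"
proof -
  obtain k g where g: "range g \<subseteq> G" "shift_by k x = biconcat g"
    using assms(2) unfolding con_set_eq' cut_set_def by auto
  have ne: "[] \<notin> range g" using g assms(1) by blast
  have c: "shift_by (word_start g j + k) x \<in> cut_set G" for j
    using word_start_cut[OF assms(1) g(1), of j] unfolding g(2)[symmetric] by simp
  \<comment> \<open>Index \<bar>k\<bar> is far enough to compensate the offset k, since
    \<open>word_start\<close> grows at least by one per word.\<close>
  have "\<bar>k\<bar> \<le> word_start g \<bar>k\<bar>" using word_start_diff[OF ne, of 0 "\<bar>k\<bar>"] by simp
  then have "word_start g \<bar>k\<bar> + k = int (nat (word_start g \<bar>k\<bar> + k))" by simp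
  then show "\<exists>a :: nat. shift_by (int a) x \<in> cut_set G" using c[of "\<bar>k\<bar>"] by metis
  have "word_start g (- \<bar>k\<bar>) \<le> - \<bar>k\<bar>" using word_start_diff[OF ne, of "- \<bar>k\<bar>" 0] by simp
  then have "word_start g (- \<bar>k\<bar>) + k = - int (nat (- (word_start g (- \<bar>k\<bar>) + k)))" by simp
  then show "\<exists>a :: nat. shift_by (- int a) x \<in> cut_set G" using c[of "- \<bar>k\<bar>"] by metis
qed

lemma continuous_measurable_invariant:
  fixes \<phi> :: "(int \<Rightarrow> 'a::topological_space) \<Rightarrow> real"
  assumes "\<mu> \<in> invariant_measures Z" "continuous_on Z \<phi>"
  shows "\<phi> \<in> borel_measurable \<mu>"
proof -
  have s: "sets \<mu> = sets (restrict_space borel Z)" using assms(1) by (simp add: invariant_measures_def)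
  show ?thesis unfolding measurable_cong_sets[OF s refl]
    by (rule borel_measurable_continuous_on_restrict[OF assms(2)])
qed

lemma space_invariant_measures:
  assumes "\<mu> \<in> invariant_measures Z"
  shows "space \<mu> = Z"
proof -
  have s: "sets \<mu> = sets (restrict_space borel Z)" using assms by (simp add: invariant_measures_def)
  show ?thesis using sets_eq_imp_space_eq[OF s] by (simp add: space_restrict_space)
qed

lemma sets_invariant_measures:
  assumes "\<mu> \<in> invariant_measures Z" "A \<in> sets borel"
  shows "A \<inter> Z \<in> sets \<mu>"
  using assms unfolding invariant_measures_def by (auto simp: sets_restrict_space)

text \<open>Instance of \<open>ks_entropy_le\<close> with the renewal weights of blocks and single
  letters. With high probability there is a cut soon after coordinate 0 and another shortly before
  n. Between them the window is a concatenation of blocks and a short rest; everything else is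
  spelled letter by letter at a cost of \<open>\<Lambda>\<close> per letter.\<close>

lemma ks_entropy_le_of_block_weights:
  fixes G :: "'a::{finite,discrete_topology} list set"
  assumes u: "uniquely_represents G" "[] \<notin> G"
    and mu: "\<mu> \<in> invariant_measures (coded_shift G)" and full: "emeasure \<mu> (con_set G) = 1"
    and cont: "continuous_on (coded_shift G) \<phi>" and e: "0 < \<epsilon>" and N: "0 < N"
    and psi: "\<And>w x. w \<in> block_words G N \<Longrightarrow> x \<in> coded_shift G \<Longrightarrow> slice x 0 (length w) = w \<Longrightarrow>
       birkhoff \<phi> (length w) x \<le> \<psi> w + \<epsilon> * real (length w)"
    and sum: "\<And>V. finite V \<Longrightarrow> V \<subseteq> block_words G N \<Longrightarrow> (\<Sum>w\<in>V. exp (\<psi> w - c * real (length w))) \<le> 1"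
  shows "ks_entropy \<mu> left_shift \<le> ereal (c + \<epsilon> - (\<integral>x. \<phi> x \<partial>\<mu>))"
proof (rule ereal_le_epsilon2)
  fix e' :: real assume e': "0 < e'"
  \<comment> \<open>One \<eta> pays for the mass given to fillers, the other for windows without a
    cut near one of their ends.\<close>
  define \<eta> where "\<eta> = e' / 2"
  have \<eta>: "0 < \<eta>" using e' by (simp add: \<eta>_def)
  interpret measure_preserving \<mu> left_shift using invariant_measure_preserving[OF mu] .
  let ?X = "coded_shift G"
  have space_mu: "space \<mu> = ?X" by (rule space_invariant_measures[OF mu])
  obtain B where B: "0 \<le> B" "\<And>x. x \<in> ?X \<Longrightarrow> \<bar>\<phi> x\<bar> \<le> B"
    using continuous_coded_shift_bounded[OF cont] by blast
  have bB: "\<bar>birkhoff \<phi> n x\<bar> \<le> real n * B" if "x \<in> ?X" for n x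
    using birkhoff_shift_invariant_bound[of G \<phi> B x n] B(2) that by blast
  \<comment> \<open>Then 1 - \<gamma> = exp (- \<eta>), so reserving mass \<gamma> for fillers costs
    \<eta> per block. As a block has at least one letter, the \<eta> per letter in \<open>b\<close>
    absorbs this.\<close>
  define \<gamma> where "\<gamma> = 1 - exp (- \<eta>)"
  have \<gamma>: "0 < \<gamma>" "\<gamma> < 1" using \<eta> by (auto simp: \<gamma>_def)
  define a0 where "a0 = real (CARD('a))"
  have a0: "1 \<le> a0" unfolding a0_def by (simp add: Suc_le_eq)
  \<comment> \<open>The filler mass is shared equally by the letters of the alphabet.\<close>
  define g0 where "g0 = \<gamma> / a0"
  have g0: "0 < g0" "g0 \<le> 1" using \<gamma> a0 by (auto simp: g0_def field_simps)
  define V where "V = block_words G N"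
  define q where "q = (\<lambda>w :: 'a list. (if w \<in> V then (1 - \<gamma>) * exp (\<psi> w - c * real (length w)) else 0)
     + (if length w = 1 then g0 else 0))"
  have q0: "0 \<le> q w" for w using \<gamma> g0 by (simp add: q_def)
  have qsum: "(\<Sum>w\<in>{w. w \<noteq> [] \<and> length w \<le> n}. q w) \<le> 1" for n
  proof -
    let ?L = "{w :: 'a list. w \<noteq> [] \<and> length w \<le> n}"
    have "finite {w :: 'a list. set w \<subseteq> UNIV \<and> length w \<le> n}" by (rule finite_lists_length_le) simp
    then have fL: "finite ?L" by (rule finite_subset[rotated]) auto
    have "(\<Sum>w\<in>?L. if w \<in> V then (1 - \<gamma>) * exp (\<psi> w - c * real (length w)) else 0)
        = (\<Sum>w\<in>?L \<inter> V. (1 - \<gamma>) * exp (\<psi> w - c * real (length w)))"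
      using fL by (simp add: sum.inter_restrict)
    also have "\<dots> = (1 - \<gamma>) * (\<Sum>w\<in>?L \<inter> V. exp (\<psi> w - c * real (length w)))" by (simp add: sum_distrib_left)
    also have "\<dots> \<le> (1 - \<gamma>) * 1" using \<gamma> fL by (intro mult_left_mono sum) (auto simp: V_def)
    finally have 1: "(\<Sum>w\<in>?L. if w \<in> V then (1 - \<gamma>) * exp (\<psi> w - c * real (length w)) else 0) \<le> 1 - \<gamma>" by simp
    have "(\<Sum>w\<in>?L. if length w = 1 then g0 else 0) = (\<Sum>w\<in>?L \<inter> {w. length w = 1}. g0)"
      unfolding sum.inter_restrict[OF fL] by simp
    also have "\<dots> \<le> (\<Sum>w\<in>{w :: 'a list. length w = 1}. g0)"
      using g0 words_of_length_finite[where 'a = 'a, of 1] by (intro sum_mono2) auto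
    also have "\<dots> = \<gamma>"
      using card_lists_length_eq[of "UNIV :: 'a set" 1] a0 by (simp add: g0_def a0_def)
    finally show ?thesis using 1 unfolding q_def sum.distrib by simp
  qed
  define Q where "Q = parse_weight q"
  define b where "b = c + \<epsilon> + \<eta>"
  have blocks: "exp (birkhoff \<phi> (length (concat bs)) x - b * real (length (concat bs))) \<le> prod_list (map q bs)"
    if "set bs \<subseteq> V" "x \<in> ?X" "slice x 0 (length (concat bs)) = concat bs" for bs x
    using that
  proof (induction bs arbitrary: x)
    case (Cons w bs)
    let ?l = "length (concat bs)" and ?y = "shift_by (int (length w)) x"
    have w: "w \<in> V" and bs: "set bs \<subseteq> V" using Cons.prems by auto
    have sp: "slice x 0 (length w) @ slice x (int (length w)) ?l = w @ concat bs"
      using Cons.prems(3) slice_append[of x 0 "length w" ?l] by simp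
    then have s1: "slice x 0 (length w) = w" and s2: "slice ?y 0 ?l = concat bs" by (auto simp: slice_shift)
    have y: "?y \<in> ?X" using Cons.prems(2) by (rule coded_shift_shift)
    have lw: "1 \<le> length w" using length_block_words[of w G N] w N by (simp add: V_def)
    have "birkhoff \<phi> (length w) x - b * real (length w) \<le> - \<eta> + (\<psi> w - c * real (length w))"
    proof -
      have "\<eta> * 1 \<le> \<eta> * real (length w)" using \<eta> lw by (intro mult_left_mono) auto
      then show ?thesis using psi[of w x] w Cons.prems(2) s1 unfolding V_def b_def by (simp add: algebra_simps)
    qed
    then have "exp (birkhoff \<phi> (length w) x - b * real (length w)) \<le> (1 - \<gamma>) * exp (\<psi> w - c * real (length w))"
      unfolding \<gamma>_def by (simp add: exp_add[symmetric])
    also have "\<dots> \<le> q w" using w g0 by (simp add: q_def)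
    finally have 1: "exp (birkhoff \<phi> (length w) x - b * real (length w)) \<le> q w" .
    have 2: "exp (birkhoff \<phi> ?l ?y - b * real ?l) \<le> prod_list (map q bs)" by (rule Cons.IH[OF bs y s2])
    have "exp (birkhoff \<phi> (length (concat (w # bs))) x - b * real (length (concat (w # bs))))
       = exp (birkhoff \<phi> (length w) x - b * real (length w)) * exp (birkhoff \<phi> ?l ?y - b * real ?l)"
      by (simp add: exp_add[symmetric] birkhoff_add algebra_simps)
    also have "\<dots> \<le> q w * prod_list (map q bs)" using 1 2 q0 by (intro mult_mono) auto
    finally show ?case by simp
  qed (simp add: birkhoff_def)
  \<comment> \<open>Cost of one letter outside the blocks: its possible contribution to the Birkhoff
    sum, the term \<open>b\<close> that it would have earned in a block, and the price of a
    filler.\<close>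
  define \<Lambda> where "\<Lambda> = B + \<bar>b\<bar> - ln g0"
  have "ln g0 \<le> 0" using g0 by simp
  then have \<Lambda>: "0 \<le> \<Lambda>" unfolding \<Lambda>_def using B(1) by linarith
  have parse: "exp (birkhoff \<phi> n x - b * real n - \<Lambda> * real (m1 + m2)) \<le> Q (slice x 0 n)"
    if x: "x \<in> ?X" and bs: "bs \<in> lists V" and s: "slice x 0 n = u1 @ concat bs @ u2"
      and m: "length u1 = m1" "length u2 = m2" for x n bs u1 u2 m1 m2
  proof -
    let ?sing = "map (\<lambda>a :: 'a. [a])" and ?l = "length (concat bs)"
    have bs': "set bs \<subseteq> V" using bs by auto
    have cs: "concat (?sing v) = v" for v by (induction v) auto
    have n: "n = m1 + ?l + m2" using arg_cong[OF s, of length] m by simp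
    have "slice x 0 n = slice x 0 m1 @ slice x (int m1) ?l @ slice x (int (m1 + ?l)) m2"
      unfolding n using slice_append[of x 0 m1 "?l + m2"] slice_append[of x "int m1" ?l m2] by (simp add: add.assoc)
    then have "slice x (int m1) ?l = concat bs" using s m by (simp add: append_eq_append_conv)
    then have sl: "slice (shift_by (int m1) x) 0 ?l = concat bs" by (simp add: slice_shift)
    have sing: "prod_list (map q (?sing v)) \<ge> g0 ^ length v" for v
    proof (induction v)
      case (Cons a v)
      have "g0 \<le> q [a]" using \<gamma> by (simp add: q_def)
      then show ?case using Cons g0 q0[of "[a]"] by (auto intro!: mult_mono)
    qed simp
    have "b * real ?l \<le> b * real n + \<bar>b\<bar> * real (m1 + m2)"
    proof -
      have "- b * real (m1 + m2) \<le> \<bar>b\<bar> * real (m1 + m2)" by (intro mult_right_mono) auto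
      then show ?thesis unfolding n by (simp add: algebra_simps)
    qed
    moreover have "birkhoff \<phi> n x \<le> birkhoff \<phi> ?l (shift_by (int m1) x) + B * real (m1 + m2)"
    proof -
      have "birkhoff \<phi> n x = birkhoff \<phi> m1 x + birkhoff \<phi> ?l (shift_by (int m1) x) + birkhoff \<phi> m2 (shift_by (int (m1 + ?l)) x)"
        unfolding n birkhoff_add ..
      moreover have "\<bar>birkhoff \<phi> m1 x\<bar> \<le> real m1 * B" by (rule bB[OF x])
      moreover have "\<bar>birkhoff \<phi> m2 (shift_by (int (m1 + ?l)) x)\<bar> \<le> real m2 * B" by (rule bB[OF coded_shift_shift[OF x]])
      ultimately show ?thesis by (simp add: algebra_simps abs_le_iff)
    qed
    ultimately have "birkhoff \<phi> n x - b * real n - \<Lambda> * real (m1 + m2)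
        \<le> (birkhoff \<phi> ?l (shift_by (int m1) x) - b * real ?l) + ln g0 * real (m1 + m2)"
      unfolding \<Lambda>_def by (simp add: algebra_simps)
    then have "exp (birkhoff \<phi> n x - b * real n - \<Lambda> * real (m1 + m2))
        \<le> exp (birkhoff \<phi> ?l (shift_by (int m1) x) - b * real ?l) * exp (ln g0 * real (m1 + m2))"
      by (simp add: exp_add[symmetric])
    also have "exp (ln g0 * real (m1 + m2)) = g0 ^ (m1 + m2)"
      using g0 by (simp add: powr_realpow[symmetric] powr_def mult.commute)
    also have "exp (birkhoff \<phi> ?l (shift_by (int m1) x) - b * real ?l) * g0 ^ (m1 + m2)
        = g0 ^ length u1 * (exp (birkhoff \<phi> ?l (shift_by (int m1) x) - b * real ?l) * g0 ^ length u2)"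
      using m by (simp add: power_add)
    also have "\<dots> \<le> prod_list (map q (?sing u1)) * (prod_list (map q bs) * prod_list (map q (?sing u2)))"
      using sing blocks[OF bs' coded_shift_shift[OF x] sl] g0 q0
      by (intro mult_mono) (auto intro!: mult_nonneg_nonneg prod_list_nonneg)
    also have "\<dots> = prod_list (map q (?sing u1 @ bs @ ?sing u2))" by simp
    also have "\<dots> \<le> parse_weight q (concat (?sing u1 @ bs @ ?sing u2))"
    proof (rule parse_weight_concat[OF q0])
      show "[] \<notin> set (?sing u1 @ bs @ ?sing u2)"
        using bs Nil_notin_block_words[OF N, of G] by (auto simp: V_def)
    qed
    also have "concat (?sing u1 @ bs @ ?sing u2) = slice x 0 n" using s cs by simp
    finally show ?thesis unfolding Q_def .
  qed
  \<comment> \<open>\<open>Gd J\<close> asks for a cut at distance at most \<open>J\<close> to the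
    right of the origin, \<open>Hd J\<close> for one to the left; coordinate 0 counts for both. On
    \<open>con_set G\<close> each holds for some \<open>J\<close>.\<close>
  define Gd where "Gd = (\<lambda>J :: nat. {x. \<exists>a\<in>{..J}. shift_by (int a) x \<in> cut_set G})"
  define Hd where "Hd = (\<lambda>J :: nat. {x. \<exists>a\<in>{..J}. shift_by (- int a) x \<in> cut_set G})"
  have cutm: "{x. shift_by k x \<in> cut_set G} \<in> sets borel" for k
    using measurable_sets[OF shift_measurable[of k] borel_cut_set[OF u]] by (simp add: vimage_def)
  have Gm: "Gd J \<in> sets borel" "Hd J \<in> sets borel" for J
  proof -
    have "Gd J = (\<Union>a\<in>{..J}. {x. shift_by (int a) x \<in> cut_set G})" "Hd J = (\<Union>a\<in>{..J}. {x. shift_by (- int a) x \<in> cut_set G})"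
      unfolding Gd_def Hd_def by auto
    then show "Gd J \<in> sets borel" "Hd J \<in> sets borel" using cutm by auto
  qed
  have p1: "prob (con_set G) = 1" using full by (simp add: measure_def)
  have lim: "(\<lambda>J. prob (F J \<inter> ?X)) \<longlonglongrightarrow> 1"
    if F: "\<And>J. F J \<in> sets borel" "incseq F" "con_set G \<subseteq> (\<Union>J. F J)" for F
  proof -
    have Fm: "F J \<inter> ?X \<in> sets \<mu>" for J by (rule sets_invariant_measures[OF mu F(1)])
    have "incseq (\<lambda>J. F J \<inter> ?X)" using F(2) unfolding incseq_def by blast
    then have "(\<lambda>J. prob (F J \<inter> ?X)) \<longlonglongrightarrow> prob (\<Union>J. F J \<inter> ?X)"
      using Fm by (intro finite_Lim_measure_incseq) auto
    moreover have "prob (\<Union>J. F J \<inter> ?X) = 1"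
    proof -
      have "con_set G \<subseteq> (\<Union>J. F J \<inter> ?X)" using F(3) con_set_subset_coded_shift[of G] by blast
      moreover have "(\<Union>J. F J \<inter> ?X) \<in> events" using Fm by (intro sets.countable_UN) auto
      ultimately have "prob (con_set G) \<le> prob (\<Union>J. F J \<inter> ?X)" by (rule finite_measure_mono)
      then have "1 \<le> prob (\<Union>J. F J \<inter> ?X)" using p1 by simp
      then show ?thesis using prob_le_1 by (intro antisym) auto
    qed
    ultimately show ?thesis by simp
  qed
  have limG: "(\<lambda>J. prob (Gd J \<inter> ?X)) \<longlonglongrightarrow> 1"
  proof (rule lim)
    show "Gd J \<in> sets borel" for J by (rule Gm(1))
    show "incseq Gd" by (rule incseq_SucI) (auto simp: Gd_def atMost_Suc)
    show "con_set G \<subseteq> (\<Union>J. Gd J)"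
    proof
      fix x assume "x \<in> con_set G"
      then obtain a :: nat where "shift_by (int a) x \<in> cut_set G" using con_set_cuts_unbounded(1)[OF u(2)] by blast
      then have "x \<in> Gd a" unfolding Gd_def by auto
      then show "x \<in> (\<Union>J. Gd J)" by blast
    qed
  qed
  have limH: "(\<lambda>J. prob (Hd J \<inter> ?X)) \<longlonglongrightarrow> 1"
  proof (rule lim)
    show "Hd J \<in> sets borel" for J by (rule Gm(2))
    show "incseq Hd" by (rule incseq_SucI) (auto simp: Hd_def atMost_Suc)
    show "con_set G \<subseteq> (\<Union>J. Hd J)"
    proof
      fix x assume "x \<in> con_set G"
      then obtain a :: nat where "shift_by (- int a) x \<in> cut_set G" using con_set_cuts_unbounded(2)[OF u(2)] by blast
      then have "x \<in> Hd a" unfolding Hd_def by auto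
      then show "x \<in> (\<Union>J. Hd J)" by blast
    qed
  qed
  \<comment> \<open>Two exceptional sets of measure at most \<delta> cost at most
    \<open>\<Lambda>\<close> per letter, together at most \<eta>.\<close>
  define \<delta> where "\<delta> = \<eta> / (2 * (\<Lambda> + 1))"
  have \<delta>: "0 < \<delta>" "2 * \<Lambda> * \<delta> \<le> \<eta>" using \<eta> \<Lambda> by (auto simp: \<delta>_def field_simps)
  have "eventually (\<lambda>J. prob (Gd J \<inter> ?X) > 1 - \<delta> \<and> prob (Hd J \<inter> ?X) > 1 - \<delta>) sequentially"
    using \<delta> by (intro eventually_conj order_tendstoD(1)[OF limG] order_tendstoD(1)[OF limH]) auto
  then obtain J where J: "prob (Gd J \<inter> ?X) > 1 - \<delta>" "prob (Hd J \<inter> ?X) > 1 - \<delta>"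
    by (auto simp: eventually_sequentially)
  define B1 where "B1 = ?X - Gd J"
  define B2 where "B2 = ?X - Hd J"
  have Bm: "B1 \<in> sets \<mu>" "B2 \<in> sets \<mu>"
  proof -
    have "B1 = space \<mu> - (Gd J \<inter> ?X)" "B2 = space \<mu> - (Hd J \<inter> ?X)" unfolding B1_def B2_def space_mu by auto
    then show "B1 \<in> sets \<mu>" "B2 \<in> sets \<mu>" using sets_invariant_measures[OF mu Gm(1)] sets_invariant_measures[OF mu Gm(2)] by auto
  qed
  have Bp: "prob B1 \<le> \<delta>" "prob B2 \<le> \<delta>"
  proof -
    have "B1 = space \<mu> - (Gd J \<inter> ?X)" "B2 = space \<mu> - (Hd J \<inter> ?X)" unfolding B1_def B2_def space_mu by auto
    then show "prob B1 \<le> \<delta>" "prob B2 \<le> \<delta>"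
      using prob_compl[OF sets_invariant_measures[OF mu Gm(1)], of J] prob_compl[OF sets_invariant_measures[OF mu Gm(2)], of J] J
      by auto
  qed
  \<comment> \<open>Filler letters of a typical window: at most \<open>J\<close> before the first
    cut, at most \<open>J\<close> after the last one, and fewer than \<open>N\<close> left over by
    the grouping into blocks.\<close>
  define K where "K = \<Lambda> * real (2 * J + N)"
  \<comment> \<open>The code length of a typical window; on the exceptional sets enough is added to
    spell all n letters as fillers.\<close>
  define D where "D = (\<lambda>n x. b * real n - birkhoff \<phi> n x + K
     + \<Lambda> * real n * (indicat_real B1 x + indicat_real B2 ((left_shift ^^ n) x)))"
  have \<phi>m: "\<phi> \<in> borel_measurable \<mu>" by (rule continuous_measurable_invariant[OF mu cont])
  have \<phi>i: "integrable \<mu> \<phi>"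
    by (rule integrable_const_bound[of _ B]) (use \<phi>m B(2) space_mu in auto)
  have \<phi>i': "integrable \<mu> (\<lambda>x. \<phi> (shift_by (int i) x))" "(\<integral>x. \<phi> (shift_by (int i) x) \<partial>\<mu>) = (\<integral>x. \<phi> x \<partial>\<mu>)" for i
    using integrable_funpow[OF \<phi>i, of i] integral_funpow[OF \<phi>m, of i] unfolding funpow_left_shift by auto
  have Si: "integrable \<mu> (birkhoff \<phi> n)" "(\<integral>x. birkhoff \<phi> n x \<partial>\<mu>) = real n * (\<integral>x. \<phi> x \<partial>\<mu>)" for n
    unfolding birkhoff_def using \<phi>i' by (auto simp: Bochner_Integration.integral_sum)
  have I1: "integrable \<mu> (indicat_real B1)" and I2: "integrable \<mu> (indicat_real B2)"
    using Bm by (auto simp: emeasure_eq_measure)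
  have I2': "integrable \<mu> (\<lambda>x. indicat_real B2 ((left_shift ^^ n) x))" for n by (rule integrable_funpow[OF I2])
  have E2: "(\<integral>x. indicat_real B2 ((left_shift ^^ n) x) \<partial>\<mu>) = prob B2" for n
    using integral_funpow[of "indicat_real B2" n] Bm by simp
  have "ks_entropy \<mu> left_shift \<le> ereal (b - (\<integral>x. \<phi> x \<partial>\<mu>) + \<eta>)"
  proof (rule ks_entropy_le[OF mu, where Q = Q and D = D and K = K])
    show "0 \<le> Q w" for w unfolding Q_def by (rule parse_weight_nonneg[OF q0])
    show "(\<Sum>u\<in>{u. length u = n}. Q u) \<le> 1" for n unfolding Q_def by (rule sum_parse_weight_le_1[OF q0 qsum])
    show "integrable \<mu> (D n)" for n
      unfolding D_def using Si(1) I1 I2'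
      by (intro Bochner_Integration.integrable_add Bochner_Integration.integrable_diff integrable_mult_right) auto
    show "(\<integral>x. D n x \<partial>\<mu>) \<le> real n * (b - (\<integral>x. \<phi> x \<partial>\<mu>) + \<eta>) + K" for n
    proof -
      have "(\<integral>x. D n x \<partial>\<mu>) = b * real n - real n * (\<integral>x. \<phi> x \<partial>\<mu>) + K + \<Lambda> * real n * (prob B1 + prob B2)"
        unfolding D_def using Si I1 I2' E2[of n] Bm by (simp add: prob_space)
      also have "\<Lambda> * real n * (prob B1 + prob B2) \<le> \<Lambda> * real n * (\<delta> + \<delta>)"
        using Bp \<Lambda> by (intro mult_left_mono add_mono) auto
      also have "\<dots> = real n * (2 * \<Lambda> * \<delta>)" by (simp add: algebra_simps)
      also have "\<dots> \<le> real n * \<eta>" using \<delta> by (intro mult_left_mono) auto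
      finally show ?thesis by (simp add: algebra_simps)
    qed
    show "AE x in \<mu>. exp (- D n x) \<le> Q (slice x 0 n)" for n
      using AE_space
    proof eventually_elim
      case (elim x)
      then have x: "x \<in> ?X" using space_mu by simp
      have nx: "(left_shift ^^ n) x = shift_by (int n) x" by (simp add: funpow_left_shift)
      show ?case
      \<comment> \<open>The condition 2 J \<le> n puts the cut near 0 at or before the cut near
        n.\<close>
      proof (cases "x \<in> Gd J \<and> shift_by (int n) x \<in> Hd J \<and> 2 * J \<le> n")
        case True
        then obtain a a' where a: "a \<le> J" "shift_by (int a) x \<in> cut_set G" "a' \<le> J" "shift_by (- int a') (shift_by (int n) x) \<in> cut_set G"
          unfolding Gd_def Hd_def by auto
        define d where "d = n - a'"
        have d: "a \<le> d" "d \<le> n" "shift_by (int d) x \<in> cut_set G" "n - d \<le> J"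
          using a True by (auto simp: d_def of_nat_diff)
        obtain ws where ws: "ws \<in> lists G" "slice x (int a) (nat (int d - int a)) = concat ws"
          using slice_between_cuts[OF u a(2) d(3)] d(1) by auto
        obtain bs rs where bs: "bs \<in> lists V" "concat ws = concat bs @ concat rs" "length (concat rs) < N"
          using exists_blocks[OF ws(1) N] unfolding V_def by auto
        have "slice x 0 n = slice x 0 a @ slice x (int a) (nat (int d - int a)) @ slice x (int d) (n - d)"
          using slice_append[of x 0 a "n - a"] slice_append[of x "int a" "d - a" "n - d"] d
          by (simp add: of_nat_diff nat_diff_distrib)
        then have "slice x 0 n = slice x 0 a @ concat bs @ (concat rs @ slice x (int d) (n - d))"
          using ws(2) bs(2) by simp
        from parse[OF x bs(1) this refl refl]
        have "exp (birkhoff \<phi> n x - b * real n - \<Lambda> * real (a + (length (concat rs) + (n - d)))) \<le> Q (slice x 0 n)" by simp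
        moreover have "- D n x \<le> birkhoff \<phi> n x - b * real n - \<Lambda> * real (a + (length (concat rs) + (n - d)))"
        proof -
          have "a + (length (concat rs) + (n - d)) \<le> 2 * J + N" using a d bs(3) by simp
          then have "\<Lambda> * real (a + (length (concat rs) + (n - d))) \<le> K"
            unfolding K_def using \<Lambda> by (intro mult_left_mono of_nat_mono) auto
          moreover have "0 \<le> \<Lambda> * real n * (indicat_real B1 x + indicat_real B2 ((left_shift ^^ n) x))"
            using \<Lambda> by simp
          ultimately show ?thesis unfolding D_def by linarith
        qed
        ultimately show ?thesis by (meson exp_le_cancel_iff order_trans)
      next
        case False
        \<comment> \<open>No blocks at all: the whole window is filler. For n below 2 J the constant
          \<open>K\<close> covers this.\<close>
        have "slice x 0 n = slice x 0 n @ concat [] @ []" by simp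
        from parse[OF x _ this refl refl] have "exp (birkhoff \<phi> n x - b * real n - \<Lambda> * real n) \<le> Q (slice x 0 n)" by simp
        moreover have "\<Lambda> * real n \<le> K + \<Lambda> * real n * (indicat_real B1 x + indicat_real B2 ((left_shift ^^ n) x))"
        proof (cases "2 * J \<le> n")
          case True
          then have "x \<in> B1 \<or> shift_by (int n) x \<in> B2"
            using False x coded_shift_shift[OF x] unfolding B1_def B2_def by auto
          then have "1 \<le> indicat_real B1 x + indicat_real B2 ((left_shift ^^ n) x)"
            unfolding nx by (auto simp: indicator_def)
          then have "\<Lambda> * real n * 1 \<le> \<Lambda> * real n * (indicat_real B1 x + indicat_real B2 ((left_shift ^^ n) x))"
            using \<Lambda> by (intro mult_left_mono) auto
          moreover have "0 \<le> K" using \<Lambda> by (simp add: K_def)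
          ultimately show ?thesis by simp
        next
          case False
          then have "\<Lambda> * real n \<le> K" unfolding K_def using \<Lambda> by (intro mult_left_mono of_nat_mono) auto
          moreover have "0 \<le> \<Lambda> * real n * (indicat_real B1 x + indicat_real B2 ((left_shift ^^ n) x))"
            using \<Lambda> by simp
          ultimately show ?thesis by linarith
        qed
        ultimately show ?thesis unfolding D_def
          by (smt (verit, best) exp_le_cancel_iff)
      qed
    qed
  qed
  also have "b - (\<integral>x. \<phi> x \<partial>\<mu>) + \<eta> = c + \<epsilon> - (\<integral>x. \<phi> x \<partial>\<mu>) + e'" by (simp add: b_def \<eta>_def)
  finally show "ks_entropy \<mu> left_shift \<le> ereal (c + \<epsilon> - (\<integral>x. \<phi> x \<partial>\<mu>)) + ereal e'" by simp
qed

section \<open>Bernoulli concatenation measures\<close>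

text \<open>Over a finite alphabet an open set is a countable union of cylinders, each an
  intersection of finitely many coordinate conditions.\<close>

lemma measurable_sequences:
  fixes f :: "'b \<Rightarrow> int \<Rightarrow> 'a::{finite,discrete_topology}"
  assumes "\<And>i a. {x \<in> space M. f x i = a} \<in> sets M"
  shows "f \<in> borel_measurable M"
proof (rule borel_measurableI)
  fix U :: "(int \<Rightarrow> 'a) set" assume U: "open U"
  let ?T = "\<lambda>r. {u :: 'a list. length u = 2 * r + 1 \<and> (\<forall>y. slice y (- int r) (2 * r + 1) = u \<longrightarrow> y \<in> U)}"
  let ?A = "\<lambda>r u. {x \<in> space M. \<forall>j\<in>{..<2 * r + 1}. f x (- int r + int j) = u ! j}"
  have eq: "slice y (- int r) (2 * r + 1) = u \<longleftrightarrow> (\<forall>j\<in>{..<2 * r + 1}. y (- int r + int j) = u ! j)"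
    if "length u = 2 * r + 1" for y r and u :: "'a list"
    unfolding list_eq_iff_nth_eq using that by auto
  have "f -` U \<inter> space M = (\<Union>r. \<Union>u\<in>?T r. ?A r u)"
  proof (intro equalityI subsetI)
    fix x assume x: "x \<in> f -` U \<inter> space M"
    then obtain r where r: "\<And>y. agree r (f x) y \<Longrightarrow> y \<in> U" using open_imp_agree[OF U, of "f x"] by auto
    let ?u = "slice (f x) (- int r) (2 * r + 1)"
    have "y \<in> U" if y: "slice y (- int r) (2 * r + 1) = ?u" for y
    proof (rule r)
      show "agree r (f x) y"
        unfolding agree_def
      proof (intro allI impI)
        fix i assume i: "\<bar>i\<bar> \<le> int r"
        then have "nat (i + int r) < 2 * r + 1" by auto
        moreover have "0 \<le> i + int r" using i by linarith
        ultimately show "f x i = y i" using arg_cong[OF y, of "\<lambda>u. u ! nat (i + int r)"] by simp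
      qed
    qed
    then have "?u \<in> ?T r" by simp
    moreover have "x \<in> ?A r ?u" using x by auto
    ultimately show "x \<in> (\<Union>r. \<Union>u\<in>?T r. ?A r u)" by blast
  next
    fix x assume "x \<in> (\<Union>r. \<Union>u\<in>?T r. ?A r u)"
    then obtain r u where "u \<in> ?T r" "x \<in> ?A r u" by blast
    then show "x \<in> f -` U \<inter> space M" using eq[of u r "f x"] by auto
  qed
  moreover have "?A r u \<in> sets M" for r u
    by (intro sets.sets_Collect_finite_All assms) auto
  moreover have "countable (?T r)" for r
    by (intro countable_finite finite_subset[OF _ words_of_length_finite[where n = "2 * r + 1"]]) auto
  ultimately show "f -` U \<inter> space M \<in> sets M" by (simp add: sets.countable_UN')
qed

text \<open>\<open>Z\<close> stands for the subshift on which the measure is to live; only its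
  stability under the shift and the presence of all concatenations are required.\<close>

locale bernoulli_blocks =
  fixes V :: "'a::{finite,discrete_topology} list set" and p :: "'a list \<Rightarrow> real" and Z :: "(int \<Rightarrow> 'a) set"
  assumes V: "finite V" "[] \<notin> V" and p: "\<And>w. w \<in> V \<Longrightarrow> 0 \<le> p w" "sum p V = 1"
    and Z: "\<And>g k. range g \<subseteq> V \<Longrightarrow> shift_by k (biconcat g) \<in> Z" "\<And>x. x \<in> Z \<Longrightarrow> shift_by 1 x \<in> Z"
begin

definition "W = point_measure V (\<lambda>w. ennreal (p w))"
definition "BP = PiM UNIV (\<lambda>_::int. W)"
definition "maxlen = Max (length ` V)"
definition "mean = (\<Sum>w\<in>V. p w * real (length w))"
text \<open>The part of level k of the tower that the projection to sequences maps into
  \<open>B\<close>.\<close>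

definition "base k B = {g \<in> space BP. k < length (g 0) \<and> shift_by (int k) (biconcat g) \<in> B}"
text \<open>Kakutani tower over the Bernoulli shift with roof function \<open>length (g 0)\<close>,
  projected to \<open>Z\<close>. Dividing by the mean roof height makes it a probability;
  randomizing the position of the origin within the word at index 0 makes it invariant under the
  shift by one letter.\<close>

definition "tower = measure_of Z (sets (restrict_space borel Z))
  (\<lambda>B. ennreal ((\<Sum>k<maxlen. measure BP (base k B)) / mean))"

lemma length_le_maxlen: "w \<in> V \<Longrightarrow> length w \<le> maxlen"
  unfolding maxlen_def using V by (intro Max_ge) auto

lemma length_pos: "w \<in> V \<Longrightarrow> 0 < length w"
  using V by auto

lemma prob_space_W: "prob_space W"
proof
  have "emeasure W (space W) = (\<Sum>w\<in>V. ennreal (p w))"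
    unfolding W_def space_point_measure by (intro emeasure_point_measure_finite V) simp
  also have "\<dots> = ennreal (sum p V)" using p by (intro sum_ennreal) auto
  finally show "emeasure W (space W) = 1" using p by simp
qed

lemma measure_W: "w \<in> V \<Longrightarrow> measure W {w} = p w"
  unfolding W_def measure_def using V p by (subst emeasure_point_measure_finite) auto

sublocale PP: product_prob_space "\<lambda>_::int. W" UNIV
  unfolding product_prob_space_def product_prob_space_axioms_def product_sigma_finite_def
  using prob_space_W prob_space_imp_sigma_finite by blast

sublocale BP: prob_space BP
  unfolding BP_def by (rule PP.P.prob_space_axioms)

lemma space_BP: "space BP = {g. range g \<subseteq> V}"
  unfolding BP_def space_PiM W_def space_point_measure by auto

lemma sets_coordinate: "{g \<in> space BP. g i = w} \<in> sets BP"
proof (cases "w \<in> V")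
  case True
  have "(\<lambda>g. g i) \<in> BP \<rightarrow>\<^sub>M W" unfolding BP_def by (rule measurable_component_singleton) simp
  from measurable_sets[OF this, of "{w}"] True have "(\<lambda>g. g i) -` {w} \<inter> space BP \<in> sets BP"
    by (simp add: W_def sets_point_measure)
  moreover have "(\<lambda>g. g i) -` {w} \<inter> space BP = {g \<in> space BP. g i = w}" by auto
  ultimately show ?thesis by simp
next
  case False
  then have e: "{g \<in> space BP. g i = w} = {}" unfolding space_BP by auto
  show ?thesis unfolding e by simp
qed

text \<open>There are finitely many patterns on \<open>J\<close> because \<open>V\<close> is finite,
  so the event is a finite union of cylinders.\<close>

lemma sets_finite_dependence:
  assumes J: "finite J" and h: "\<forall>g\<in>space BP. \<forall>g'\<in>space BP. (\<forall>i\<in>J. g i = g' i) \<longrightarrow> h g = h g'"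
  shows "{g \<in> space BP. h g} \<in> sets BP"
proof -
  let ?T = "(\<lambda>g. restrict g J) ` {g \<in> space BP. h g}"
  have "?T \<subseteq> Pi\<^sub>E J (\<lambda>_. V)" unfolding space_BP by auto
  then have fT: "finite ?T" by (rule finite_subset) (intro finite_PiE J V(1))
  have eq: "{g \<in> space BP. h g} = (\<Union>t\<in>?T. {g \<in> space BP. \<forall>i\<in>J. g i = t i})"
  proof (intro equalityI subsetI)
    fix g assume g: "g \<in> {g \<in> space BP. h g}"
    have "\<forall>i\<in>J. g i = restrict g J i" by simp
    with g show "g \<in> (\<Union>t\<in>?T. {g \<in> space BP. \<forall>i\<in>J. g i = t i})" by blast
  next
    fix g assume "g \<in> (\<Union>t\<in>?T. {g \<in> space BP. \<forall>i\<in>J. g i = t i})"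
    then obtain g' where g': "g' \<in> space BP" "h g'" "g \<in> space BP" "\<forall>i\<in>J. g i = g' i" by auto
    then show "g \<in> {g \<in> space BP. h g}" using h by blast
  qed
  have "{g \<in> space BP. \<forall>i\<in>J. g i = t i} \<in> sets BP" for t
    by (intro sets.sets_Collect_finite_All sets_coordinate J)
  then have "(\<Union>t\<in>?T. {g \<in> space BP. \<forall>i\<in>J. g i = t i}) \<in> sets BP" by (intro sets.finite_UN fT)
  then show ?thesis by (rule back_subst[OF _ eq[symmetric], of "\<lambda>A. A \<in> sets BP"])
qed

lemma biconcat_shift_measurable: "(\<lambda>g. shift_by k (biconcat g)) \<in> BP \<rightarrow>\<^sub>M borel"
proof (rule measurable_sequences)
  fix i a
  let ?J = "{- (\<bar>i + k\<bar> + 1)..\<bar>i + k\<bar> + 1}"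
  have "\<forall>g\<in>space BP. \<forall>g'\<in>space BP. (\<forall>i\<in>?J. g i = g' i) \<longrightarrow> (shift_by k (biconcat g) i = a) = (shift_by k (biconcat g') i = a)"
  proof (intro ballI impI)
    fix g g' assume g: "g \<in> space BP" "g' \<in> space BP" "\<forall>j\<in>?J. g j = g' j"
    have "biconcat g (i + k) = biconcat g' (i + k)"
      by (rule biconcat_cong) (use g V in \<open>auto simp: space_BP abs_le_iff\<close>)
    then show "(shift_by k (biconcat g) i = a) = (shift_by k (biconcat g') i = a)" by (simp add: shift_by_def)
  qed
  from sets_finite_dependence[OF _ this] show "{g \<in> space BP. shift_by k (biconcat g) i = a} \<in> sets BP" by simp
qed

lemma sets_length: "{g \<in> space BP. Q (length (g 0))} \<in> sets BP"
proof -
  have eq: "{g \<in> space BP. Q (length (g 0))} = (\<Union>w\<in>{w \<in> V. Q (length w)}. {g \<in> space BP. g 0 = w})"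
    unfolding space_BP by auto
  show ?thesis unfolding eq using V(1) by (intro sets.finite_UN sets_coordinate) simp
qed

lemma biconcat_in_Z: "g \<in> space BP \<Longrightarrow> shift_by k (biconcat g) \<in> Z"
  using Z(1) unfolding space_BP by blast

lemma base_sets:
  assumes "B \<in> sets (restrict_space borel Z)"
  shows "base k B \<in> sets BP"
proof -
  obtain C where C: "C \<in> sets borel" "B = Z \<inter> C" using assms by (auto simp: sets_restrict_space)
  have "{g \<in> space BP. shift_by (int k) (biconcat g) \<in> C} \<in> sets BP"
    using measurable_sets[OF biconcat_shift_measurable C(1), of "int k"] by (simp add: vimage_def Int_def conj_commute)
  then have "{g \<in> space BP. k < length (g 0)} \<inter> {g \<in> space BP. shift_by (int k) (biconcat g) \<in> C} \<in> sets BP"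
    using sets_length[of "\<lambda>l. k < l"] by blast
  moreover have "base k B = {g \<in> space BP. k < length (g 0)} \<inter> {g \<in> space BP. shift_by (int k) (biconcat g) \<in> C}"
    unfolding base_def C(2) using biconcat_in_Z by auto
  ultimately show ?thesis by simp
qed

lemma measure_cylinder:
  assumes "finite J" "\<And>j. j \<in> J \<Longrightarrow> w j \<in> V"
  shows "measure BP {g \<in> space BP. \<forall>j\<in>J. g j = w j} = (\<Prod>j\<in>J. p (w j))"
proof -
  have eq: "{g \<in> space BP. \<forall>j\<in>J. g j = w j} = PP.emb UNIV J (Pi\<^sub>E J (\<lambda>j. {w j}))"
    unfolding BP_def prod_emb_def by (auto simp: space_PiM)
  have sW: "{w j} \<in> sets W" if "j \<in> J" for j using assms(2)[OF that] by (simp add: W_def sets_point_measure)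
  have "measure BP {g \<in> space BP. \<forall>j\<in>J. g j = w j} = (\<Prod>j\<in>J. measure W {w j})"
    unfolding eq unfolding BP_def by (rule PP.measure_PiM_emb[OF subset_UNIV assms(1) sW])
  also have "\<dots> = (\<Prod>j\<in>J. p (w j))" using assms measure_W by (intro prod.cong) auto
  finally show ?thesis .
qed

lemma measure_first_word: "w \<in> V \<Longrightarrow> measure BP {g \<in> space BP. g 0 = w} = p w"
  using measure_cylinder[of "{0}" "\<lambda>_. w"] by simp

lemma BP_shift_invariant:
  assumes "A \<in> sets BP"
  shows "measure BP {g \<in> space BP. (\<lambda>i. g (i + 1)) \<in> A} = measure BP A"
proof -
  have "distr BP BP (\<lambda>g i. g (i + 1)) = BP"
    using distr_PiM_reindex[of UNIV "\<lambda>_::int. W" "\<lambda>i. i + 1" UNIV] prob_space_W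
    unfolding BP_def by (simp add: inj_on_def restrict_def)
  moreover have "(\<lambda>g i. g (i + 1)) \<in> BP \<rightarrow>\<^sub>M BP"
    unfolding BP_def by (rule measurable_PiM_single') (auto simp: space_PiM)
  moreover have "(\<lambda>g i. g (i + 1)) -` A \<inter> space BP = {g \<in> space BP. (\<lambda>i. g (i + 1)) \<in> A}" by auto
  ultimately show ?thesis using measure_distr[of "\<lambda>g i. g (i + 1)" BP BP A] assms by simp
qed

lemma mean_ge_1: "1 \<le> mean"
proof -
  have "(\<Sum>w\<in>V. p w * 1) \<le> mean"
    unfolding mean_def using p(1) length_pos by (intro sum_mono mult_left_mono) (auto simp: Suc_le_eq)
  then show ?thesis using p(2) by simp
qed

text \<open>The mean as the sum of the tail probabilities; this is the total mass of the tower
  before normalization.\<close>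

lemma sum_measure_length_gt: "(\<Sum>k<maxlen. measure BP {g \<in> space BP. k < length (g 0)}) = mean"
proof -
  have "measure BP {g \<in> space BP. k < length (g 0)} = (\<Sum>w\<in>V. if k < length w then p w else 0)" for k
  proof -
    have "{g \<in> space BP. k < length (g 0)} = (\<Union>w\<in>{w \<in> V. k < length w}. {g \<in> space BP. g 0 = w})"
      unfolding space_BP by auto
    also have "measure BP \<dots> = (\<Sum>w\<in>{w \<in> V. k < length w}. measure BP {g \<in> space BP. g 0 = w})"
      by (rule BP.finite_measure_finite_Union)
         (use V sets_coordinate in \<open>auto simp: disjoint_family_on_def\<close>)
    also have "\<dots> = (\<Sum>w\<in>{w \<in> V. k < length w}. p w)" by (intro sum.cong measure_first_word) auto
    also have "\<dots> = (\<Sum>w\<in>V. if k < length w then p w else 0)" using V by (intro sum.mono_neutral_cong_left) auto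
    finally show ?thesis .
  qed
  then have "(\<Sum>k<maxlen. measure BP {g \<in> space BP. k < length (g 0)}) = (\<Sum>w\<in>V. \<Sum>k<maxlen. if k < length w then p w else 0)"
    by (simp only: sum.swap[of _ V])
  also have "\<dots> = (\<Sum>w\<in>V. p w * real (length w))"
  proof (rule sum.cong[OF refl])
    fix w assume "w \<in> V"
    then have "(\<Sum>k<maxlen. if k < length w then p w else 0) = (\<Sum>k<length w. p w)"
      using length_le_maxlen by (intro sum.mono_neutral_cong_right) (auto dest: less_le_trans)
    then show "(\<Sum>k<maxlen. if k < length w then p w else 0) = p w * real (length w)" by simp
  qed
  finally show ?thesis by (simp add: mean_def)
qed

lemma sets_tower: "sets tower = sets (restrict_space borel Z)"
proof -
  have "sigma_sets Z (sets (restrict_space borel Z)) = sets (restrict_space borel Z)"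
    using sets.sigma_sets_eq[of "restrict_space borel Z"] by (simp add: space_restrict_space)
  moreover have "sets (restrict_space borel Z) \<subseteq> Pow Z"
    using sets.space_closed[of "restrict_space borel Z"] by (simp add: space_restrict_space)
  ultimately show ?thesis unfolding tower_def by (simp add: sets_measure_of)
qed

lemma space_tower: "space tower = Z"
  using sets_eq_imp_space_eq[OF sets_tower] by (simp add: space_restrict_space)

lemma emeasure_tower:
  assumes B: "B \<in> sets tower"
  shows "emeasure tower B = ennreal ((\<Sum>k<maxlen. measure BP (base k B)) / mean)"
proof (rule emeasure_measure_of[OF tower_def])
  show "sets (restrict_space borel Z) \<subseteq> Pow Z"
    using sets.space_closed[of "restrict_space borel Z"] by (simp add: space_restrict_space)
  show "positive (sets tower) (\<lambda>B. ennreal ((\<Sum>k<maxlen. measure BP (base k B)) / mean))"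
    by (simp add: positive_def base_def)
  show "countably_additive (sets tower) (\<lambda>B. ennreal ((\<Sum>k<maxlen. measure BP (base k B)) / mean))"
  proof (rule countably_additiveI)
    fix A :: "nat \<Rightarrow> _" assume A: "range A \<subseteq> sets tower" "disjoint_family A"
    have "(\<lambda>i. measure BP (base k (A i))) sums measure BP (base k (\<Union>i. A i))" for k
    proof -
      have "base k (\<Union>i. A i) = (\<Union>i. base k (A i))" unfolding base_def by auto
      moreover have "(\<lambda>i. measure BP (base k (A i))) sums measure BP (\<Union>i. base k (A i))"
      proof (rule BP.finite_measure_UNION)
        show "range (\<lambda>i. base k (A i)) \<subseteq> sets BP" using A(1) base_sets unfolding sets_tower by blast
        show "disjoint_family (\<lambda>i. base k (A i))" using A(2) unfolding disjoint_family_on_def base_def by blast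
      qed
      ultimately show ?thesis by simp
    qed
    then have "(\<lambda>i. (\<Sum>k<maxlen. measure BP (base k (A i))) / mean) sums ((\<Sum>k<maxlen. measure BP (base k (\<Union>i. A i))) / mean)"
      by (intro sums_divide sums_sum)
    then show "(\<Sum>i. ennreal ((\<Sum>k<maxlen. measure BP (base k (A i))) / mean))
        = ennreal ((\<Sum>k<maxlen. measure BP (base k (\<Union>i. A i))) / mean)"
      using mean_ge_1 by (intro suminf_ennreal_eq) (auto intro!: divide_nonneg_nonneg sum_nonneg)
  qed
qed (rule B)

lemma measure_tower:
  assumes "B \<in> sets tower"
  shows "measure tower B = (\<Sum>k<maxlen. measure BP (base k B)) / mean"
  unfolding measure_def emeasure_tower[OF assms] using mean_ge_1
  by (intro enn2real_ennreal) (auto simp: measure_def[symmetric] intro!: divide_nonneg_nonneg sum_nonneg)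

lemma prob_space_tower: "prob_space tower"
proof
  have "base k Z = {g \<in> space BP. k < length (g 0)}" for k
    unfolding base_def using biconcat_in_Z by auto
  moreover have "Z \<in> sets tower" using sets.top[of tower] by (simp add: space_tower)
  ultimately show "emeasure tower (space tower) = 1"
    using mean_ge_1 sum_measure_length_gt by (simp add: space_tower emeasure_tower)
qed

lemma left_shift_tower: "left_shift \<in> tower \<rightarrow>\<^sub>M tower"
  unfolding measurable_cong_sets[OF sets_tower sets_tower] left_shift_eq_shift
  by (intro measurable_restrict_space3 shift_measurable) (use Z(2) in auto)

text \<open>The shift moves level k to level k + 1, except at the top of the first word, where it
  returns to level 0 of the next word. The returning parts add up to level 0 by invariance of the
  Bernoulli measure.\<close>

lemma measure_tower_shift:
  assumes B: "B \<in> sets tower"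
  shows "measure tower (left_shift -` B \<inter> space tower) = measure tower B"
proof -
  let ?m = "measure BP"
  define e where "e = (\<lambda>k. ?m (base k B))"
  \<comment> \<open>Sequences whose first word ends right after height k, so that the shift leaves
    this word.\<close>
  define d where "d = (\<lambda>k. {g \<in> space BP. length (g 0) = Suc k \<and> shift_by (int (Suc k)) (biconcat g) \<in> B})"
  have Bs: "left_shift -` B \<inter> space tower \<in> sets tower" using measurable_sets[OF left_shift_tower B] .
  have bm: "base k B \<in> sets BP" for k using base_sets B unfolding sets_tower by blast
  have sm: "{g \<in> space BP. shift_by l (biconcat g) \<in> B} \<in> sets BP" for l
  proof -
    obtain C where C: "C \<in> sets borel" "B = Z \<inter> C" using B unfolding sets_tower by (auto simp: sets_restrict_space)
    have "(\<lambda>g. shift_by l (biconcat g)) -` C \<inter> space BP \<in> sets BP"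
      by (rule measurable_sets[OF biconcat_shift_measurable C(1)])
    moreover have "(\<lambda>g. shift_by l (biconcat g)) -` C \<inter> space BP = {g \<in> space BP. shift_by l (biconcat g) \<in> B}"
      unfolding C(2) using biconcat_in_Z by auto
    ultimately show ?thesis by simp
  qed
  have dm: "d k \<in> sets BP" for k
  proof -
    have "d k = {g \<in> space BP. length (g 0) = Suc k} \<inter> {g \<in> space BP. shift_by (int (Suc k)) (biconcat g) \<in> B}"
      unfolding d_def by auto
    then show ?thesis using sm sets_length[of "\<lambda>l. l = Suc k"] by auto
  qed
  have split: "?m (base k (left_shift -` B \<inter> space tower)) = e (Suc k) + ?m (d k)" for k
  proof -
    have "base k (left_shift -` B \<inter> space tower) = base (Suc k) B \<union> d k"
    proof (rule set_eqI)
      fix g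
      have "shift_by (int k) (biconcat g) \<in> left_shift -` B \<inter> space tower \<longleftrightarrow> shift_by (int (Suc k)) (biconcat g) \<in> B"
        if "g \<in> space BP" using biconcat_in_Z[OF that] by (simp add: space_tower left_shift_eq_shift add.commute)
      then show "g \<in> base k (left_shift -` B \<inter> space tower) \<longleftrightarrow> g \<in> base (Suc k) B \<union> d k"
        unfolding base_def d_def by (auto simp del: of_nat_Suc)
    qed
    moreover have "base (Suc k) B \<inter> d k = {}" unfolding base_def d_def by auto
    ultimately show ?thesis unfolding e_def using BP.finite_measure_Union[OF bm dm] by simp
  qed
  \<comment> \<open>The highest level is \<open>maxlen\<close> - 1; the vanishing term closes the
    telescoping sum.\<close>
  have e_last: "e maxlen = 0"
  proof -
    have "base maxlen B = {}"
      unfolding base_def space_BP using length_le_maxlen by (auto simp: not_less[symmetric])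
    then show ?thesis by (simp add: e_def)
  qed
  have sum_d: "(\<Sum>k<maxlen. ?m (d k)) = e 0"
  proof -
    let ?A = "{g \<in> space BP. shift_by 0 (biconcat g) \<in> B}"
    have "(\<Sum>k<maxlen. ?m (d k)) = ?m (\<Union>k<maxlen. d k)"
      using dm by (intro BP.finite_measure_finite_Union[symmetric]) (auto simp: disjoint_family_on_def d_def)
    also have "(\<Union>k<maxlen. d k) = {g \<in> space BP. (\<lambda>i. g (i + 1)) \<in> ?A}"
    proof (rule set_eqI)
      fix g
      show "g \<in> (\<Union>k<maxlen. d k) \<longleftrightarrow> g \<in> {g \<in> space BP. (\<lambda>i. g (i + 1)) \<in> ?A}"
      proof (cases "g \<in> space BP")
        case True
        then have g: "range g \<subseteq> V" unfolding space_BP by simp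
        then have ne: "[] \<notin> range g" using V by blast
        have g0: "g 0 \<in> V" using g by auto
        obtain k where k: "length (g 0) = Suc k" using length_pos[OF g0] gr0_implies_Suc by blast
        have "k < maxlen" using length_le_maxlen[OF g0] k by simp
        then have "g \<in> (\<Union>k<maxlen. d k) \<longleftrightarrow> shift_by (int (length (g 0))) (biconcat g) \<in> B"
          unfolding d_def using True k by auto
        also have "shift_by (int (length (g 0))) (biconcat g) = biconcat (\<lambda>i. g (i + 1))"
          using biconcat_shift[OF ne, of 1] word_start_Suc[of g 0] by simp
        finally have 1: "g \<in> (\<Union>k<maxlen. d k) \<longleftrightarrow> biconcat (\<lambda>i. g (i + 1)) \<in> B" .
        have "(\<lambda>i. g (i + 1)) \<in> space BP" using g unfolding space_BP by auto
        then show ?thesis using True 1 by simp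
      next
        case False
        then show ?thesis by (auto simp: d_def)
      qed
    qed
    also have "?m \<dots> = ?m ?A" by (rule BP_shift_invariant[OF sm])
    also have "?A = base 0 B" unfolding base_def using length_pos by (auto simp: space_BP)
    finally show ?thesis by (simp add: e_def)
  qed
  have "(\<Sum>k<maxlen. ?m (base k (left_shift -` B \<inter> space tower))) = (\<Sum>k<maxlen. e (Suc k)) + e 0"
    by (simp only: split sum.distrib sum_d)
  also have "\<dots> = (\<Sum>k<Suc maxlen. e k)" by (simp only: sum.lessThan_Suc_shift add.commute)
  also have "\<dots> = (\<Sum>k<maxlen. e k)" using e_last by simp
  finally show ?thesis unfolding measure_tower[OF Bs] measure_tower[OF B] e_def by simp
qed

lemma tower_invariant: "tower \<in> invariant_measures Z"
  unfolding invariant_measures_def mem_Collect_eq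
proof (intro conjI sets_tower prob_space_tower left_shift_tower)
  interpret T: prob_space tower by (rule prob_space_tower)
  show "distr tower tower left_shift = tower"
  proof (rule measure_eqI)
    fix B assume "B \<in> sets (distr tower tower left_shift)"
    then have B: "B \<in> sets tower" by simp
    then show "emeasure (distr tower tower left_shift) B = emeasure tower B"
      using measure_tower_shift[OF B] by (simp add: emeasure_distr[OF left_shift_tower B] T.emeasure_eq_measure)
  qed simp
qed

end

section \<open>The lower bound\<close>

lemma nat_add_diff: "(c :: int) \<le> a \<Longrightarrow> nat (a + int b - c) = nat (a - c) + b"
  by simp

text \<open>Under the tower measure with block probabilities exp (\<psi> w - s |w|), an atom of the
  n-fold join that shows symbols and cuts fixes all complete blocks in the window once the first
  block and the offset in it are given. Its measure is thus at most a constant times exp of the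
  Birkhoff sum minus s n, and \<open>dist_entropy_ge\<close> yields a free energy of at least
  s.\<close>

lemma gibbs_block_pressure:
  fixes G F :: "'a::{finite,discrete_topology} list set"
  assumes u: "uniquely_represents G" "[] \<notin> G" and F: "F \<subseteq> G" "finite F" and N: "0 < N"
    and cont: "continuous_on (coded_shift G) \<phi>"
    and psi: "\<And>w x. w \<in> block_words F N \<Longrightarrow> x \<in> coded_shift G \<Longrightarrow> slice x 0 (length w) = w \<Longrightarrow>
       \<psi> w \<le> birkhoff \<phi> (length w) x"
    and sum1: "(\<Sum>w\<in>block_words F N. exp (\<psi> w - s * real (length w))) = 1"
  shows "ereal s \<le> pressure (coded_shift F) \<phi>"
proof -
  define V where "V = block_words F N"
  define p where "p = (\<lambda>w :: 'a list. exp (\<psi> w - s * real (length w)))"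
  let ?Z = "coded_shift F"
  have F': "[] \<notin> F" using u F by blast
  have ZG: "?Z \<subseteq> coded_shift G" by (rule coded_shift_mono[OF F(1)])
  interpret bernoulli_blocks V p ?Z
  proof
    show "finite V" "[] \<notin> V" unfolding V_def using finite_block_words[OF F(2) F'] Nil_notin_block_words[OF N] by auto
    show "0 \<le> p w" for w by (simp add: p_def)
    show "sum p V = 1" using sum1 by (simp add: p_def V_def)
    show "shift_by k (biconcat g) \<in> ?Z" if "range g \<subseteq> V" for g k
    proof -
      have "biconcat g \<in> cut_set V" using that unfolding cut_set_def by blast
      then have "biconcat g \<in> con_set F" using cut_set_block_words[OF F', of N] cut_set_subset_con_set unfolding V_def by blast
      then show ?thesis using con_set_shift con_set_subset_coded_shift by blast
    qed
    show "shift_by 1 x \<in> ?Z" if "x \<in> ?Z" for x using coded_shift_shift[OF that] .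
  qed
  interpret T: measure_preserving tower left_shift by (rule invariant_measure_preserving[OF tower_invariant])
  obtain B where B: "0 \<le> B" "\<And>x. x \<in> coded_shift G \<Longrightarrow> \<bar>\<phi> x\<bar> \<le> B"
    using continuous_coded_shift_bounded[OF cont] by blast
  have bB: "\<bar>birkhoff \<phi> n x\<bar> \<le> real n * B" if "x \<in> coded_shift G" for n x
    using birkhoff_shift_invariant_bound[of G \<phi> B x n] B(2) that by blast
  \<comment> \<open>Symbols alone might leave the block boundaries undecided; the second component
    records whether there is a cut at the origin.\<close>
  define key where "key = (\<lambda>x :: int \<Rightarrow> 'a. (x 0, x \<in> cut_set G))"
  define Pt where "Pt = (\<lambda>z. {x \<in> ?Z. key x = z}) ` UNIV - {{}}"
  have piece: "{x \<in> ?Z. key x = z} \<in> sets tower" for z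
  proof -
    obtain a b where z: "z = (a, b)" by (cases z)
    have "{x :: int \<Rightarrow> 'a. x 0 = a} \<in> sets borel"
      by (rule cylindrical_borel[of 0]) (auto simp: cylindrical_def agree_def)
    moreover have "{x. (x \<in> cut_set G) = b} \<in> sets borel"
    proof (cases b)
      case True
      then show ?thesis using borel_cut_set[OF u] by simp
    next
      case False
      then have "{x. (x \<in> cut_set G) = b} = UNIV - cut_set G" by auto
      then show ?thesis using borel_cut_set[OF u] by (metis sets.compl_sets space_borel)
    qed
    ultimately have "{x. x 0 = a} \<inter> {x. (x \<in> cut_set G) = b} \<in> sets borel" by blast
    from sets_invariant_measures[OF tower_invariant this]
    show ?thesis unfolding z key_def by (simp add: Int_def conj_ac)
  qed
  have Pt: "Pt \<in> finite_partitions tower"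
    unfolding finite_partitions_def mem_Collect_eq
  proof (intro conjI)
    show "finite Pt" unfolding Pt_def by simp
    show "Pt \<subseteq> sets tower" unfolding Pt_def using piece by auto
    show "partition_on (space tower) Pt"
      unfolding space_tower partition_on_def disjoint_def Pt_def by auto
  qed
  have key_eq: "key x = key y" if "T.label Pt x = T.label Pt y" "x \<in> ?Z" "y \<in> ?Z" for x y
  proof -
    have "T.label Pt x \<in> Pt" "x \<in> T.label Pt x" "y \<in> T.label Pt x"
      using T.label_eq_iff[OF Pt, of x] T.label_eq_iff[OF Pt, of y] that unfolding space_tower by auto
    then show ?thesis unfolding Pt_def by auto
  qed
  have fPt: "finite Pt" using Pt by (simp add: finite_partitions_def)
  note lm = T.label_meas[OF Pt]
  let ?it = "T.itinerary (T.label Pt)"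
  have inV: "length w \<le> maxlen" "1 \<le> length w" "w \<in> block_words F N" if "w \<in> V" for w
    using length_le_maxlen[OF that] length_pos[OF that] that by (auto simp: V_def Suc_le_eq)
  \<comment> \<open>At most \<open>maxlen\<close> coordinates at either end of the window lie
    outside the complete blocks, each at a cost of at most B + \<bar>s\<bar>.\<close>
  define E where "E = real (2 * maxlen) * (B + \<bar>s\<bar>)"
  have atom: "measure tower (?it n -` {?it n y} \<inter> space tower)
      \<le> real maxlen * real (card V) * exp (birkhoff \<phi> n y - s * real n + E)"
    if n: "2 * maxlen < n" and y: "y \<in> ?Z" for n y
  proof -
    let ?C = "?it n -` {?it n y} \<inter> space tower"
    let ?R = "exp (birkhoff \<phi> n y - s * real n + E)"
    have yG: "y \<in> coded_shift G" using y ZG by blast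
    have Cm: "?C \<in> sets tower"
    proof -
      have "?it n y \<in> {t. set t \<subseteq> Pt \<and> length t = n}"
        using measurable_space[OF T.itinerary_meas[OF fPt lm, of n]] y by (simp add: space_tower)
      then show ?thesis using measurable_sets[OF T.itinerary_meas[OF fPt lm, of n], of "{?it n y}"] by simp
    qed
    have single: "measure BP (base k ?C \<inter> {g \<in> space BP. g 0 = w}) \<le> ?R" if w: "w \<in> V" for k w
    proof (cases "base k ?C \<inter> {g \<in> space BP. g 0 = w} = {}")
      case True
      then show ?thesis by simp
    next
      case False
      then obtain g where g: "g \<in> space BP" "g 0 = w" "k < length w" "shift_by (int k) (biconcat g) \<in> ?C"
        unfolding base_def by auto
      have rg: "range g \<subseteq> V" using g(1) by (simp add: space_BP)
      have gV: "g j \<in> V" for j using rg by auto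
      have ne: "[] \<notin> range g" using rg V by blast
      let ?ws = "word_start g"
      have ws1: "?ws 1 = int (length w)" using word_start_Suc[of g 0] g(2) by simp
      \<comment> \<open>\<open>I\<close> is the index of the word that covers the last coordinate of
        the window. Words 1 to \<open>I\<close> - 1 are complete; word 0 has already begun and word
        \<open>I\<close> may run out of the window. The bound on n makes \<open>I\<close> at least
        1.\<close>
      obtain I where I: "?ws I \<le> int k + int n - 1" "int k + int n - 1 < ?ws (I + 1)"
        using word_start_ex[OF ne] by blast
      have sm: "strict_mono ?ws" by (rule word_start_strict_mono[OF ne])
      have "?ws 1 \<le> int k + int n - 1" using ws1 inV(1)[OF w] n by linarith
      then have "?ws 1 < ?ws (I + 1)" using I(2) by linarith
      then have I1: "1 \<le> I" using sm by (simp add: strict_mono_less)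
      have Ihi: "int k + int n - int maxlen \<le> ?ws I"
        using I(2) word_start_Suc[of g I] inV(1)[OF gV[of I]] by linarith
      have same: "key (shift_by t (biconcat g')) = key (shift_by (t - int k) y)"
        if g': "g' \<in> base k ?C" and t: "int k \<le> t" "t < int k + int n" for g' t
      proof -
        define i where "i = nat (t - int k)"
        have i: "i < n" "t - int k = int i" using t by (auto simp: i_def)
        have "shift_by (int k) (biconcat g') \<in> ?C" using g' by (simp add: base_def)
        then have "?it n (shift_by (int k) (biconcat g')) = ?it n y" and z: "shift_by (int k) (biconcat g') \<in> ?Z"
          by (auto simp: space_tower)
        then have "T.label Pt ((left_shift ^^ i) (shift_by (int k) (biconcat g'))) = T.label Pt ((left_shift ^^ i) y)"
          using i(1) by (auto simp: T.itinerary_eq_iff T.itinerary_def)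
        then have "key ((left_shift ^^ i) (shift_by (int k) (biconcat g'))) = key ((left_shift ^^ i) y)"
          by (rule key_eq) (auto simp: funpow_left_shift intro!: coded_shift_shift z y simp del: shift_by_shift_by)
        then show ?thesis unfolding funpow_left_shift shift_by_shift_by i(2)[symmetric] by simp
      qed
      have gb: "g \<in> base k ?C" using g by (simp add: base_def)
      let ?J = "{1..<I}"
      have "base k ?C \<inter> {g \<in> space BP. g 0 = w} \<subseteq> {g' \<in> space BP. \<forall>j\<in>?J. g' j = g j}"
      proof
        fix g' assume g': "g' \<in> base k ?C \<inter> {g \<in> space BP. g 0 = w}"
        then have g'b: "g' \<in> base k ?C" and g'0: "g' 0 = w" and g's: "g' \<in> space BP" by auto
        have rg': "range g' \<subseteq> V" using g's by (simp add: space_BP)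
        have keys: "key (shift_by t (biconcat g)) = key (shift_by t (biconcat g'))" if "int k \<le> t" "t < int k + int n" for t
          using same[OF gb that] same[OF g'b that] by simp
        define i where "i = nat (I - 1)"
        have i: "int i + 1 = I" using I1 by (simp add: i_def)
        have "\<forall>j. 0 \<le> j \<and> j \<le> int i \<longrightarrow> g j = g' j"
        proof (rule blocks_determined[OF u F(1) N])
          show "range g \<subseteq> block_words F N" "range g' \<subseteq> block_words F N" using rg rg' by (auto simp: V_def)
          show "g 0 = g' 0" using g(2) g'0 by simp
          show "int k \<le> int (length (g 0))" using g by simp
          show "word_start g (int i + 1) < int k + int n" using I(1) i by simp
          fix t assume t: "int k \<le> t" "t < int k + int n"
          show "shift_by t (biconcat g) \<in> cut_set G \<longleftrightarrow> shift_by t (biconcat g') \<in> cut_set G"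
            "biconcat g t = biconcat g' t"
            using keys[OF t] by (auto simp: key_def shift_by_def)
        qed
        then show "g' \<in> {g' \<in> space BP. \<forall>j\<in>?J. g' j = g j}" using g's i by auto
      qed
      then have "measure BP (base k ?C \<inter> {g \<in> space BP. g 0 = w}) \<le> measure BP {g' \<in> space BP. \<forall>j\<in>?J. g' j = g j}"
        by (intro BP.finite_measure_mono sets.sets_Collect_finite_All sets_coordinate) auto
      also have "\<dots> = (\<Prod>j\<in>?J. p (g j))" using gV by (intro measure_cylinder) auto
      also have "\<dots> = exp (\<Sum>j\<in>?J. \<psi> (g j) - s * real (length (g j)))" by (simp add: p_def exp_sum)
      also have "(\<Sum>j\<in>?J. \<psi> (g j) - s * real (length (g j))) \<le> birkhoff \<phi> n y - s * real n + E"
      proof -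
        \<comment> \<open>The sums are compared along \<open>y\<close> itself: its window shows the
          same symbols as that of \<open>g\<close>, so the shifts of \<open>y\<close> lie in the
          cylinders of the blocks and \<open>psi\<close> applies to them.\<close>
        have part: "(\<Sum>j\<in>{1..<1 + int m}. \<psi> (g j)) \<le> birkhoff \<phi> (nat (?ws (1 + int m) - ?ws 1)) (shift_by (?ws 1 - int k) y)
            \<and> (\<Sum>j\<in>{1..<1 + int m}. real (length (g j))) = real_of_int (?ws (1 + int m) - ?ws 1)"
          if "1 + int m \<le> I" for m
          using that
        proof (induction m)
          case 0
          then show ?case by (simp add: birkhoff_def)
        next
          case (Suc m)
          let ?j = "1 + int m"
          have IH: "(\<Sum>j\<in>{1..<?j}. \<psi> (g j)) \<le> birkhoff \<phi> (nat (?ws ?j - ?ws 1)) (shift_by (?ws 1 - int k) y)"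
            "(\<Sum>j\<in>{1..<?j}. real (length (g j))) = real_of_int (?ws ?j - ?ws 1)" using Suc by auto
          have ins: "{1..<1 + int (Suc m)} = insert ?j {1..<?j}" by auto
          have wsS: "?ws (1 + int (Suc m)) = ?ws ?j + int (length (g ?j))"
            using word_start_Suc[of g ?j] by (simp add: algebra_simps)
          have ge: "?ws 1 \<le> ?ws ?j" using sm by (simp add: strict_mono_less_eq)
          have hi: "?ws ?j + int (length (g ?j)) \<le> ?ws I"
            unfolding wsS[symmetric] using Suc.prems sm by (simp add: strict_mono_less_eq)
          have sl: "slice (shift_by (?ws ?j - int k) y) 0 (length (g ?j)) = g ?j"
          proof -
            have "slice (shift_by (?ws ?j - int k) y) 0 (length (g ?j)) = slice (biconcat g) (?ws ?j) (length (g ?j))"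
            proof (rule slice_cong)
              fix i assume i: "i < length (g ?j)"
              have "int k \<le> ?ws ?j + int i" using ge ws1 g(3) by linarith
              moreover have "?ws ?j + int i < int k + int n" using hi I(1) i by linarith
              ultimately have "key (shift_by (?ws ?j + int i) (biconcat g)) = key (shift_by (?ws ?j + int i - int k) y)"
                by (rule same[OF gb])
              then show "shift_by (?ws ?j - int k) y (0 + int i) = biconcat g (?ws ?j + int i)"
                by (simp add: key_def shift_by_def algebra_simps)
            qed
            then show ?thesis using slice_biconcat[OF ne] by simp
          qed
          have "\<psi> (g ?j) \<le> birkhoff \<phi> (length (g ?j)) (shift_by (?ws ?j - int k) y)"
            by (rule psi[OF inV(3)[OF gV] coded_shift_shift[OF yG] sl])
          moreover have "birkhoff \<phi> (nat (?ws (1 + int (Suc m)) - ?ws 1)) (shift_by (?ws 1 - int k) y)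
             = birkhoff \<phi> (nat (?ws ?j - ?ws 1)) (shift_by (?ws 1 - int k) y)
               + birkhoff \<phi> (length (g ?j)) (shift_by (?ws ?j - int k) y)"
          proof -
            have "nat (?ws (1 + int (Suc m)) - ?ws 1) = nat (?ws ?j - ?ws 1) + length (g ?j)"
              
              unfolding wsS by (rule nat_add_diff[OF ge])
            then show ?thesis using ge by (simp add: birkhoff_add)
          qed
          ultimately show ?case using IH unfolding ins wsS by (simp add: algebra_simps)
        qed
        define m where "m = nat (I - 1)"
        have m: "1 + int m = I" using I1 by (simp add: m_def)
        define l where "l = nat (?ws I - ?ws 1)"
        have ge: "?ws 1 \<le> ?ws I" using sm I1 by (simp add: strict_mono_less_eq)
        have l: "int l = ?ws I - ?ws 1" using ge by (simp add: l_def)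
        have "1 + int m \<le> I" using m by simp
        from part[OF this, unfolded m]
        have P1: "(\<Sum>j\<in>?J. \<psi> (g j)) \<le> birkhoff \<phi> l (shift_by (?ws 1 - int k) y)"
          and "(\<Sum>j\<in>?J. real (length (g j))) = real_of_int (?ws I - ?ws 1)"
          unfolding l_def by blast+
        then have P2: "(\<Sum>j\<in>?J. real (length (g j))) = real l" unfolding l[symmetric] by simp
        define a where "a = nat (?ws 1 - int k)"
        have a: "int a = ?ws 1 - int k" using ws1 g(3) by (simp add: a_def)
        have al: "a + l \<le> n" using a l I(1) by linarith
        \<comment> \<open>The window splits into a rest of word 0 of length \<open>a\<close>, the
          complete blocks of length \<open>l\<close>, and a final piece of length
          \<open>r\<close>.\<close>
        define r where "r = n - (a + l)"
        have n_eq: "n = a + l + r" using al by (simp add: r_def)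
        have ar: "a + r \<le> 2 * maxlen"
          using n_eq a l Ihi ws1 inV(1)[OF w] by linarith
        have "birkhoff \<phi> n y = birkhoff \<phi> a y + birkhoff \<phi> l (shift_by (int a) y) + birkhoff \<phi> r (shift_by (int (a + l)) y)"
          unfolding n_eq birkhoff_add ..
        moreover have "\<bar>birkhoff \<phi> a y\<bar> \<le> real a * B" by (rule bB[OF yG])
        moreover have "\<bar>birkhoff \<phi> r (shift_by (int (a + l)) y)\<bar> \<le> real r * B" by (rule bB[OF coded_shift_shift[OF yG]])
        ultimately have "birkhoff \<phi> l (shift_by (int a) y) \<le> birkhoff \<phi> n y + real (a + r) * B"
          by (simp add: algebra_simps abs_le_iff)
        moreover have "- s * real l \<le> - s * real n + real (a + r) * \<bar>s\<bar>"
        proof -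
          have "s * real (a + r) \<le> \<bar>s\<bar> * real (a + r)" by (intro mult_right_mono) auto
          then show ?thesis unfolding n_eq by (simp add: algebra_simps)
        qed
        moreover have "real (a + r) * (B + \<bar>s\<bar>) \<le> E"
          unfolding E_def using ar B(1) by (intro mult_right_mono of_nat_mono) auto
        ultimately show ?thesis
          using P1 unfolding a[symmetric] sum_subtractf sum_distrib_left[symmetric] P2
          by (simp add: algebra_simps)
      qed
      finally show ?thesis by simp
    qed
    have bk: "measure BP (base k ?C) \<le> real (card V) * ?R" for k
    proof -
      have bm: "base k ?C \<in> sets BP" using base_sets Cm unfolding sets_tower by blast
      have "base k ?C = (\<Union>w\<in>V. base k ?C \<inter> {g \<in> space BP. g 0 = w})"
        unfolding base_def space_BP by auto
      then have "measure BP (base k ?C) = measure BP (\<Union>w\<in>V. base k ?C \<inter> {g \<in> space BP. g 0 = w})" by simp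
      also have "\<dots> \<le> (\<Sum>w\<in>V. measure BP (base k ?C \<inter> {g \<in> space BP. g 0 = w}))"
        using V(1) bm sets_coordinate by (intro BP.finite_measure_subadditive_finite) auto
      also have "\<dots> \<le> (\<Sum>w\<in>V. ?R)" using single by (intro sum_mono) auto
      finally show ?thesis by simp
    qed
    have "measure tower ?C = (\<Sum>k<maxlen. measure BP (base k ?C)) / mean" by (rule measure_tower[OF Cm])
    also have "\<dots> \<le> (\<Sum>k<maxlen. measure BP (base k ?C)) / 1"
      using mean_ge_1 by (intro divide_left_mono sum_nonneg) auto
    also have "\<dots> = (\<Sum>k<maxlen. measure BP (base k ?C))" by simp
    also have "\<dots> \<le> (\<Sum>k<maxlen. real (card V) * ?R)" by (intro sum_mono bk)
    finally show ?thesis by simp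
  qed
  have Vne: "V \<noteq> {}" using p(2) by auto
  then have cV: "1 \<le> real (card V)" using V(1) by (simp add: Suc_le_eq card_gt_0_iff)
  have ml: "1 \<le> real maxlen" using Vne inV by fastforce
  \<comment> \<open>The logarithm counts the choices of the offset and of the first block.\<close>
  define K where "K = E + ln (real maxlen * real (card V))"
  have \<phi>Z: "continuous_on ?Z \<phi>" using cont ZG by (rule continuous_on_subset)
  have \<phi>m: "\<phi> \<in> borel_measurable tower" by (rule continuous_measurable_invariant[OF tower_invariant \<phi>Z])
  have \<phi>i: "integrable tower \<phi>"
    by (rule T.integrable_const_bound[of _ B]) (use \<phi>m B(2) ZG space_tower in auto)
  have \<phi>i': "integrable tower (\<lambda>x. \<phi> (shift_by (int i) x))" "(\<integral>x. \<phi> (shift_by (int i) x) \<partial>tower) = (\<integral>x. \<phi> x \<partial>tower)" for i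
    using T.integrable_funpow[OF \<phi>i, of i] T.integral_funpow[OF \<phi>m, of i] unfolding funpow_left_shift by auto
  have Si: "integrable tower (birkhoff \<phi> n)" "(\<integral>x. birkhoff \<phi> n x \<partial>tower) = real n * (\<integral>x. \<phi> x \<partial>tower)" for n
    unfolding birkhoff_def using \<phi>i' by (auto simp: Bochner_Integration.integral_sum)
  have H: "real n * (s - (\<integral>x. \<phi> x \<partial>tower)) - K \<le> T.itin_entropy (T.label Pt) Pt n" if n: "2 * maxlen < n" for n
  proof -
    define D where "D = (\<lambda>x. s * real n - birkhoff \<phi> n x - K)"
    have Di: "integrable tower D" unfolding D_def using Si(1) by (intro Bochner_Integration.integrable_diff) auto
    have "(\<integral>x. D x \<partial>tower) \<le> T.itin_entropy (T.label Pt) Pt n"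
    proof (rule T.dist_entropy_ge[OF _ T.itinerary_meas[OF fPt lm] Di])
      show "finite {t. set t \<subseteq> Pt \<and> length t = n}" by (rule finite_lists_length_eq[OF fPt])
      show "AE x in tower. measure tower (?it n -` {?it n x} \<inter> space tower) \<le> exp (- D x)"
      proof (rule AE_I2)
        fix x assume "x \<in> space tower"
        then have "x \<in> ?Z" by (simp add: space_tower)
        have "exp (- D x) = exp (birkhoff \<phi> n x - s * real n + E) * exp (ln (real maxlen * real (card V)))"
          unfolding D_def K_def by (simp add: exp_add[symmetric] algebra_simps)
        also have "exp (ln (real maxlen * real (card V))) = real maxlen * real (card V)"
          using cV ml by (intro exp_ln mult_pos_pos) auto
        finally show "measure tower (?it n -` {?it n x} \<inter> space tower) \<le> exp (- D x)"
          using atom[OF n \<open>x \<in> ?Z\<close>] by (simp add: mult.commute)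
      qed
    qed
    moreover have "(\<integral>x. D x \<partial>tower) = real n * (s - (\<integral>x. \<phi> x \<partial>tower)) - K"
      unfolding D_def using Si by (simp add: T.prob_space algebra_simps)
    ultimately show ?thesis by simp
  qed
  have "s - (\<integral>x. \<phi> x \<partial>tower) \<le> entropy_of_partition tower left_shift Pt"
  proof (rule LIMSEQ_le[OF _ T.entropy_of_partition_limit[OF Pt]])
    let ?b = "s - (\<integral>x. \<phi> x \<partial>tower)"
    show "(\<lambda>n. ?b + (- K) / real n) \<longlonglongrightarrow> ?b"
      using tendsto_add[OF tendsto_const lim_const_over_n, of ?b "- K"] by simp
    show "\<exists>n0. \<forall>n\<ge>n0. ?b + (- K) / real n \<le> T.itin_entropy (T.label Pt) Pt n / real n"
    proof (intro exI[of _ "Suc (2 * maxlen)"] allI impI)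
      fix n assume n: "Suc (2 * maxlen) \<le> n"
      then have "?b + (- K) / real n = (real n * ?b - K) / real n" by (simp add: field_simps)
      also have "\<dots> \<le> T.itin_entropy (T.label Pt) Pt n / real n" using H[of n] n by (intro divide_right_mono) auto
      finally show "?b + (- K) / real n \<le> T.itin_entropy (T.label Pt) Pt n / real n" .
    qed
  qed
  then have "ereal (s - (\<integral>x. \<phi> x \<partial>tower)) \<le> ereal (entropy_of_partition tower left_shift Pt)" by simp
  also have "\<dots> \<le> ks_entropy tower left_shift" unfolding ks_entropy_def by (rule SUP_upper[OF Pt])
  finally have "ereal (s - (\<integral>x. \<phi> x \<partial>tower)) + ereal (\<integral>x. \<phi> x \<partial>tower) \<le> free_energy \<phi> tower"
    unfolding free_energy_def by (rule add_right_mono)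
  also have "\<dots> \<le> pressure ?Z \<phi>" unfolding pressure_def by (rule SUP_upper[OF tower_invariant])
  finally show ?thesis by simp
qed

text \<open>If the sum exceeded 1 at c, then by continuity it would equal 1 at some s \<ge> c; the
  Gibbs measure at s gives s \<le> pressure \<le> c, so s = c, a contradiction.\<close>

lemma block_weight_sum_le_1:
  fixes G F :: "'a::{finite,discrete_topology} list set"
  assumes u: "uniquely_represents G" "[] \<notin> G" and F: "F \<subseteq> G" "finite F" and N: "0 < N"
    and cont: "continuous_on (coded_shift G) \<phi>"
    and psi: "\<And>w x. w \<in> block_words F N \<Longrightarrow> x \<in> coded_shift G \<Longrightarrow> slice x 0 (length w) = w \<Longrightarrow>
       \<psi> w \<le> birkhoff \<phi> (length w) x"
    and c: "pressure (coded_shift F) \<phi> \<le> ereal c"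
  shows "(\<Sum>w\<in>block_words F N. exp (\<psi> w - c * real (length w))) \<le> 1"
proof (rule ccontr)
  define f where "f = (\<lambda>t. \<Sum>w\<in>block_words F N. exp (\<psi> w - t * real (length w)))"
  assume "\<not> ?thesis"
  then have fc: "1 < f c" by (simp add: f_def)
  \<comment> \<open>Each block has at least one letter, so raising c by ln (f c) divides the sum at
    least by f c. This provides the right end for the intermediate value theorem.\<close>
  define t where "t = c + ln (f c)"
  have t: "c \<le> t" using fc by (simp add: t_def)
  have ft: "f t = (\<Sum>w\<in>block_words F N. exp (\<psi> w - t * real (length w)))" by (simp add: f_def)
  have "f t \<le> (\<Sum>w\<in>block_words F N. exp (\<psi> w - c * real (length w)) * exp (- ln (f c)))"
    unfolding ft
  proof (rule sum_mono)
    fix w assume "w \<in> block_words F N"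
    then have "1 \<le> length w" using length_block_words[of w F N] N by simp
    then have "ln (f c) * 1 \<le> ln (f c) * real (length w)" using fc by (intro mult_left_mono) auto
    then show "exp (\<psi> w - t * real (length w)) \<le> exp (\<psi> w - c * real (length w)) * exp (- ln (f c))"
      unfolding t_def by (simp add: exp_add[symmetric] algebra_simps)
  qed
  also have "\<dots> = f c * exp (- ln (f c))" by (simp add: f_def sum_distrib_right)
  also have "\<dots> = 1" using fc by (simp add: exp_minus)
  finally have "f t \<le> 1" .
  moreover have "continuous_on {c..t} f" unfolding f_def by (intro continuous_intros)
  ultimately obtain s where s: "c \<le> s" "s \<le> t" "f s = 1" using IVT2'[of f t 1 c] fc t by auto
  have "ereal s \<le> pressure (coded_shift F) \<phi>"
    by (rule gibbs_block_pressure[OF u F N cont psi]) (use s(3) in \<open>auto simp: f_def\<close>)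
  then have "ereal s \<le> ereal c" using c by (rule order_trans)
  then have "s = c" using s(1) by simp
  then show False using s(3) fc by simp
qed

section \<open>Approximation from inside\<close>

text \<open>Invariant measures here have the subshift as their space, so a measure on a smaller
  subshift must be carried along the inclusion before the suprema can be compared.\<close>

definition extend_measure :: "(int \<Rightarrow> 'a::topological_space) measure \<Rightarrow> (int \<Rightarrow> 'a) set \<Rightarrow> (int \<Rightarrow> 'a) measure" where
  "extend_measure \<mu> Z = distr \<mu> (restrict_space borel Z) (\<lambda>x. x)"

context
  fixes Z Z' :: "(int \<Rightarrow> 'a::topological_space) set" and \<mu>
  assumes mu: "\<mu> \<in> invariant_measures Z" and Zb: "Z \<in> sets borel" and ZZ': "Z \<subseteq> Z'"
    and Z': "\<And>x. x \<in> Z' \<Longrightarrow> shift_by 1 x \<in> Z'"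
begin

interpretation M: measure_preserving \<mu> left_shift by (rule invariant_measure_preserving[OF mu])

lemma inclusion_measurable: "(\<lambda>x. x) \<in> \<mu> \<rightarrow>\<^sub>M restrict_space borel Z'"
proof (rule measurable_restrict_space2)
  have s: "sets \<mu> = sets (restrict_space borel Z)" using mu by (simp add: invariant_measures_def)
  show "(\<lambda>x. x) \<in> \<mu> \<rightarrow>\<^sub>M borel"
    unfolding measurable_cong_sets[OF s refl] by (intro measurable_restrict_space1) simp
qed (use ZZ' space_invariant_measures[OF mu] in auto)

lemma sets_extend: "sets (extend_measure \<mu> Z') = sets (restrict_space borel Z')"
  by (simp add: extend_measure_def)

lemma emeasure_extend:
  assumes "A \<in> sets (restrict_space borel Z')"
  shows "emeasure (extend_measure \<mu> Z') A = emeasure \<mu> (A \<inter> Z)"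
  unfolding extend_measure_def using emeasure_distr[OF inclusion_measurable assms] space_invariant_measures[OF mu]
  by (simp add: vimage_def Int_def)

lemma measure_extend:
  assumes "A \<in> sets (restrict_space borel Z')"
  shows "measure (extend_measure \<mu> Z') A = measure \<mu> (A \<inter> Z)"
  by (simp add: measure_def emeasure_extend[OF assms])

lemma space_extend: "space (extend_measure \<mu> Z') = Z'"
  by (simp add: extend_measure_def space_restrict_space)

lemma extend_invariant: "extend_measure \<mu> Z' \<in> invariant_measures Z'"
  unfolding invariant_measures_def mem_Collect_eq
proof (intro conjI sets_extend)
  show "prob_space (extend_measure \<mu> Z')"
    unfolding extend_measure_def by (rule M.prob_space_distr[OF inclusion_measurable])
  show ls: "left_shift \<in> extend_measure \<mu> Z' \<rightarrow>\<^sub>M extend_measure \<mu> Z'"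
    unfolding measurable_cong_sets[OF sets_extend sets_extend] left_shift_eq_shift
    by (intro measurable_restrict_space3 shift_measurable) (use Z' in auto)
  show "distr (extend_measure \<mu> Z') (extend_measure \<mu> Z') left_shift = extend_measure \<mu> Z'"
  proof (rule measure_eqI)
    fix A assume "A \<in> sets (distr (extend_measure \<mu> Z') (extend_measure \<mu> Z') left_shift)"
    then have A: "A \<in> sets (extend_measure \<mu> Z')" by simp
    have AZ: "A \<inter> Z \<in> sets \<mu>"
    proof -
      have "(\<lambda>x. x) -` A \<inter> space \<mu> \<in> sets \<mu>" using measurable_sets[OF inclusion_measurable] A unfolding sets_extend by blast
      then show ?thesis using space_invariant_measures[OF mu] by (simp add: vimage_def Int_def)
    qed
    have pre: "left_shift -` A \<inter> Z' \<in> sets (restrict_space borel Z')"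
      using measurable_sets[OF ls A] unfolding space_extend sets_extend .
    have "emeasure (distr (extend_measure \<mu> Z') (extend_measure \<mu> Z') left_shift) A
        = emeasure (extend_measure \<mu> Z') (left_shift -` A \<inter> Z')"
      using emeasure_distr[OF ls A] by (simp add: space_extend)
    also have "\<dots> = emeasure \<mu> (left_shift -` A \<inter> Z' \<inter> Z)" by (rule emeasure_extend[OF pre])
    also have "left_shift -` A \<inter> Z' \<inter> Z = left_shift -` (A \<inter> Z) \<inter> space \<mu>"
      using ZZ' measurable_space[OF M.T_meas] unfolding space_invariant_measures[OF mu] by auto
    also have "emeasure \<mu> \<dots> = emeasure (distr \<mu> \<mu> left_shift) (A \<inter> Z)"
      using emeasure_distr[OF M.T_meas AZ] by simp
    also have "\<dots> = emeasure \<mu> (A \<inter> Z)" unfolding M.T_inv ..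
    also have "\<dots> = emeasure (extend_measure \<mu> Z') A" using emeasure_extend A unfolding sets_extend by simp
    finally show "emeasure (distr (extend_measure \<mu> Z') (extend_measure \<mu> Z') left_shift) A = emeasure (extend_measure \<mu> Z') A" .
  qed simp
qed

interpretation M': measure_preserving "extend_measure \<mu> Z'" left_shift by (rule invariant_measure_preserving[OF extend_invariant])

text \<open>A partition of \<open>Z\<close> becomes one of \<open>Z'\<close> by adding the null
  piece \<open>Z' - Z\<close>. Orbits from \<open>Z\<close> never visit it, so the itineraries, and
  with them the entropy, remain the same.\<close>

lemma ks_entropy_extend: "ks_entropy \<mu> left_shift \<le> ks_entropy (extend_measure \<mu> Z') left_shift"
  unfolding ks_entropy_def
proof (rule SUP_least)
  fix P assume P: "P \<in> finite_partitions \<mu>"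
  have sp: "space \<mu> = Z" by (rule space_invariant_measures[OF mu])
  have s: "sets \<mu> = sets (restrict_space borel Z)" using mu by (simp add: invariant_measures_def)
  \<comment> \<open>The difference with {{}} covers Z = Z', because partitions contain no empty
    piece.\<close>
  define P' where "P' = P \<union> ({Z' - Z} - {{}})"
  have sub: "sets \<mu> \<subseteq> sets (extend_measure \<mu> Z')"
  proof
    fix A assume "A \<in> sets \<mu>"
    then obtain B where B: "B \<in> sets borel" "A = Z \<inter> B" unfolding s by (auto simp: sets_restrict_space)
    then have "A = Z' \<inter> (Z \<inter> B)" using ZZ' by auto
    then show "A \<in> sets (extend_measure \<mu> Z')" unfolding sets_extend sets_restrict_space using B Zb by blast
  qed
  have P': "P' \<in> finite_partitions (extend_measure \<mu> Z')"
  proof -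
    have "Z' - Z = Z' \<inter> (UNIV - Z)" by auto
    moreover have "UNIV - Z \<in> sets borel" using sets.compl_sets[OF Zb] by simp
    ultimately have "Z' - Z \<in> sets (extend_measure \<mu> Z')" unfolding sets_extend sets_restrict_space by blast
    moreover have "partition_on (space (extend_measure \<mu> Z')) P'"
    proof -
      have p: "partition_on Z P" using P unfolding finite_partitions_def sp by simp
      show ?thesis unfolding space_extend
      proof (rule partition_onI)
        show "\<Union>P' = Z'" using p ZZ' unfolding P'_def partition_on_def by auto
        have AZ: "A \<subseteq> Z" if "A \<in> P" for A using p that unfolding partition_on_def by blast
        have dP: "A \<inter> B = {}" if "A \<in> P" "B \<in> P" "A \<noteq> B" for A B
          using p that unfolding partition_on_def disjoint_def by blast
        show "disjnt A B" if AB: "A \<in> P'" "B \<in> P'" "A \<noteq> B" for A B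
          using AB AZ[of A] AZ[of B] dP[of A B] unfolding P'_def disjnt_def by auto
        show "{} \<notin> P'" using p unfolding P'_def partition_on_def by auto
      qed
    qed
    ultimately show ?thesis using P sub unfolding finite_partitions_def P'_def by auto
  qed
  have fP: "finite P" and fP': "finite P'" using P P' by (auto simp: finite_partitions_def)
  have lab: "M.label P' x = M.label P x" if "x \<in> Z" for x
  proof -
    have "M.label P x \<in> P" "x \<in> M.label P x" using M.label_eq_iff[OF P, of x] that sp by auto
    then show ?thesis using M'.label_eq_iff(1)[OF P', of x "M.label P x"] that ZZ' space_extend
      unfolding P'_def by auto
  qed
  have orb: "(left_shift ^^ i) x \<in> Z" if "x \<in> Z" for x i
    using measurable_space[OF M.funpow_meas, of x i] that unfolding sp by simp
  have itin: "M.itinerary (M.label P') n x = M.itinerary (M.label P) n x" if "x \<in> Z" for x n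
    unfolding M.itinerary_def using lab orb[OF that] by simp
  have ent: "M'.itin_entropy (M.label P') P' n = M.itin_entropy (M.label P) P n" for n
  proof -
    let ?W = "{t. set t \<subseteq> P \<and> length t = n}" and ?W' = "{t. set t \<subseteq> P' \<and> length t = n}"
    let ?m = "\<lambda>t. measure \<mu> (M.itinerary (M.label P) n -` {t} \<inter> space \<mu>)"
    have m': "measure (extend_measure \<mu> Z') (M.itinerary (M.label P') n -` {t} \<inter> space (extend_measure \<mu> Z')) = ?m t"
      if t: "t \<in> ?W'" for t
    proof -
      have "M.itinerary (M.label P') n -` {t} \<inter> space (extend_measure \<mu> Z') \<in> sets (restrict_space borel Z')"
        using measurable_sets[OF M'.itinerary_meas[OF fP' M'.label_meas[OF P'], of n], of "{t}"] t unfolding sets_extend by simp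
      from measure_extend[OF this]
      have "measure (extend_measure \<mu> Z') (M.itinerary (M.label P') n -` {t} \<inter> space (extend_measure \<mu> Z'))
          = measure \<mu> (M.itinerary (M.label P') n -` {t} \<inter> Z' \<inter> Z)" unfolding space_extend .
      also have "M.itinerary (M.label P') n -` {t} \<inter> Z' \<inter> Z = M.itinerary (M.label P) n -` {t} \<inter> space \<mu>"
        using itin ZZ' unfolding sp by auto
      finally show ?thesis .
    qed
    have "(\<Sum>t\<in>?W'. ?m t * ln (?m t)) = (\<Sum>t\<in>?W. ?m t * ln (?m t))"
    proof (rule sum.mono_neutral_right)
      show "finite ?W'" by (rule finite_lists_length_eq[OF fP'])
      show "?W \<subseteq> ?W'" unfolding P'_def by auto
      show "\<forall>t\<in>?W' - ?W. ?m t * ln (?m t) = 0"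
      proof
        fix t assume t: "t \<in> ?W' - ?W"
        have "M.itinerary (M.label P) n x \<in> ?W" if "x \<in> space \<mu>" for x
          using measurable_space[OF M.itinerary_meas[OF fP M.label_meas[OF P], of n] that] by simp
        then have "M.itinerary (M.label P) n -` {t} \<inter> space \<mu> = {}" using t by blast
        then show "?m t * ln (?m t) = 0" by simp
      qed
    qed
    then show ?thesis unfolding dist_entropy_def using m' by simp
  qed
  have "entropy_of_partition (extend_measure \<mu> Z') left_shift P' = entropy_of_partition \<mu> left_shift P"
    using LIMSEQ_unique[OF M'.entropy_of_partition_limit[OF P', unfolded ent] M.entropy_of_partition_limit[OF P]] .
  then show "ereal (entropy_of_partition \<mu> left_shift P)
      \<le> (SUP P\<in>finite_partitions (extend_measure \<mu> Z'). ereal (entropy_of_partition (extend_measure \<mu> Z') left_shift P))"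
    by (intro SUP_upper2[OF P']) simp
qed

lemma free_energy_extend:
  assumes "continuous_on Z' \<phi>"
  shows "free_energy \<phi> \<mu> \<le> free_energy \<phi> (extend_measure \<mu> Z')"
proof -
  have "(\<integral>x. \<phi> x \<partial>extend_measure \<mu> Z') = (\<integral>x. \<phi> x \<partial>\<mu>)"
    unfolding extend_measure_def
    using integral_distr[OF inclusion_measurable borel_measurable_continuous_on_restrict[OF assms]] by simp
  then show ?thesis unfolding free_energy_def using ks_entropy_extend by (simp add: add_right_mono)
qed

end

lemma borel_coded_shift: "coded_shift G \<in> sets borel"
  unfolding coded_shift_def by simp

lemma pressure_mono:
  fixes F G :: "'a::discrete_topology list set"
  assumes FG: "F \<subseteq> G" and cont: "continuous_on (coded_shift G) \<phi>"
  shows "pressure (coded_shift F) \<phi> \<le> pressure (coded_shift G) \<phi>"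
  unfolding pressure_def
proof (rule SUP_mono)
  fix \<mu> assume mu: "\<mu> \<in> invariant_measures (coded_shift F)"
  note ext = mu borel_coded_shift coded_shift_mono[OF FG] coded_shift_shift[of _ G 1]
  show "\<exists>\<nu>\<in>invariant_measures (coded_shift G). free_energy \<phi> \<mu> \<le> free_energy \<phi> \<nu>"
    using free_energy_extend[where Z' = "coded_shift G", OF ext cont]
      extend_invariant[where Z' = "coded_shift G", OF ext] by blast
qed

text \<open>For finite \<open>F\<close> the coded shift is contained in \<open>con_set G\<close>, so
  every measure on it, carried over to the large shift, is admissible for the sequential
  pressure.\<close>

lemma pressure_le_seq_pressure:
  fixes F G :: "'a::{finite,discrete_topology} list set"
  assumes u: "uniquely_represents G" "[] \<notin> G" and F: "F \<subseteq> G" "finite F"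
    and cont: "continuous_on (coded_shift G) \<phi>"
  shows "pressure (coded_shift F) \<phi> \<le> seq_pressure \<phi> G"
  unfolding pressure_def seq_pressure_def
proof (rule SUP_mono)
  fix \<mu> assume mu: "\<mu> \<in> invariant_measures (coded_shift F)"
  note ext = mu borel_coded_shift coded_shift_mono[OF F(1)] coded_shift_shift[of _ G 1]
  interpret prob_space \<mu> using mu by (simp add: invariant_measures_def)
  have Z: "coded_shift F = con_set F" using u F by (intro coded_shift_finite) auto
  have "con_set G = coded_shift G \<inter> con_set G" using con_set_subset_coded_shift by blast
  then have "con_set G \<in> sets (restrict_space borel (coded_shift G))"
    unfolding sets_restrict_space using borel_con_set[OF u] by blast
  from emeasure_extend[where Z' = "coded_shift G", OF ext this]
  have "emeasure (extend_measure \<mu> (coded_shift G)) (con_set G) = emeasure \<mu> (con_set G \<inter> coded_shift F)" .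
  also have "con_set G \<inter> coded_shift F = space \<mu>"
    unfolding space_invariant_measures[OF mu] Z using con_set_mono[OF F(1)] by blast
  also have "emeasure \<mu> (space \<mu>) = 1" by (rule emeasure_space_1)
  finally have "extend_measure \<mu> (coded_shift G) \<in> {\<mu> \<in> invariant_measures (coded_shift G). emeasure \<mu> (con_set G) = 1}"
    using extend_invariant[where Z' = "coded_shift G", OF ext] by simp
  then show "\<exists>\<nu>\<in>{\<mu> \<in> invariant_measures (coded_shift G). emeasure \<mu> (con_set G) = 1}. free_energy \<phi> \<mu> \<le> free_energy \<phi> \<nu>"
    using free_energy_extend[where Z' = "coded_shift G", OF ext cont] by blast
qed

section \<open>Exhaustion by finite sets of generators\<close>

lemma first_generators_mono: "m \<le> n \<Longrightarrow> first_generators G e m \<subseteq> first_generators G e n"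
  unfolding first_generators_def by auto

lemma finite_first_generators: "finite (first_generators G e m)"
  unfolding first_generators_def by auto

lemma first_generators_subset: "enumerates e G \<Longrightarrow> first_generators G e m \<subseteq> G"
  unfolding first_generators_def enumerates_def bij_betw_def by auto

text \<open>The sets of first generators are cofinal among the finite subsets of \<open>G\<close>
  for every enumeration; this allows finitely many blocks to be treated inside a single one of
  them.\<close>

lemma finite_subset_first_generators:
  assumes e: "enumerates e G" and F: "finite F" "F \<subseteq> G"
  shows "\<exists>m\<ge>1. F \<subseteq> first_generators G e m"
proof -
  have "G = e ` enum_indices G" using e unfolding enumerates_def bij_betw_def by simp
  then obtain I where I: "I \<subseteq> enum_indices G" "finite I" "F = e ` I" using finite_subset_image[of F e "enum_indices G"] F by auto
  define m where "m = Suc (Max (insert 0 I))"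
  have "i < m" if "i \<in> I" for i unfolding m_def less_Suc_eq_le using I(2) that by (intro Max_ge) auto
  then have "F \<subseteq> first_generators G e m" using I unfolding first_generators_def by auto
  then show ?thesis by (intro exI[of _ m]) (simp add: m_def)
qed

text \<open>A bound on the block weights is tested on finite sets of blocks. These involve finitely
  many generators, hence lie over some first m of them, where the assumed bound on the pressure
  applies.\<close>

lemma seq_pressure_le:
  fixes G :: "'a::{finite,discrete_topology} list set"
  assumes u: "uniquely_represents G" "[] \<notin> G" and e: "enumerates e G"
    and cont: "continuous_on (coded_shift G) \<phi>"
    and c: "\<And>m. m \<ge> 1 \<Longrightarrow> pressure (coded_shift (first_generators G e m)) \<phi> \<le> ereal c"
  shows "seq_pressure \<phi> G \<le> ereal c"
  unfolding seq_pressure_def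
proof (rule SUP_least)
  fix \<mu> assume "\<mu> \<in> {\<mu> \<in> invariant_measures (coded_shift G). emeasure \<mu> (con_set G) = 1}"
  then have mu: "\<mu> \<in> invariant_measures (coded_shift G)" and full: "emeasure \<mu> (con_set G) = 1" by auto
  obtain B where B: "0 \<le> B" "\<And>x. x \<in> coded_shift G \<Longrightarrow> \<bar>\<phi> x\<bar> \<le> B"
    using continuous_coded_shift_bounded[OF cont] by blast
  let ?\<psi> = "word_weight \<phi> (coded_shift G)"
  show "free_energy \<phi> \<mu> \<le> ereal c"
  proof (rule ereal_le_epsilon2)
    fix \<epsilon> :: real assume eps: "0 < \<epsilon>"
    obtain N where N: "0 < N" "\<And>w x. N \<le> length w \<Longrightarrow> x \<in> coded_shift G \<Longrightarrow> slice x 0 (length w) = w \<Longrightarrow>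
        birkhoff \<phi> (length w) x \<le> ?\<psi> w + \<epsilon> * real (length w)"
      using birkhoff_le_word_weight[OF cont eps] by blast
    have "(\<Sum>w\<in>V. exp (?\<psi> w - c * real (length w))) \<le> 1" if V: "finite V" "V \<subseteq> block_words G N" for V
    proof -
      have "\<exists>ws. w = concat ws \<and> ws \<in> lists G \<and> ws \<noteq> [] \<and> N \<le> length (concat ws) \<and> length (concat (butlast ws)) < N"
        if "w \<in> V" for w using V(2) that unfolding block_words_def by auto
      then obtain ws where ws: "\<And>w. w \<in> V \<Longrightarrow> w = concat (ws w) \<and> ws w \<in> lists G \<and> ws w \<noteq> [] \<and>
          N \<le> length (concat (ws w)) \<and> length (concat (butlast (ws w))) < N" by metis
      have "(\<Union>w\<in>V. set (ws w)) \<subseteq> G" using ws by (auto simp: in_lists_conv_set)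
      moreover have "finite (\<Union>w\<in>V. set (ws w))" using V(1) by simp
      ultimately obtain m where m: "m \<ge> 1" "(\<Union>w\<in>V. set (ws w)) \<subseteq> first_generators G e m"
        using finite_subset_first_generators[OF e] by blast
      let ?F = "first_generators G e m"
      have "V \<subseteq> block_words ?F N"
      proof
        fix w assume w: "w \<in> V"
        then have "ws w \<in> lists ?F" using m(2) by (auto simp: in_lists_conv_set)
        then show "w \<in> block_words ?F N" unfolding block_words_def using ws[OF w] by blast
      qed
      moreover have "finite (block_words ?F N)"
        using first_generators_subset[OF e, of m] u(2) by (intro finite_block_words finite_first_generators) auto
      ultimately have "(\<Sum>w\<in>V. exp (?\<psi> w - c * real (length w))) \<le> (\<Sum>w\<in>block_words ?F N. exp (?\<psi> w - c * real (length w)))"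
        by (intro sum_mono2) auto
      also have "\<dots> \<le> 1"
        by (rule block_weight_sum_le_1[OF u first_generators_subset[OF e] finite_first_generators N(1) cont _ c[OF m(1)]])
           (rule word_weight_le[OF B(2)])
      finally show ?thesis .
    qed
    then have "ks_entropy \<mu> left_shift \<le> ereal (c + \<epsilon> - (\<integral>x. \<phi> x \<partial>\<mu>))"
      by (intro ks_entropy_le_of_block_weights[OF u mu full cont eps N(1), where \<psi> = ?\<psi>] N(2) length_block_words)
    then have "free_energy \<phi> \<mu> \<le> ereal (c + \<epsilon> - (\<integral>x. \<phi> x \<partial>\<mu>)) + ereal (\<integral>x. \<phi> x \<partial>\<mu>)"
      unfolding free_energy_def by (rule add_right_mono)
    then show "free_energy \<phi> \<mu> \<le> ereal c + ereal \<epsilon>" by simp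
  qed
qed

lemma seq_pressure_eq:
  fixes G :: "'a::{finite,discrete_topology} list set"
  assumes u: "uniquely_represents G" "[] \<notin> G" and e: "enumerates e G"
    and cont: "continuous_on (coded_shift G) \<phi>"
  shows "seq_pressure \<phi> G = (SUP m\<in>{1..}. pressure (coded_shift (first_generators G e m)) \<phi>)"
    and "(\<lambda>m. pressure (coded_shift (first_generators G e m)) \<phi>) \<longlonglongrightarrow> seq_pressure \<phi> G"
proof -
  let ?p = "\<lambda>m. pressure (coded_shift (first_generators G e m)) \<phi>"
  show eq: "seq_pressure \<phi> G = (SUP m\<in>{1..}. ?p m)"
  proof (rule antisym)
    show "seq_pressure \<phi> G \<le> (SUP m\<in>{1..}. ?p m)"
    \<comment> \<open>Testing against real upper bounds also settles infinite values of the
      supremum.\<close>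
    proof (rule ereal_le_real)
      fix c assume c: "(SUP m\<in>{1..}. ?p m) \<le> ereal c"
      show "seq_pressure \<phi> G \<le> ereal c"
      proof (rule seq_pressure_le[OF u e cont])
        fix m :: nat assume "1 \<le> m"
        then have "?p m \<le> (SUP m\<in>{1..}. ?p m)" by (intro SUP_upper) simp
        then show "?p m \<le> ereal c" using c by (rule order_trans)
      qed
    qed
    show "(SUP m\<in>{1..}. ?p m) \<le> seq_pressure \<phi> G"
      by (intro SUP_least pressure_le_seq_pressure[OF u first_generators_subset[OF e] finite_first_generators cont])
  qed
  have inc: "incseq ?p"
  proof (rule incseq_SucI)
    fix m
    have "continuous_on (coded_shift (first_generators G e (Suc m))) \<phi>"
      using cont coded_shift_mono[OF first_generators_subset[OF e]] by (rule continuous_on_subset)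
    then show "?p m \<le> ?p (Suc m)" by (intro pressure_mono first_generators_mono) auto
  qed
  \<comment> \<open>The limit theorem for monotone sequences takes the supremum from m = 0 on; by
    monotonicity the additional term does not change it.\<close>
  have "(SUP m. ?p m) = (SUP m\<in>{1..}. ?p m)"
  proof (rule antisym)
    show "(SUP m. ?p m) \<le> (SUP m\<in>{1..}. ?p m)"
      by (rule SUP_mono) (use inc in \<open>auto simp: incseq_Suc_iff intro!: bexI[of _ "Suc _"]\<close>)
    show "(SUP m\<in>{1..}. ?p m) \<le> (SUP m. ?p m)" by (rule SUP_subset_mono) auto
  qed
  then show "?p \<longlonglongrightarrow> seq_pressure \<phi> G" using LIMSEQ_SUP[OF inc] eq by simp
qed

theorem theorem1p1:
  fixes G :: "'a::{finite,discrete_topology} list set"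
    and e :: "nat \<Rightarrow> 'a list"
  assumes "countable G" and "G \<noteq> {}" and "\<forall>w\<in>G. w \<noteq> []"
    and "enumerates e G"
    and "uniquely_represents G"
  shows "(\<forall>\<phi>. continuous_on (coded_shift G) \<phi> \<longrightarrow>
           seq_pressure \<phi> G = (SUP m\<in>{1..}. pressure (coded_shift (first_generators G e m)) \<phi>) \<and>
           (\<lambda>m. pressure (coded_shift (first_generators G e m)) \<phi>) \<longlonglongrightarrow> seq_pressure \<phi> G) \<and>
         (\<forall>\<phi>. continuous_on (coded_shift G) \<phi> \<longrightarrow>
           ((\<lambda>m. pressure (coded_shift (first_generators G e m)) \<phi>) \<longlonglongrightarrow> pressure (coded_shift G) \<phi>
             \<longleftrightarrow> pressure (coded_shift G) \<phi> = seq_pressure \<phi> G)) \<and>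
         (\<forall>\<phi> e'. continuous_on (coded_shift G) \<phi> \<longrightarrow> enumerates e' G \<longrightarrow>
           convergent (\<lambda>m. pressure (coded_shift (first_generators G e' m)) \<phi>) \<and>
           lim (\<lambda>m. pressure (coded_shift (first_generators G e' m)) \<phi>) =
           lim (\<lambda>m. pressure (coded_shift (first_generators G e m)) \<phi>))"
proof -
  have ne: "[] \<notin> G" using assms(3) by blast
  note main = seq_pressure_eq[OF assms(5) ne]
  show ?thesis
  proof (intro conjI allI impI)
    fix \<phi> :: "(int \<Rightarrow> 'a) \<Rightarrow> real" assume cont: "continuous_on (coded_shift G) \<phi>"
    note lim = main(2)[OF assms(4) cont]
    show "seq_pressure \<phi> G = (SUP m\<in>{1..}. pressure (coded_shift (first_generators G e m)) \<phi>)"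
      by (rule main(1)[OF assms(4) cont])
    show "(\<lambda>m. pressure (coded_shift (first_generators G e m)) \<phi>) \<longlonglongrightarrow> seq_pressure \<phi> G" by (rule lim)
    show "(\<lambda>m. pressure (coded_shift (first_generators G e m)) \<phi>) \<longlonglongrightarrow> pressure (coded_shift G) \<phi>
        \<longleftrightarrow> pressure (coded_shift G) \<phi> = seq_pressure \<phi> G"
    proof
      assume "(\<lambda>m. pressure (coded_shift (first_generators G e m)) \<phi>) \<longlonglongrightarrow> pressure (coded_shift G) \<phi>"
      then show "pressure (coded_shift G) \<phi> = seq_pressure \<phi> G" using lim by (rule LIMSEQ_unique)
    next
      assume "pressure (coded_shift G) \<phi> = seq_pressure \<phi> G"
      then show "(\<lambda>m. pressure (coded_shift (first_generators G e m)) \<phi>) \<longlonglongrightarrow> pressure (coded_shift G) \<phi>"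
        using lim by simp
    qed
  next
    fix \<phi> :: "(int \<Rightarrow> 'a) \<Rightarrow> real" and e' assume cont: "continuous_on (coded_shift G) \<phi>" and e': "enumerates e' G"
    show "convergent (\<lambda>m. pressure (coded_shift (first_generators G e' m)) \<phi>)"
      using main(2)[OF e' cont] by (auto simp: convergent_def)
    \<comment> \<open>Both limits are \<open>seq_pressure \<phi> G\<close>, in whose definition no
      enumeration occurs.\<close>
    show "lim (\<lambda>m. pressure (coded_shift (first_generators G e' m)) \<phi>) =
        lim (\<lambda>m. pressure (coded_shift (first_generators G e m)) \<phi>)"
      using limI[OF main(2)[OF e' cont]] limI[OF main(2)[OF assms(4) cont]] by simp
  qed
qed

end
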